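(* There is a randomized algorithm that takes as input (1) oracles $\mathrm{MQ}(h)$ and $\mathrm{SAMP}(h)$ for some function $h:\{0,1\}^n\to\{0,1\}$, (2) positive integers $r$ and $\mu$, and (3) a distance parameter $\varepsilon$, which makes $\mathrm{poly}(r/\varepsilon,\mu)$ oracle calls and satisfies: (a) if $h$ is an $(r,\mu)$-factored-DNF, it accepts with probability at least $0.9$; and (b) if $\mathrm{reldist}(h,h')>\varepsilon$ for every $(r,\mu)$-factored-DNF $h'$, it rejects with probability at least $0.9$.
   Context: $\mathrm{MQ}(h)$ returns $h(x)$ on query $x$; $\mathrm{SAMP}(h)$ returns an independent uniformly random element of $h^{-1}(1)$. $\mathrm{reldist}(f,g)=|f^{-1}(1)\triangle g^{-1}(1)|/|f^{-1}(1)|$. A function $h:\{0,1\}^n\to\{0,1\}$ is an $(r,\mu)$-factored-DNF if $h=H\wedge(T_1\vee\cdots\vee T_{r'})$ for some $r'\le r$, where $H$ is a conjunction of literals of arbitrary width, $T_1,\dots,T_{r'}$ are conjunctions of literals, the variables of $H$ are disjoint from the variables appearing in $T_1,\dots,T_{r'}$, and the total number of variables appearing in $T_1,\dots,T_{r'}$ is at most $\mu$. *)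

theory Defs
  imports "HOL-Probability.Probability" "HOL-Computational_Algebra.Polynomial"
begin

definition cube :: "nat \<Rightarrow> bool list set" where
  "cube n = {x. length x = n}"

(* A function {0,1}^n -> {0,1} is represented by a predicate on all lists,
   of which only the restriction to cube n matters. *)
definition ones :: "nat \<Rightarrow> (bool list \<Rightarrow> bool) \<Rightarrow> bool list set" where
  "ones n h = {x \<in> cube n. h x}"

(* If f is identically 0, division by zero makes this 0. *)
definition reldist :: "nat \<Rightarrow> (bool list \<Rightarrow> bool) \<Rightarrow> (bool list \<Rightarrow> bool) \<Rightarrow> real" where
  "reldist n f g = real (card (sym_diff (ones n f) (ones n g))) / real (card (ones n f))"

(* The literal (i, True) is the variable x_i, and (i, False) is its negation.
   A conjunction is the set of its literals; it may be empty (constantly true)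
   or contradictory. *)
type_synonym literal = "nat \<times> bool"

definition conj_true :: "literal set \<Rightarrow> bool list \<Rightarrow> bool" where
  "conj_true T x \<longleftrightarrow> (\<forall>(i, b) \<in> T. x ! i = b)"

definition vars :: "literal set \<Rightarrow> nat set" where
  "vars T = fst ` T"

definition factored_dnf :: "nat \<Rightarrow> nat \<Rightarrow> nat \<Rightarrow> (bool list \<Rightarrow> bool) \<Rightarrow> bool" where
  "factored_dnf n r \<mu> h \<longleftrightarrow>
     (\<exists>(H :: literal set) (Ts :: literal set list).
        length Ts \<le> r \<and>
        vars H \<subseteq> {..<n} \<and> (\<Union>T\<in>set Ts. vars T) \<subseteq> {..<n} \<and>
        vars H \<inter> (\<Union>T\<in>set Ts. vars T) = {} \<and>
        card (\<Union>T\<in>set Ts. vars T) \<le> \<mu> \<and>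
        (\<forall>x\<in>cube n. h x \<longleftrightarrow> conj_true H x \<and> (\<exists>T\<in>set Ts. conj_true T x)))"

(* Randomized algorithms with oracle access, as interaction trees: stop with a
   verdict, query MQ, call SAMP, or draw a private uniform random number from
   {0..N}. The algorithm sees the oracles only through their answers. *)
datatype oracle_alg =
    Output bool
  | MQ "bool list" "bool \<Rightarrow> oracle_alg"
  | SAMP "bool list option \<Rightarrow> oracle_alg"
  | Draw nat "nat \<Rightarrow> oracle_alg"

(* There is no element to return if h is identically 0; the oracle then answers None. *)
definition samp :: "nat \<Rightarrow> (bool list \<Rightarrow> bool) \<Rightarrow> bool list option pmf" where
  "samp n h =
     (if ones n h = {} then return_pmf None else map_pmf Some (pmf_of_set (ones n h)))"

(* Joint distribution of the verdict (True = accept) and the number of oracle calls;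
   private random draws are not counted. *)
primrec run :: "nat \<Rightarrow> (bool list \<Rightarrow> bool) \<Rightarrow> oracle_alg \<Rightarrow> (bool \<times> nat) pmf" where
  "run n h (Output b) = return_pmf (b, 0)"
| "run n h (MQ x k) = map_pmf (apsnd Suc) (run n h (k (h x)))"
| "run n h (SAMP k) = map_pmf (apsnd Suc) (bind_pmf (samp n h) (\<lambda>y. run n h (k y)))"
| "run n h (Draw N k) = bind_pmf (pmf_of_set {0..N}) (\<lambda>i. run n h (k i))"

definition prob_accept :: "nat \<Rightarrow> (bool list \<Rightarrow> bool) \<Rightarrow> oracle_alg \<Rightarrow> real" where
  "prob_accept n h A = measure_pmf.prob (run n h A) {(b, c). b}"

definition prob_reject :: "nat \<Rightarrow> (bool list \<Rightarrow> bool) \<Rightarrow> oracle_alg \<Rightarrow> real" where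
  "prob_reject n h A = measure_pmf.prob (run n h A) {(b, c). \<not> b}"

end

theory Submission
  imports Defs
begin

text \<open>
  Identify points of the cube with subsets of \<open>{..<n}\<close>, let \<open>S\<close> be the set of ones of \<open>h\<close>, and split
  the variables at random into \<open>l\<close> blocks, so that the at most \<open>\<mu>\<close> variables of the terms are
  separated. The tester finds relevant blocks one at a time. For each of them it knows a point
  \<open>z\<close> of \<open>S\<close> and a change \<open>d\<close> inside the block that leads out of \<open>S\<close>; substituting the block of \<open>x\<close>
  into \<open>z\<close> then reads off the relevant variable of the block in \<open>x\<close> with one query. The answers form the
  pattern of \<open>x\<close>, and adding the changes \<open>d\<close> of the blocks in the pattern normalizes \<open>x\<close>. For a
  factored DNF the points of \<open>S\<close> with a given pattern are translates of a single subcube, up to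
  irrelevant blocks. Hence \<open>x \<oplus> (m \<inter> (u \<oplus> v))\<close>, with normalized samples \<open>u\<close>, \<open>v\<close> and a random mask
  \<open>m\<close>, stays in \<open>S\<close> with the pattern of \<open>x\<close>; if it leaves \<open>S\<close>, a path from \<open>x\<close> to that point that
  changes one block at a time reveals a new relevant block, which happens at most \<open>\<mu>\<close> times.

  Conversely, suppose that this test nearly always succeeds, and let \<open>g v\<close> be the probability that
  translation by \<open>v\<close> moves a sample out of \<open>S\<close> or changes its pattern. Then \<open>g\<close> is subadditive and has
  a gap: \<open>g v \<le> 3/4\<close> forces \<open>g v\<close> to be tiny. The vectors below the gap therefore form a
  linear space, and the masks make it a coordinate subspace. So \<open>S\<close> is close to a union of parallel
  subcubes indexed by a set of patterns, independently of \<open>n\<close>. It remains to test that this set of patterns is an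
  \<open>r\<close>-term DNF: take the smallest \<open>r\<close>-term DNF that contains the patterns of enough samples, and test
  that random points of it give elements of \<open>S\<close>.
\<close>

text \<open>The ones of \<open>h\<close> may be a tiny part of the cube, so every queried point is
  assembled from samples of \<open>S\<close>. No bound may depend on \<open>n\<close>, so errors
  cannot be summed over coordinates: adding a coordinate to a harmless vector at most doubles the
  bound on \<open>g\<close>, and the gap undoes the loss. The obstacle for completeness is that
  passing all rounds does not show that every relevant block was found. The set of possible patterns
  may still vary with the unfound variables. For this reason a round also carries the pattern of one
  sample over to another, and the hypothesis is a smallest DNF: the set belonging to a typical
  sample is itself a competing DNF, so counting bounds how far the hypothesis exceeds it. The
  parameters are chosen in the order \<open>\<delta>4\<close>, \<open>k4\<close>, \<open>d3\<close>,
  \<open>k3\<close>, \<open>\<delta>\<close>, \<open>k\<close>. Detecting a failure rate of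
  \<open>\<delta>4\<close> takes more than \<open>1 / \<delta>4\<close> trials; a factored DNF may
  fail a trial with probability up to \<open>k3 * \<delta> + 2 / d3\<close>, which must be small
  against \<open>1 / k4\<close>; and \<open>k\<close> rounds must notice a failure rate of
  \<open>\<delta>\<close>.\<close>

section \<open>Computations with a bounded number of oracle calls\<close>

text \<open>The tree \<open>K a\<close> that continues the computation is a parameter, which makes such computations
  composable although the verdict of an oracle tree is only a truth value.\<close>
definition computable :: "nat \<Rightarrow> nat \<Rightarrow> ((bool list \<Rightarrow> bool) \<Rightarrow> 'a pmf) \<Rightarrow> bool" where
  "computable n q F \<longleftrightarrow> (\<exists>F'. (\<forall>h. map_pmf fst (F' h) = F h \<and> (\<forall>(a, c)\<in>set_pmf (F' h). c \<le> q)) \<and>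
     (\<forall>K. \<exists>A. \<forall>h. run n h A = bind_pmf (F' h) (\<lambda>(a, c). map_pmf (apsnd ((+) c)) (run n h (K a)))))"

lemma computableI:
  assumes "\<And>h. map_pmf fst (F' h) = F h" "\<And>h a c. (a, c) \<in> set_pmf (F' h) \<Longrightarrow> c \<le> q"
    "\<And>K. \<exists>A. \<forall>h. run n h A = bind_pmf (F' h) (\<lambda>(a, c). map_pmf (apsnd ((+) c)) (run n h (K a)))"
  shows "computable n q F"
  unfolding computable_def by (rule exI[of _ F']) (use assms in auto)

lemma computable_mono: "computable n q F \<Longrightarrow> q \<le> q' \<Longrightarrow> computable n q' F"
  unfolding computable_def by fastforce

lemma apsnd_plus_0 [simp]: "apsnd ((+) (0::nat)) = id"
  by (auto simp: fun_eq_iff)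

lemma apsnd_plus_1 [simp]: "apsnd ((+) (Suc 0)) = apsnd Suc"
  by (auto simp: fun_eq_iff)

lemma computable_return: "computable n 0 (\<lambda>h. return_pmf a)"
proof (rule computableI[where F' = "\<lambda>h. return_pmf (a, 0)"])
  fix K show "\<exists>A. \<forall>h. run n h A = return_pmf (a, 0) \<bind> (\<lambda>(a, c). map_pmf (apsnd ((+) c)) (run n h (K a)))"
    by (rule exI[of _ "K a"]) (simp add: bind_return_pmf)
qed auto

lemma computable_uniform:
  assumes "finite B" "B \<noteq> {}"
  shows "computable n 0 (\<lambda>h. pmf_of_set B)"
proof -
  obtain e where e: "bij_betw e {0..<card B} B"
    using ex_bij_betw_nat_finite[OF assms(1)] by blast
  have card: "card B > 0" using assms by (simp add: card_gt_0_iff)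
  then have "{0..card B - 1} = {0..<card B}" by auto
  with e have e': "bij_betw e {0..card B - 1} B" by simp
  have B: "pmf_of_set B = map_pmf e (pmf_of_set {0..card B - 1})"
    using e' by (subst map_pmf_of_set_bij_betw[OF e']) auto
  show ?thesis
  proof (rule computableI[where F' = "\<lambda>h. map_pmf (\<lambda>a. (a, 0)) (pmf_of_set B)"])
    fix K
    show "\<exists>A. \<forall>h. run n h A = map_pmf (\<lambda>a. (a, 0)) (pmf_of_set B) \<bind>
            (\<lambda>(a, c). map_pmf (apsnd ((+) c)) (run n h (K a)))"
      by (rule exI[of _ "Draw (card B - 1) (\<lambda>i. K (e i))"]) (simp add: B bind_map_pmf)
  qed (auto simp: pmf.map_comp o_def)
qed

lemma computable_samp: "computable n 1 (samp n)"
proof (rule computableI[where F' = "\<lambda>h. map_pmf (\<lambda>a. (a, 1)) (samp n h)"])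
  fix K
  show "\<exists>A. \<forall>h. run n h A = map_pmf (\<lambda>a. (a, 1)) (samp n h) \<bind>
          (\<lambda>(a, c). map_pmf (apsnd ((+) c)) (run n h (K a)))"
    by (rule exI[of _ "SAMP K"]) (simp add: bind_map_pmf map_bind_pmf)
qed (auto simp: pmf.map_comp o_def)

lemma computable_MQ: "computable n 1 (\<lambda>h. return_pmf (h x))"
proof (rule computableI[where F' = "\<lambda>h. return_pmf (h x, 1)"])
  fix K
  show "\<exists>A. \<forall>h. run n h A = return_pmf (h x, 1) \<bind>
          (\<lambda>(a, c). map_pmf (apsnd ((+) c)) (run n h (K a)))"
    by (rule exI[of _ "MQ x K"]) (simp add: bind_return_pmf)
qed auto

text \<open>The second budget is required only on \<open>V\<close>: the queries made in a state
  depend on how many blocks it contains, and only reachable states obey a bound.\<close>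

lemma computable_bind:
  assumes F: "computable n q F" and G: "\<And>a. a \<in> V \<Longrightarrow> computable n q' (G a)" and V: "\<And>h. set_pmf (F h) \<subseteq> V"
  shows "computable n (q + q') (\<lambda>h. bind_pmf (F h) (\<lambda>a. G a h))"
proof -
  obtain F' where F': "\<And>h. map_pmf fst (F' h) = F h" "\<And>h a c. (a, c) \<in> set_pmf (F' h) \<Longrightarrow> c \<le> q"
    and FA: "\<And>K. \<exists>A. \<forall>h. run n h A = bind_pmf (F' h) (\<lambda>(a, c). map_pmf (apsnd ((+) c)) (run n h (K a)))"
    using F unfolding computable_def by blast
  have V': "a \<in> V" if "(a, c) \<in> set_pmf (F' h)" for a c h
    using V[of h] that by (auto simp: F'(1)[symmetric] image_iff)
  have "\<forall>a. \<exists>G'. a \<in> V \<longrightarrow> ((\<forall>h. map_pmf fst (G' h) = G a h \<and> (\<forall>(b, c)\<in>set_pmf (G' h). c \<le> q')) \<and>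
     (\<forall>K. \<exists>A. \<forall>h. run n h A = bind_pmf (G' h) (\<lambda>(b, c). map_pmf (apsnd ((+) c)) (run n h (K b)))))"
    using G unfolding computable_def by blast
  then obtain G' where G': "\<And>a h. a \<in> V \<Longrightarrow> map_pmf fst (G' a h) = G a h"
      "\<And>a h b c. a \<in> V \<Longrightarrow> (b, c) \<in> set_pmf (G' a h) \<Longrightarrow> c \<le> q'"
    and GA: "\<And>a K. a \<in> V \<Longrightarrow> \<exists>A. \<forall>h. run n h A = bind_pmf (G' a h) (\<lambda>(b, c). map_pmf (apsnd ((+) c)) (run n h (K b)))"
    unfolding choice_iff by fastforce
  define H where "H = (\<lambda>h. bind_pmf (F' h) (\<lambda>(a, c). map_pmf (apsnd ((+) c)) (G' a h)))"
  show ?thesis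
  proof (rule computableI[where F' = H])
    fix h
    have "map_pmf fst (H h) = bind_pmf (F' h) (\<lambda>(a, c). map_pmf fst (G' a h))"
      unfolding H_def by (auto simp: map_bind_pmf pmf.map_comp o_def split_def)
    also have "\<dots> = bind_pmf (F' h) (\<lambda>(a, c). G a h)"
      by (intro bind_pmf_cong refl) (auto simp: G'(1) V')
    also have "\<dots> = bind_pmf (map_pmf fst (F' h)) (\<lambda>a. G a h)"
      by (simp add: bind_map_pmf split_def)
    finally show "map_pmf fst (H h) = bind_pmf (F h) (\<lambda>a. G a h)" by (simp add: F'(1))
  next
    fix h a c assume "(a, c) \<in> set_pmf (H h)"
    then show "c \<le> q + q'" unfolding H_def using F'(2) G'(2) V' by (fastforce intro: add_mono)
  next
    fix K :: "'b \<Rightarrow> oracle_alg"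
    have "\<forall>a. \<exists>A. a \<in> V \<longrightarrow> (\<forall>h. run n h A = bind_pmf (G' a h) (\<lambda>(b, c). map_pmf (apsnd ((+) c)) (run n h (K b))))"
      using GA by blast
    then obtain B where B: "\<And>a h. a \<in> V \<Longrightarrow> run n h (B a) = bind_pmf (G' a h) (\<lambda>(b, c). map_pmf (apsnd ((+) c)) (run n h (K b)))"
      unfolding choice_iff by blast
    obtain A where A: "\<And>h. run n h A = bind_pmf (F' h) (\<lambda>(a, c). map_pmf (apsnd ((+) c)) (run n h (B a)))"
      using FA by blast
    have "run n h A = H h \<bind> (\<lambda>(a, c). map_pmf (apsnd ((+) c)) (run n h (K a)))" for h
    proof -
      have "run n h A = bind_pmf (F' h) (\<lambda>(a, c). map_pmf (apsnd ((+) c))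
           (bind_pmf (G' a h) (\<lambda>(b, c). map_pmf (apsnd ((+) c)) (run n h (K b)))))"
        unfolding A by (intro bind_pmf_cong refl) (auto simp: B V')
      also have "\<dots> = H h \<bind> (\<lambda>(a, c). map_pmf (apsnd ((+) c)) (run n h (K a)))"
        unfolding H_def
        by (auto simp: bind_assoc_pmf bind_map_pmf map_bind_pmf pmf.map_comp o_def split_def
             apsnd_def map_prod_def add.assoc intro!: bind_pmf_cong map_pmf_cong)
      finally show ?thesis .
    qed
    then show "\<exists>A. \<forall>h. run n h A = H h \<bind> (\<lambda>(a, c). map_pmf (apsnd ((+) c)) (run n h (K a)))"
      by blast
  qed
qed

lemma computable_map:
  assumes "computable n q F" shows "computable n q (\<lambda>h. map_pmf f (F h))"
  using computable_bind[OF assms, of UNIV 0 "\<lambda>a h. return_pmf (f a)"]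
  by (simp add: map_pmf_def computable_return)

lemma computable_replicate:
  assumes "computable n q F" shows "computable n (k * q) (\<lambda>h. replicate_pmf k (F h))"
proof (induction k)
  case 0 show ?case by (simp add: computable_return)
next
  case (Suc k)
  have "computable n (k * q) (\<lambda>h. replicate_pmf k (F h) \<bind> (\<lambda>xs. return_pmf (x # xs)))" for x
    using computable_map[OF Suc, of "(#) x"] by (simp add: map_pmf_def)
  then show ?case
    using computable_bind[OF assms, of UNIV "k * q" "\<lambda>x h. replicate_pmf k (F h) \<bind> (\<lambda>xs. return_pmf (x # xs))"]
    by simp
qed

lemma computable_queries: "computable n (length xs) (\<lambda>h. return_pmf (map h xs))"
proof (induction xs)
  case Nil show ?case by (simp add: computable_return)
next
  case (Cons x xs)
  show ?case
    using computable_bind[OF computable_MQ[of n x], of UNIV "length xs" "\<lambda>b h. return_pmf (b # map h xs)"]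
      computable_map[OF Cons, of "(#) _"]
    by (simp add: bind_return_pmf)
qed

section \<open>Cube points as sets of coordinates, and queries fixed in advance\<close>

definition bits :: "bool list \<Rightarrow> nat set" where
  "bits xs = {i. i < length xs \<and> xs ! i}"

definition word :: "nat \<Rightarrow> nat set \<Rightarrow> bool list" where
  "word n x = map (\<lambda>i. i \<in> x) [0..<n]"

lemma length_word [simp]: "length (word n x) = n"
  and nth_word [simp]: "i < n \<Longrightarrow> word n x ! i \<longleftrightarrow> i \<in> x"
  by (auto simp: word_def)

lemma word_bits: "length xs = n \<Longrightarrow> word n (bits xs) = xs"
  by (rule nth_equalityI) (auto simp: bits_def)

lemma bits_word: "bits (word n x) = x \<inter> {..<n}"
  by (auto simp: bits_def)

lemma bits_subset: "length xs = n \<Longrightarrow> bits xs \<subseteq> {..<n}"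
  by (auto simp: bits_def)

definition depends :: "'b set \<Rightarrow> (('b \<Rightarrow> bool) \<Rightarrow> 'a) \<Rightarrow> bool" where
  "depends Q g \<longleftrightarrow> (\<forall>h h'. (\<forall>x\<in>Q. h x = h' x) \<longrightarrow> g h = g h')"

lemma dependsD: "depends Q g \<Longrightarrow> (\<And>x. x \<in> Q \<Longrightarrow> h x = h' x) \<Longrightarrow> g h = g h'"
  unfolding depends_def by blast

text \<open>All of \<open>Q\<close> is queried in advance. This may ask more than an adaptive
  computation would, but the budget reduces to a bound on \<open>card Q\<close>.\<close>

lemma computable_depends:
  assumes Q: "finite Q" "card Q \<le> q" and g: "depends Q g"
  shows "computable n q (\<lambda>h. return_pmf (g (\<lambda>x. h (word n x))))"
proof -
  obtain xs where xs: "set xs = Q" "distinct xs" using finite_distinct_list[OF Q(1)] by blast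
  have len: "length xs = card Q" using xs distinct_card by fastforce
  \<comment> \<open>Points outside \<open>Q\<close> get an arbitrary answer, which
    \<open>depends\<close> makes harmless.\<close>
  define G where "G = (\<lambda>bs. g (\<lambda>x. the (map_of (zip xs bs) x)))"
  have "g (\<lambda>x. h (word n x)) = G (map h (map (word n) xs))" for h
    unfolding G_def
  proof (rule dependsD[OF g])
    fix x assume "x \<in> Q"
    then obtain i where i: "i < length xs" "xs ! i = x" by (auto simp: xs(1)[symmetric] in_set_conv_nth)
    have "map_of (zip xs (map h (map (word n) xs))) (xs ! i) = Some (map h (map (word n) xs) ! i)"
      using i xs by (intro map_of_zip_nth) auto
    then show "h (word n x) = the (map_of (zip xs (map h (map (word n) xs))) x)" using i by simp
  qed
  then have "computable n (length xs) (\<lambda>h. return_pmf (g (\<lambda>x. h (word n x))))"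
    using computable_map[OF computable_queries[of n "map (word n) xs"], of G] by simp
  then show ?thesis using Q len by (auto intro: computable_mono)
qed

text \<open>Adaptive queries: the answers computed first choose the points that are queried
  next.\<close>

lemma computable_bind_det:
  assumes "computable n q (\<lambda>h. return_pmf (f h))" "\<And>a. a \<in> V \<Longrightarrow> computable n q' (\<lambda>h. G a h)" "\<And>h. f h \<in> V"
  shows "computable n (q + q') (\<lambda>h. G (f h) h)"
  using computable_bind[OF assms(1), of V q' G] assms(2,3) by (simp add: bind_return_pmf)

lemma computable_alg:
  assumes "computable n q F"
  shows "\<exists>A. \<forall>h. (\<forall>(b, c)\<in>set_pmf (run n h A). c \<le> q) \<and> map_pmf fst (run n h A) = F h"
proof -
  obtain F' A where F': "\<And>h. map_pmf fst (F' h) = F h" "\<And>h a c. (a, c) \<in> set_pmf (F' h) \<Longrightarrow> c \<le> q"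
    and A: "\<And>h. run n h A = bind_pmf (F' h) (\<lambda>(a, c). map_pmf (apsnd ((+) c)) (run n h (Output a)))"
    using assms unfolding computable_def by blast
  have "run n h A = F' h" for h
    unfolding A by (simp add: split_def bind_return_pmf')
  then show ?thesis using F' by (intro exI[of _ A]) auto
qed

section \<open>Elementary probability bounds\<close>

lemma prob_bind_pmf:
  "measure_pmf.prob (bind_pmf M f) A = measure_pmf.expectation M (\<lambda>x. measure_pmf.prob (f x) A)"
proof -
  have "ennreal (measure_pmf.prob (bind_pmf M f) A) = (\<integral>\<^sup>+x. ennreal (measure_pmf.prob (f x) A) \<partial>M)"
    by (simp flip: measure_pmf.emeasure_eq_measure)
  also have "\<dots> = ennreal (measure_pmf.expectation M (\<lambda>x. measure_pmf.prob (f x) A))"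
    by (intro nn_integral_eq_integral measure_pmf.integrable_const_bound[where B=1]) auto
  finally show ?thesis by (simp add: integral_nonneg_AE)
qed

lemma integrable_bounded_pmf:
  fixes f :: "'a \<Rightarrow> real"
  assumes "\<And>x. x \<in> set_pmf M \<Longrightarrow> 0 \<le> f x" "\<And>x. x \<in> set_pmf M \<Longrightarrow> f x \<le> B"
  shows "integrable (measure_pmf M) f"
  using assms by (intro measure_pmf.integrable_const_bound[where B=B]) (auto simp: AE_measure_pmf_iff)

lemma prob_bind_le:
  assumes "\<And>x. x \<in> set_pmf M \<Longrightarrow> measure_pmf.prob (f x) A \<le> c x" "integrable (measure_pmf M) c"
  shows "measure_pmf.prob (bind_pmf M f) A \<le> measure_pmf.expectation M c"
  unfolding prob_bind_pmf
  by (intro integral_mono_AE integrable_bounded_pmf[where B=1] assms) (auto simp: AE_measure_pmf_iff assms)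

lemma prob_bind_le_except:
  assumes "\<And>x. x \<in> set_pmf M \<Longrightarrow> x \<notin> B \<Longrightarrow> measure_pmf.prob (f x) A \<le> c" "0 \<le> c"
  shows "measure_pmf.prob (bind_pmf M f) A \<le> measure_pmf.prob M B + c"
proof -
  have "measure_pmf.prob (bind_pmf M f) A \<le> measure_pmf.expectation M (\<lambda>x. indicator B x + c)"
  proof (rule prob_bind_le)
    fix x assume "x \<in> set_pmf M"
    show "measure_pmf.prob (f x) A \<le> indicator B x + c"
    proof (cases "x \<in> B")
      case True
      have "measure_pmf.prob (f x) A \<le> 1" by simp
      then show ?thesis using True assms(2) by (simp add: add_increasing2)
    qed (use assms \<open>x \<in> set_pmf M\<close> in auto)
  qed (use assms(2) in \<open>auto intro!: integrable_bounded_pmf[where B="1+c"] simp: indicator_def\<close>)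
  also have "\<dots> = measure_pmf.prob M B + c"
    by (subst Bochner_Integration.integral_add) (auto intro!: integrable_bounded_pmf[where B=1] simp: indicator_def)
  finally show ?thesis .
qed

lemma prob_replicate_all:
  "measure_pmf.prob (replicate_pmf k M) {xs. set xs \<subseteq> A} = measure_pmf.prob M A ^ k"
proof (induction k)
  case (Suc k)
  have "measure_pmf.prob (replicate_pmf k M \<bind> (\<lambda>xs. return_pmf (x # xs))) {xs. set xs \<subseteq> A} =
      indicator A x * measure_pmf.prob M A ^ k" for x
  proof -
    have "replicate_pmf k M \<bind> (\<lambda>xs. return_pmf (x # xs)) = map_pmf ((#) x) (replicate_pmf k M)"
      by (simp add: map_pmf_def)
    then have "measure_pmf.prob (replicate_pmf k M \<bind> (\<lambda>xs. return_pmf (x # xs))) {xs. set xs \<subseteq> A} =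
       measure_pmf.prob (replicate_pmf k M) (((#) x) -` {xs. set xs \<subseteq> A})" by simp
    also have "((#) x) -` {xs. set xs \<subseteq> A} = (if x \<in> A then {xs. set xs \<subseteq> A} else {})" by auto
    finally show ?thesis using Suc by simp
  qed
  then show ?case by (simp add: prob_bind_pmf)
qed simp

lemma prob_replicate_ex_le:
  "measure_pmf.prob (replicate_pmf k M) {xs. \<exists>x\<in>set xs. x \<in> A} \<le> k * measure_pmf.prob M A"
proof -
  have "{xs. \<exists>x\<in>set xs. x \<in> A} = UNIV - {xs. set xs \<subseteq> - A}" by auto
  then have "measure_pmf.prob (replicate_pmf k M) {xs. \<exists>x\<in>set xs. x \<in> A} =
      1 - measure_pmf.prob M (- A) ^ k"
    using measure_pmf.prob_compl[of "{xs. set xs \<subseteq> - A}" "replicate_pmf k M"]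
    by (simp add: prob_replicate_all)
  also have "measure_pmf.prob M (- A) = 1 - measure_pmf.prob M A"
    using measure_pmf.prob_compl[of A M] by (simp add: Compl_eq_Diff_UNIV)
  also have "1 - (1 - measure_pmf.prob M A) ^ k \<le> k * measure_pmf.prob M A"
    using Bernoulli_inequality[of "- measure_pmf.prob M A" k] by simp
  finally show ?thesis .
qed

text \<open>The exponential bound is weakened to a rational one, so that the error probabilities of
  the tester can be added by linear arithmetic.\<close>

lemma one_minus_power_le:
  fixes d :: real
  assumes "0 < d" "d \<le> p" "p \<le> 1" "0 < k"
  shows "(1 - p) ^ k \<le> 1 / (real k * d)"
proof -
  have "(1 - p) ^ k \<le> exp (- d) ^ k"
    using assms exp_ge_add_one_self[of "- d"] by (intro power_mono) auto
  also have "\<dots> = 1 / exp (real k * d)" by (simp add: exp_of_nat_mult exp_minus inverse_eq_divide power_one_over)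
  also have "\<dots> \<le> 1 / (real k * d)"
    using assms exp_ge_add_one_self[of "real k * d"] by (intro divide_left_mono) (linarith | simp)+
  finally show ?thesis .
qed

section \<open>Translations of a set that mostly preserve it\<close>

definition xor :: "'a set \<Rightarrow> 'a set \<Rightarrow> 'a set" (infixl "\<oplus>" 65) where
  "x \<oplus> y = (x - y) \<union> (y - x)"

lemma mem_xor [simp]: "i \<in> x \<oplus> y \<longleftrightarrow> (i \<in> x) \<noteq> (i \<in> y)"
  by (auto simp: xor_def)

lemma xor_comm: "x \<oplus> y = y \<oplus> x"
  by (auto simp: xor_def)

lemma xor_assoc: "x \<oplus> y \<oplus> z = x \<oplus> (y \<oplus> z)"
  by (auto simp: set_eq_iff)

lemma xor_cancel [simp]: "x \<oplus> (x \<oplus> y) = y" "x \<oplus> y \<oplus> y = x"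
  by (auto simp: set_eq_iff)

lemma xor_self [simp]: "x \<oplus> x = {}"
  by (auto simp: set_eq_iff)

lemma xor_empty [simp]: "x \<oplus> {} = x" "{} \<oplus> x = x"
  by (auto simp: set_eq_iff)

lemma xor_subset: "x \<subseteq> A \<Longrightarrow> y \<subseteq> A \<Longrightarrow> x \<oplus> y \<subseteq> A"
  by (auto simp: xor_def)

lemma inj_on_xor: "inj_on (\<lambda>x. x \<oplus> v) A"
  by (rule inj_on_inverseI[where g = "\<lambda>x. x \<oplus> v"]) simp

lemma bij_betw_xor_Pow: "v \<subseteq> A \<Longrightarrow> bij_betw (\<lambda>x. x \<oplus> v) (Pow A) (Pow A)"
  by (rule bij_betw_byWitness[where f' = "\<lambda>x. x \<oplus> v"]) (simp_all add: image_subset_iff xor_subset)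

text \<open>\<open>\<phi>\<close> will be the pattern and \<open>\<tau>\<close> the normalization.
  The only link between them is that points with equal pattern are normalized by the same
  translation.\<close>

locale translation =
  fixes n :: nat and S :: "nat set set" and \<phi> :: "nat set \<Rightarrow> 'c" and \<tau> :: "nat set \<Rightarrow> nat set"
  assumes S: "S \<subseteq> Pow {..<n}" "S \<noteq> {}"
    and \<tau>_subset: "x \<in> S \<Longrightarrow> \<tau> x \<subseteq> {..<n}"
    and \<tau>_xor: "\<lbrakk>x \<in> S; y \<in> S; \<phi> x = \<phi> y\<rbrakk> \<Longrightarrow> \<tau> x \<oplus> \<tau> y = x \<oplus> y"
begin

abbreviation "N \<equiv> real (card S)"
abbreviation "C \<equiv> Pow {..<n}"
abbreviation "M \<equiv> real (card C)"

definition keep :: "nat set \<Rightarrow> nat set \<Rightarrow> bool" where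
  "keep v x \<longleftrightarrow> x \<oplus> v \<in> S \<and> \<phi> (x \<oplus> v) = \<phi> x"

definition g :: "nat set \<Rightarrow> real" where
  "g v = card {x \<in> S. \<not> keep v x} / N"

lemma finite_S: "finite S" using S(1) by (rule finite_subset) simp
lemma N_pos: "N > 0" using S finite_S by (simp add: card_gt_0_iff)
lemma M_pos: "M > 0" by (simp add: card_Pow)
lemma g_nonneg: "g v \<ge> 0" by (simp add: g_def)

lemma card_not_keep: "real (card {x \<in> S. \<not> keep v x}) = g v * N"
  using N_pos by (simp add: g_def)

lemma card_keep: "real (card {x \<in> S. keep v x}) = (1 - g v) * N"
proof -
  have "card {x \<in> S. keep v x} + card {x \<in> S. \<not> keep v x} = card S"
    using finite_S by (subst card_Un_disjoint[symmetric]) (auto intro: arg_cong[where f=card])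
  then show ?thesis using card_not_keep[of v] by (simp add: algebra_simps flip: of_nat_add)
qed

text \<open>If \<open>v\<close> keeps \<open>x\<close> and \<open>u\<close> keeps
  \<open>x \<oplus> v\<close>, then the sum keeps \<open>x\<close>. Translation by \<open>v\<close>
  is injective, so the second condition fails for at most as many points as \<open>u\<close> fails
  to keep.\<close>

lemma g_subadd: "g (u \<oplus> v) \<le> g u + g v"
proof -
  have "{x \<in> S. \<not> keep (u \<oplus> v) x} \<subseteq> {x \<in> S. \<not> keep v x} \<union> {x \<in> S. keep v x \<and> \<not> keep u (x \<oplus> v)}"
    by (auto simp: keep_def xor_assoc xor_comm[of v])
  then have "card {x \<in> S. \<not> keep (u \<oplus> v) x} \<le> card ({x \<in> S. \<not> keep v x} \<union> {x \<in> S. keep v x \<and> \<not> keep u (x \<oplus> v)})"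
    by (rule card_mono[rotated]) (use finite_S in auto)
  also have "\<dots> \<le> card {x \<in> S. \<not> keep v x} + card {x \<in> S. keep v x \<and> \<not> keep u (x \<oplus> v)}"
    by (rule card_Un_le)
  also have "card {x \<in> S. keep v x \<and> \<not> keep u (x \<oplus> v)} \<le> card {x \<in> S. \<not> keep u x}"
    by (rule card_inj_on_le[of "\<lambda>x. x \<oplus> v"]) (use finite_S inj_on_xor in \<open>auto simp: keep_def\<close>)
  finally have "real (card {x \<in> S. \<not> keep (u \<oplus> v) x}) \<le> real (card {x \<in> S. \<not> keep v x} + card {x \<in> S. \<not> keep u x})"
    by simp
  then have "g (u \<oplus> v) * N \<le> (g u + g v) * N"
    by (simp add: card_not_keep distrib_right)
  then show ?thesis using N_pos by simp
qed

lemma g_empty: "g {} = 0"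
  by (simp add: g_def keep_def)

text \<open>A mask and its complement are equally distributed and decompose \<open>u\<close>.\<close>
lemma g_mask: "u \<subseteq> {..<n} \<Longrightarrow> M * g u \<le> 2 * (\<Sum>m\<in>C. g (m \<inter> u))"
proof -
  assume u: "u \<subseteq> {..<n}"
  have "M * g u = (\<Sum>m\<in>C. g u)" by simp
  also have "\<dots> \<le> (\<Sum>m\<in>C. g (m \<inter> u) + g ((m \<oplus> {..<n}) \<inter> u))"
  proof (rule sum_mono)
    fix m assume "m \<in> C"
    have "m \<inter> u \<oplus> (m \<oplus> {..<n}) \<inter> u = u" using u by auto
    then show "g u \<le> g (m \<inter> u) + g ((m \<oplus> {..<n}) \<inter> u)" using g_subadd by metis
  qed
  also have "\<dots> = 2 * (\<Sum>m\<in>C. g (m \<inter> u))"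
    using sum.reindex_bij_betw[OF bij_betw_xor_Pow[of "{..<n}" "{..<n}"], of "\<lambda>m. g (m \<inter> u)"]
    by (simp add: sum.distrib)
  finally show ?thesis .
qed

text \<open>Flipping bit \<open>i\<close> of a uniform mask leaves it uniform and changes the masked
  vector by exactly \<open>{i}\<close>. So masks come in pairs, one of which carries at least half
  of \<open>g {i}\<close>.\<close>

lemma g_mask_ge:
  assumes "i \<in> u" "i < n" shows "M * g {i} \<le> 2 * (\<Sum>m\<in>C. g (m \<inter> u))"
proof -
  have "M * g {i} = (\<Sum>m\<in>C. g {i})" by simp
  also have "\<dots> \<le> (\<Sum>m\<in>C. g (m \<inter> u) + g ((m \<oplus> {i}) \<inter> u))"
  proof (rule sum_mono)
    fix m assume "m \<in> C"
    have "m \<inter> u \<oplus> (m \<oplus> {i}) \<inter> u = {i}" using assms by auto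
    then show "g {i} \<le> g (m \<inter> u) + g ((m \<oplus> {i}) \<inter> u)" using g_subadd by metis
  qed
  also have "\<dots> = 2 * (\<Sum>m\<in>C. g (m \<inter> u))"
    using sum.reindex_bij_betw[OF bij_betw_xor_Pow[of "{i}" "{..<n}"], of "\<lambda>m. g (m \<inter> u)"] assms
    by (simp add: sum.distrib)
  finally show ?thesis .
qed

text \<open>The free coordinates, that is, the directions of the parallel subcubes. The threshold is
  the upper end of the gap in \<open>g_gap\<close>.\<close>

definition "R = {i. i < n \<and> g {i} \<le> 3/4}"

context
  fixes \<delta> :: real
  assumes mask_test: "(\<Sum>y\<in>S. \<Sum>z\<in>S. \<Sum>m\<in>C. g (m \<inter> (\<tau> y \<oplus> \<tau> z))) \<le> \<delta> * N^2 * M"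
    and \<delta>: "\<delta> \<le> 1 / 100"
begin

lemma sum_g_diff: "(\<Sum>y\<in>S. \<Sum>z\<in>S. g (\<tau> y \<oplus> \<tau> z)) \<le> 2 * \<delta> * N^2"
proof -
  have "M * (\<Sum>y\<in>S. \<Sum>z\<in>S. g (\<tau> y \<oplus> \<tau> z)) \<le> 2 * (\<Sum>y\<in>S. \<Sum>z\<in>S. \<Sum>m\<in>C. g (m \<inter> (\<tau> y \<oplus> \<tau> z)))"
    unfolding sum_distrib_left by (intro sum_mono g_mask[unfolded sum_distrib_left] xor_subset \<tau>_subset)
  also have "\<dots> \<le> 2 * (\<delta> * N^2 * M)" using mask_test by simp
  finally have "M * (\<Sum>y\<in>S. \<Sum>z\<in>S. g (\<tau> y \<oplus> \<tau> z)) \<le> M * (2 * \<delta> * N^2)" by (simp add: mult_ac)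
  then show ?thesis using M_pos by (subst (asm) mult_le_cancel_left_pos) auto
qed

lemma \<delta>_nonneg: "\<delta> \<ge> 0"
proof -
  have "0 \<le> (\<Sum>y\<in>S. \<Sum>z\<in>S. g (\<tau> y \<oplus> \<tau> z))" by (intro sum_nonneg g_nonneg)
  then have "0 \<le> 2 * \<delta> * N^2" using sum_g_diff by linarith
  then show ?thesis using N_pos by (simp add: zero_le_mult_iff)
qed

text \<open>Over the kept \<open>x\<close>, both \<open>x\<close> and \<open>x \<oplus> v\<close>
  run injectively through points of \<open>S\<close>, so a bound for a random point of
  \<open>S\<close> transfers to either of them.\<close>

lemma sum_over_keep:
  assumes "\<And>y z. f y z \<ge> (0::real)"
  shows "(\<Sum>x\<in>{x\<in>S. keep v x}. \<Sum>w\<in>S. f (\<tau> x) (\<tau> w)) \<le> (\<Sum>x\<in>S. \<Sum>w\<in>S. f (\<tau> x) (\<tau> w))"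
    "(\<Sum>x\<in>{x\<in>S. keep v x}. \<Sum>w\<in>S. f (\<tau> (x \<oplus> v)) (\<tau> w)) \<le> (\<Sum>x\<in>S. \<Sum>w\<in>S. f (\<tau> x) (\<tau> w))"
proof -
  show "(\<Sum>x\<in>{x\<in>S. keep v x}. \<Sum>w\<in>S. f (\<tau> x) (\<tau> w)) \<le> (\<Sum>x\<in>S. \<Sum>w\<in>S. f (\<tau> x) (\<tau> w))"
    by (rule sum_mono2) (use finite_S assms in \<open>auto intro: sum_nonneg\<close>)
  have "(\<Sum>x\<in>{x\<in>S. keep v x}. \<Sum>w\<in>S. f (\<tau> (x \<oplus> v)) (\<tau> w)) =
     (\<Sum>x\<in>(\<lambda>x. x \<oplus> v) ` {x\<in>S. keep v x}. \<Sum>w\<in>S. f (\<tau> x) (\<tau> w))"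
    by (subst sum.reindex) (auto simp: inj_on_xor)
  also have "\<dots> \<le> (\<Sum>x\<in>S. \<Sum>w\<in>S. f (\<tau> x) (\<tau> w))"
    by (rule sum_mono2) (use finite_S assms in \<open>auto intro: sum_nonneg simp: keep_def\<close>)
  finally show "(\<Sum>x\<in>{x\<in>S. keep v x}. \<Sum>w\<in>S. f (\<tau> (x \<oplus> v)) (\<tau> w)) \<le> (\<Sum>x\<in>S. \<Sum>w\<in>S. f (\<tau> x) (\<tau> w))" .
qed

text \<open>\<open>v\<close> is the difference of the normalizations of \<open>x\<close> and
  \<open>x \<oplus> v\<close>. These two points are far from independent; inserting an arbitrary
  \<open>w\<close> gives two pairs, each of which can be compared with a pair of independent
  samples.\<close>

lemma keep_decomp:
  assumes "x \<in> S" "keep v x"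
  shows "v = (\<tau> x \<oplus> \<tau> w) \<oplus> (\<tau> (x \<oplus> v) \<oplus> \<tau> w)"
proof -
  have "\<tau> x \<oplus> \<tau> (x \<oplus> v) = x \<oplus> (x \<oplus> v)"
    using assms by (intro \<tau>_xor) (auto simp: keep_def)
  then have "\<tau> x \<oplus> \<tau> (x \<oplus> v) = v" by simp
  then show ?thesis by (auto simp: set_eq_iff)
qed

text \<open>If \<open>v\<close> preserves a quarter of \<open>S\<close>, then in many ways it is a sum of two differences of normalized
  points, each of which is typically harmless.\<close>
lemma g_gap:
  assumes "g v \<le> 3/4" shows "g v \<le> 16 * \<delta>"
proof -
  let ?X = "{x\<in>S. keep v x}"
  have X: "real (card ?X) \<ge> N / 4" using assms N_pos by (simp add: card_keep)
  have "real (card ?X) * N * g v = (\<Sum>x\<in>?X. \<Sum>w\<in>S. g v)" by simp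
  also have "\<dots> \<le> (\<Sum>x\<in>?X. \<Sum>w\<in>S. g (\<tau> x \<oplus> \<tau> w) + g (\<tau> (x \<oplus> v) \<oplus> \<tau> w))"
  proof (intro sum_mono)
    fix x w assume "x \<in> ?X"
    then show "g v \<le> g (\<tau> x \<oplus> \<tau> w) + g (\<tau> (x \<oplus> v) \<oplus> \<tau> w)"
      using keep_decomp[of x v w] g_subadd by (metis (mono_tags, lifting) mem_Collect_eq)
  qed
  also have "\<dots> = (\<Sum>x\<in>?X. \<Sum>w\<in>S. g (\<tau> x \<oplus> \<tau> w)) + (\<Sum>x\<in>?X. \<Sum>w\<in>S. g (\<tau> (x \<oplus> v) \<oplus> \<tau> w))"
    by (simp add: sum.distrib)
  also have "\<dots> \<le> 2 * (2 * \<delta> * N^2)"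
    using sum_over_keep[of "\<lambda>a b. g (a \<oplus> b)" v, OF g_nonneg] sum_g_diff by linarith
  finally have "real (card ?X) * N * g v \<le> 4 * \<delta> * N^2" by simp
  moreover have "N / 4 * N * g v \<le> real (card ?X) * N * g v"
    using X g_nonneg by (intro mult_right_mono) auto
  ultimately have "N^2 * (g v / 4) \<le> N^2 * (4 * \<delta>)" by (simp add: power2_eq_square mult_ac)
  then show ?thesis using N_pos by simp
qed

text \<open>Coordinates are added one at a time: each step raises the bound to at most
  \<open>32 * \<delta>\<close>, still below \<open>3/4\<close>, and \<open>g_gap\<close> restores
  \<open>16 * \<delta>\<close>. Hence the bound does not grow with \<open>u\<close>.\<close>

lemma g_le_of_subset:
  assumes "u \<subseteq> R" shows "g u \<le> 16 * \<delta>"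
proof -
  have "finite R" by (simp add: R_def)
  then have "finite u" using assms by (rule finite_subset[rotated])
  then show ?thesis using assms
  proof (induction u)
    case empty then show ?case using \<delta>_nonneg by (simp add: g_empty)
  next
    case (insert i u)
    have "insert i u = {i} \<oplus> u" using insert by auto
    moreover have "g {i} \<le> 16 * \<delta>" using insert by (intro g_gap) (auto simp: R_def)
    moreover have "g u \<le> 16 * \<delta>" using insert by auto
    ultimately have "g (insert i u) \<le> 32 * \<delta>" using g_subadd[of "{i}" u] by simp
    then show ?case using \<delta> by (intro g_gap) auto
  qed
qed

text \<open>A difference that leaves \<open>R\<close> contains a coordinate with \<open>g\<close>
  above \<open>3/4\<close>, so random masking of this pair costs at least \<open>3/8\<close> on
  average. Markov's inequality gives the factor \<open>8/3\<close>.\<close>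

lemma card_not_subset_R:
  "(\<Sum>y\<in>S. real (card {z\<in>S. \<not> \<tau> y \<oplus> \<tau> z \<subseteq> R})) \<le> 8/3 * \<delta> * N^2"
proof -
  have "(\<Sum>y\<in>S. real (card {z\<in>S. \<not> \<tau> y \<oplus> \<tau> z \<subseteq> R})) * (3/8 * M) =
     (\<Sum>y\<in>S. \<Sum>z\<in>{z\<in>S. \<not> \<tau> y \<oplus> \<tau> z \<subseteq> R}. 3/8 * M)"
    unfolding sum_distrib_right by simp
  also have "\<dots> \<le> (\<Sum>y\<in>S. \<Sum>z\<in>{z\<in>S. \<not> \<tau> y \<oplus> \<tau> z \<subseteq> R}. \<Sum>m\<in>C. g (m \<inter> (\<tau> y \<oplus> \<tau> z)))"
  proof (intro sum_mono)
    fix y z assume yz: "y \<in> S" "z \<in> {z\<in>S. \<not> \<tau> y \<oplus> \<tau> z \<subseteq> R}"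
    then obtain i where i: "i \<in> \<tau> y \<oplus> \<tau> z" "i \<notin> R" by blast
    moreover have "i < n" using i(1) yz xor_subset[OF \<tau>_subset \<tau>_subset, of y z] by blast
    ultimately have "g {i} > 3/4" by (simp add: R_def)
    then have "M * (3/4) \<le> M * g {i}" by (intro mult_left_mono) auto
    then show "3/8 * M \<le> (\<Sum>m\<in>C. g (m \<inter> (\<tau> y \<oplus> \<tau> z)))"
      using g_mask_ge[OF i(1) \<open>i < n\<close>] by simp
  qed
  also have "\<dots> \<le> (\<Sum>y\<in>S. \<Sum>z\<in>S. \<Sum>m\<in>C. g (m \<inter> (\<tau> y \<oplus> \<tau> z)))"
    by (intro sum_mono sum_mono2 sum_nonneg g_nonneg finite_S) auto
  also have "\<dots> \<le> \<delta> * N^2 * M" by (rule mask_test)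
  finally have "(\<Sum>y\<in>S. real (card {z\<in>S. \<not> \<tau> y \<oplus> \<tau> z \<subseteq> R})) * (3/8 * M) \<le> (8/3 * \<delta> * N^2) * (3/8 * M)"
    by (simp add: mult_ac)
  then show ?thesis using M_pos by (subst (asm) mult_le_cancel_right_pos) auto
qed

text \<open>The double counting of \<open>g_gap\<close>, with the indicator of a difference outside
  \<open>R\<close> in place of \<open>g\<close>. Some \<open>x\<close> and \<open>w\<close> make
  both differences lie in \<open>R\<close>, and \<open>v\<close> is their sum.\<close>

lemma subset_R_of_g_le:
  assumes "g v \<le> 3/4" shows "v \<subseteq> R"
proof -
  let ?X = "{x\<in>S. keep v x}"
  define b where "b = (\<lambda>y z. of_bool (\<not> y \<oplus> z \<subseteq> R) :: real)"
  have b_nonneg: "b y z \<ge> 0" for y z by (simp add: b_def)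
  have b: "(\<Sum>x\<in>S. \<Sum>w\<in>S. b (\<tau> x) (\<tau> w)) \<le> 8/3 * \<delta> * N^2"
    using card_not_subset_R finite_S by (simp add: b_def of_bool_def sum.If_cases Int_def)
  have X: "real (card ?X) \<ge> N / 4" using assms N_pos by (simp add: card_keep)
  have "(\<Sum>x\<in>?X. \<Sum>w\<in>S. b (\<tau> x) (\<tau> w) + b (\<tau> (x \<oplus> v)) (\<tau> w)) \<le> 2 * (8/3 * \<delta> * N^2)"
    unfolding sum.distrib using sum_over_keep[of b v, OF b_nonneg] b by linarith
  \<comment> \<open>\<open>16/3 * \<delta>\<close> is below \<open>1/4\<close> because
    \<open>\<delta>\<close> is at most \<open>1/100\<close>.\<close>
  also have "\<dots> < N / 4 * N"
    using \<delta> N_pos by (simp add: power2_eq_square)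
  also have "\<dots> \<le> real (card ?X) * N" using X by (intro mult_right_mono) auto
  also have "\<dots> = (\<Sum>x\<in>?X. \<Sum>w\<in>S. 1)" by simp
  finally obtain x where x: "x \<in> ?X" and "(\<Sum>w\<in>S. b (\<tau> x) (\<tau> w) + b (\<tau> (x \<oplus> v)) (\<tau> w)) < (\<Sum>w\<in>S. 1)"
    by (metis (mono_tags, lifting) linorder_not_le sum_mono)
  then obtain w where w: "w \<in> S" "b (\<tau> x) (\<tau> w) + b (\<tau> (x \<oplus> v)) (\<tau> w) < 1"
    by (metis (mono_tags, lifting) linorder_not_le sum_mono)
  then have "\<tau> x \<oplus> \<tau> w \<subseteq> R" "\<tau> (x \<oplus> v) \<oplus> \<tau> w \<subseteq> R" by (auto simp del: mem_xor simp: b_def of_bool_def split: if_splits)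
  then have "(\<tau> x \<oplus> \<tau> w) \<oplus> (\<tau> (x \<oplus> v) \<oplus> \<tau> w) \<subseteq> R" by (rule xor_subset)
  then show ?thesis using keep_decomp[of x v w] x by simp
qed

text \<open>Averaging over \<open>a\<close>, where \<open>3\<close> exceeds \<open>8/3\<close>. The
  center fixes the translate of the coordinate space \<open>R\<close> that holds nearly all
  normalized samples.\<close>

lemma exists_center: "\<exists>a\<in>S. real (card {x\<in>S. \<not> \<tau> x \<oplus> \<tau> a \<subseteq> R}) \<le> 3 * \<delta> * N"
proof (rule ccontr)
  assume "\<not> ?thesis"
  then have *: "real (card {x\<in>S. \<not> \<tau> x \<oplus> \<tau> a \<subseteq> R}) > 3 * \<delta> * N" if "a \<in> S" for a using that by (meson linorder_not_le)
  have "3 * \<delta> * N * N = (\<Sum>a\<in>S. 3 * \<delta> * N)" by simp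
  also have "\<dots> < (\<Sum>a\<in>S. real (card {x\<in>S. \<not> \<tau> x \<oplus> \<tau> a \<subseteq> R}))"
    using * S finite_S by (intro sum_strict_mono) auto
  also have "\<dots> \<le> 8/3 * \<delta> * N^2" using card_not_subset_R by (simp add: xor_comm)
  finally have "\<delta> * N^2 < 0" by (simp add: power2_eq_square)
  then show False using \<delta>_nonneg by (simp add: mult_less_0_iff)
qed

text \<open>If \<open>d\<close> lies in \<open>R\<close>, both parts of a random splitting are
  harmless. If two of its coordinates lie outside \<open>R\<close>, half of the splittings separate
  them, and then both parts are harmful. In either case the two parts often have the same
  effect.\<close>

lemma flip_test_card:
  assumes d: "d \<subseteq> {..<n}"
    and flip: "(\<Sum>m\<in>C. real (card {x\<in>S. keep (m \<inter> d) x = keep (d - m) x})) \<le> \<delta> * N * M"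
  shows "card (d - R) = 1"
proof (rule ccontr)
  assume "card (d - R) \<noteq> 1"
  have fin: "finite (d - R)" by (rule finite_subset[of _ "{..<n}"]) (use d in blast, simp)
  consider "d \<subseteq> R" | i j where "i \<in> d - R" "j \<in> d - R" "i \<noteq> j"
  proof (cases "d \<subseteq> R")
    case False
    then have "card (d - R) \<noteq> 0" using fin by auto
    then have "\<not> card (d - R) \<le> Suc 0" using \<open>card (d - R) \<noteq> 1\<close> by linarith
    then show ?thesis using that(2) unfolding card_le_Suc0_iff_eq[OF fin] by blast
  qed (use that in auto)
  then have "M * N / 4 \<le> (\<Sum>m\<in>C. real (card {x\<in>S. keep (m \<inter> d) x = keep (d - m) x}))"
  proof cases
    case 1
    have "M * N / 4 = (\<Sum>m\<in>C. N / 4)" by simp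
    also have "\<dots> \<le> (\<Sum>m\<in>C. real (card {x\<in>S. keep (m \<inter> d) x = keep (d - m) x}))"
    proof (rule sum_mono)
      fix m
      have "S \<subseteq> {x\<in>S. keep (m \<inter> d) x = keep (d - m) x} \<union> {x\<in>S. \<not> keep (m \<inter> d) x} \<union> {x\<in>S. \<not> keep (d - m) x}"
        by auto
      then have "card S \<le> card ({x\<in>S. keep (m \<inter> d) x = keep (d - m) x} \<union> {x\<in>S. \<not> keep (m \<inter> d) x} \<union> {x\<in>S. \<not> keep (d - m) x})"
        by (rule card_mono[rotated]) (use finite_S in auto)
      also have "\<dots> \<le> card {x\<in>S. keep (m \<inter> d) x = keep (d - m) x} + card {x\<in>S. \<not> keep (m \<inter> d) x} + card {x\<in>S. \<not> keep (d - m) x}"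
        by (meson card_Un_le add_le_mono1 order_trans)
      finally have "N \<le> real (card {x\<in>S. keep (m \<inter> d) x = keep (d - m) x}) + g (m \<inter> d) * N + g (d - m) * N"
        by (simp flip: card_not_keep)
      moreover have "g (m \<inter> d) * N \<le> 16 * \<delta> * N" "g (d - m) * N \<le> 16 * \<delta> * N"
        using 1 by (intro mult_right_mono g_le_of_subset; auto)+
      moreover have "32 * \<delta> * N \<le> 32/100 * N" using \<delta> by (intro mult_right_mono) auto
      ultimately show "N / 4 \<le> real (card {x\<in>S. keep (m \<inter> d) x = keep (d - m) x})" using N_pos by linarith
    qed
    finally show ?thesis .
  next
    case 2
    define f where "f = (\<lambda>m. real (card {x\<in>S. keep (m \<inter> d) x = keep (d - m) x}))"
    have i: "i < n" using 2 d by auto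
    have *: "N / 2 \<le> f m" if "(i \<in> m) \<noteq> (j \<in> m)" for m
    proof -
      have "\<not> m \<inter> d \<subseteq> R" "\<not> d - m \<subseteq> R" using 2 that by auto
      then have "g (m \<inter> d) > 3/4" "g (d - m) > 3/4" using subset_R_of_g_le[of "m \<inter> d"] subset_R_of_g_le[of "d - m"] by linarith+
      then have small: "(1 - g (m \<inter> d)) * N \<le> 1/4 * N" "(1 - g (d - m)) * N \<le> 1/4 * N"
        by (intro mult_right_mono; auto)+
      have "S \<subseteq> {x\<in>S. keep (m \<inter> d) x = keep (d - m) x} \<union> {x\<in>S. keep (m \<inter> d) x} \<union> {x\<in>S. keep (d - m) x}"
        by auto
      then have "card S \<le> card ({x\<in>S. keep (m \<inter> d) x = keep (d - m) x} \<union> {x\<in>S. keep (m \<inter> d) x} \<union> {x\<in>S. keep (d - m) x})"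
        by (rule card_mono[rotated]) (use finite_S in auto)
      also have "\<dots> \<le> card {x\<in>S. keep (m \<inter> d) x = keep (d - m) x} + card {x\<in>S. keep (m \<inter> d) x} + card {x\<in>S. keep (d - m) x}"
        by (meson card_Un_le add_le_mono1 order_trans)
      finally have "N \<le> f m + (1 - g (m \<inter> d)) * N + (1 - g (d - m)) * N"
        by (simp add: f_def flip: card_keep)
      then show ?thesis using small by linarith
    qed
    \<comment> \<open>Of the masks \<open>m\<close> and \<open>m \<oplus> {i}\<close> exactly one
      separates \<open>i\<close> from \<open>j\<close>.\<close>
    have "M * N / 2 = (\<Sum>m\<in>C. N / 2)" by simp
    also have "\<dots> \<le> (\<Sum>m\<in>C. f m + f (m \<oplus> {i}))"
    proof (rule sum_mono)
      fix m
      show "N / 2 \<le> f m + f (m \<oplus> {i})"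
      proof (cases "(i \<in> m) \<noteq> (j \<in> m)")
        case True
        moreover have "f (m \<oplus> {i}) \<ge> 0" by (simp add: f_def)
        ultimately show ?thesis using *[of m] by linarith
      next
        case False
        then have "(i \<in> m \<oplus> {i}) \<noteq> (j \<in> m \<oplus> {i})" using 2 by auto
        moreover have "f m \<ge> 0" by (simp add: f_def)
        ultimately show ?thesis using *[of "m \<oplus> {i}"] by linarith
      qed
    qed
    also have "\<dots> = 2 * (\<Sum>m\<in>C. f m)"
      using sum.reindex_bij_betw[OF bij_betw_xor_Pow[of "{i}" "{..<n}"], of f] i by (simp add: sum.distrib)
    finally show ?thesis by (simp add: f_def)
  qed
  also have "\<dots> \<le> \<delta> * N * M" by (rule flip)
  also have "\<dots> \<le> 1/100 * N * M" using \<delta> by (intro mult_right_mono) auto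
  finally have "M * N \<le> 0" by (simp add: mult.commute)
  then show False using N_pos M_pos by (simp add: mult_le_0_iff)
qed

end

end

section \<open>The tester\<close>

datatype 's outcome = Pass | Abort | Extend 's

text \<open>All \<open>k\<close> rounds of a stage are run in the same state, so that they are
  independent, and the first outcome that is not \<open>Pass\<close> is obeyed. Running out of
  stages means that too many relevant blocks were found.\<close>

primrec search :: "('s \<Rightarrow> 's outcome pmf) \<Rightarrow> ('s \<Rightarrow> bool pmf) \<Rightarrow> nat \<Rightarrow> nat \<Rightarrow> 's \<Rightarrow> bool pmf" where
  "search rnd fin k 0 s = return_pmf False"
| "search rnd fin k (Suc j) s = do {
     os \<leftarrow> replicate_pmf k (rnd s);
     if set os \<subseteq> {Pass} then fin s
     else (case hd (filter (\<lambda>u. u \<noteq> Pass) os) of Extend s' \<Rightarrow> search rnd fin k j s' | _ \<Rightarrow> return_pmf False)}"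

lemma hd_filter_not_Pass:
  assumes "\<not> set os \<subseteq> {Pass}"
  shows "hd (filter (\<lambda>u. u \<noteq> Pass) os) \<in> set os" "hd (filter (\<lambda>u. u \<noteq> Pass) os) \<noteq> Pass"
proof -
  have "filter (\<lambda>u. u \<noteq> Pass) os \<noteq> []" using assms by (auto simp: filter_empty_conv)
  then have "hd (filter (\<lambda>u. u \<noteq> Pass) os) \<in> set (filter (\<lambda>u. u \<noteq> Pass) os)" by (rule hd_in_set)
  then show "hd (filter (\<lambda>u. u \<noteq> Pass) os) \<in> set os" "hd (filter (\<lambda>u. u \<noteq> Pass) os) \<noteq> Pass" by auto
qed

text \<open>Serves both error bounds. With \<open>wrong = False\<close> the premises
  \<open>zero\<close> and \<open>abort\<close> say that these rejections are unreachable; with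
  \<open>wrong = True\<close> they hold trivially. A state whose round fails with probability above
  \<open>\<delta>\<close> slips through its stage with probability at most
  \<open>1 / (k * \<delta>)\<close>; in all other states the final verification is reliable.\<close>

lemma search_error:
  fixes Inv :: "nat \<Rightarrow> 's \<Rightarrow> bool" and wrong :: bool
  assumes zero: "\<And>s. Inv 0 s \<Longrightarrow> wrong"
    and abort: "\<And>j s. Inv (Suc j) s \<Longrightarrow> Abort \<in> set_pmf (rnd s) \<Longrightarrow> wrong"
    and extend: "\<And>j s s'. Inv (Suc j) s \<Longrightarrow> Extend s' \<in> set_pmf (rnd s) \<Longrightarrow> Inv j s'"
    and final: "\<And>j s. Inv (Suc j) s \<Longrightarrow> measure_pmf.prob (rnd s) {u. u \<noteq> Pass} \<le> \<delta> \<Longrightarrow>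
        measure_pmf.prob (fin s) {wrong} \<le> \<beta>"
    and pos: "0 < \<delta>" "0 < k" "0 \<le> \<beta>"
  shows "Inv j s \<Longrightarrow> measure_pmf.prob (search rnd fin k j s) {wrong} \<le> j / (k * \<delta>) + \<beta>"
proof (induction j arbitrary: s)
  case 0
  then show ?case using zero pos by auto
next
  case (Suc j)
  define next_state where "next_state = (\<lambda>os. if set os \<subseteq> {Pass} then fin s
     else (case hd (filter (\<lambda>u. u \<noteq> Pass) os) of Extend s' \<Rightarrow> search rnd fin k j s' | _ \<Rightarrow> return_pmf False))"
  have eq: "search rnd fin k (Suc j) s = replicate_pmf k (rnd s) \<bind> next_state"
    by (simp add: next_state_def)
  have nonneg: "0 \<le> j / (k * \<delta>) + \<beta>" using pos by simp
  have rec: "measure_pmf.prob (next_state os) {wrong} \<le> j / (k * \<delta>) + \<beta>"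
    if os: "os \<in> set_pmf (replicate_pmf k (rnd s))" "\<not> set os \<subseteq> {Pass}" for os
  proof -
    let ?o = "hd (filter (\<lambda>u. u \<noteq> Pass) os)"
    have o: "?o \<in> set_pmf (rnd s)" "?o \<noteq> Pass"
      using hd_filter_not_Pass[OF os(2)] os(1) by (auto simp: set_replicate_pmf)
    show ?thesis
    proof (cases ?o)
      case Abort
      then show ?thesis using os(2) o(1) abort[OF Suc.prems] nonneg by (simp add: next_state_def)
    next
      case (Extend s')
      then show ?thesis using os(2) o(1) Suc.IH[OF extend[OF Suc.prems, of s']] by (simp add: next_state_def)
    qed (use o in simp)
  qed
  have frac: "real j / (k * \<delta>) \<le> real (Suc j) / (k * \<delta>)" using pos by (intro divide_right_mono) auto
  let ?p = "measure_pmf.prob (rnd s) {u. u \<noteq> Pass}"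
  show ?case
  proof (cases "?p \<le> \<delta>")
    case True
    have "measure_pmf.prob (replicate_pmf k (rnd s) \<bind> next_state) {wrong} \<le>
        measure_pmf.prob (replicate_pmf k (rnd s)) {} + (j / (k * \<delta>) + \<beta>)"
    proof (rule prob_bind_le_except)
      fix os assume "os \<in> set_pmf (replicate_pmf k (rnd s))"
      moreover have "0 \<le> j / (k * \<delta>)" using pos by simp
      ultimately show "measure_pmf.prob (next_state os) {wrong} \<le> j / (k * \<delta>) + \<beta>"
        using rec[of os] final[OF Suc.prems True] by (cases "set os \<subseteq> {Pass}") (simp_all add: next_state_def)
    qed (rule nonneg)
    then show ?thesis using frac unfolding eq by simp
  next
    case False
    have "measure_pmf.prob (replicate_pmf k (rnd s) \<bind> next_state) {wrong} \<le>
        measure_pmf.prob (replicate_pmf k (rnd s)) {os. set os \<subseteq> {Pass}} + (j / (k * \<delta>) + \<beta>)"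
      by (rule prob_bind_le_except) (use rec nonneg in auto)
    also have "measure_pmf.prob (replicate_pmf k (rnd s)) {os. set os \<subseteq> {Pass}} =
        (1 - ?p) ^ k"
    proof -
      have "?p = measure_pmf.prob (rnd s) (UNIV - {Pass})"
        by (rule arg_cong[where f = "measure_pmf.prob (rnd s)"]) auto
      also have "\<dots> = 1 - measure_pmf.prob (rnd s) {Pass}"
        using measure_pmf.prob_compl[of "{Pass}" "rnd s"] by simp
      finally show ?thesis by (simp add: prob_replicate_all)
    qed
    also have "\<dots> \<le> 1 / (k * \<delta>)"
      using False pos by (intro one_minus_power_le) auto
    finally show ?thesis unfolding eq by (simp add: add_divide_distrib)
  qed
qed

lemma computable_search:
  fixes Inv :: "nat \<Rightarrow> 's \<Rightarrow> bool"
  assumes rnd: "\<And>j s. Inv (Suc j) s \<Longrightarrow> computable n q (\<lambda>h. rnd h s)"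
    and fin: "\<And>j s. Inv (Suc j) s \<Longrightarrow> computable n q' (\<lambda>h. fin h s)"
    and extend: "\<And>j s s' h. Inv (Suc j) s \<Longrightarrow> Extend s' \<in> set_pmf (rnd h s) \<Longrightarrow> Inv j s'"
  shows "Inv j s \<Longrightarrow> computable n (j * (k * q) + q') (\<lambda>h. search (rnd h) (fin h) k j s)"
proof (induction j arbitrary: s)
  case 0
  show ?case by (auto intro: computable_mono[OF computable_return])
next
  case (Suc j)
  let ?V = "\<Union>h. set_pmf (replicate_pmf k (rnd h s))"
  have "computable n (k * q + (j * (k * q) + q')) (\<lambda>h. search (rnd h) (fin h) k (Suc j) s)"
    unfolding search.simps
  proof (rule computable_bind[OF computable_replicate[OF rnd[OF Suc.prems]], where V = ?V])
    fix os assume os: "os \<in> ?V"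
    let ?o = "hd (filter (\<lambda>u. u \<noteq> Pass) os)"
    show "computable n (j * (k * q) + q') (\<lambda>h. if set os \<subseteq> {Pass} then fin h s
       else (case ?o of Extend s' \<Rightarrow> search (rnd h) (fin h) k j s' | _ \<Rightarrow> return_pmf False))"
    proof (cases "set os \<subseteq> {Pass}")
      case True
      then show ?thesis using computable_mono[OF fin[OF Suc.prems]] by simp
    next
      case False
      show ?thesis
      proof (cases ?o)
        case (Extend s')
        obtain h where "os \<in> set_pmf (replicate_pmf k (rnd h s))" using os by blast
        then have "?o \<in> set_pmf (rnd h s)"
          using hd_filter_not_Pass(1)[OF False] by (auto simp: set_replicate_pmf)
        then have "Inv j s'" using extend[OF Suc.prems] Extend by metis
        then show ?thesis using Suc.IH False Extend by simp
      qed (use False in \<open>auto intro: computable_mono[OF computable_return]\<close>)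
    qed
  qed auto
  then show ?case by (simp add: algebra_simps)
qed

text \<open>\<open>\<pi> i\<close> is the block of the variable \<open>i\<close>. In a state \<open>(I, Z, D)\<close>, \<open>I\<close> is the set of relevant blocks
  found so far, \<open>Z B\<close> is the point of \<open>S\<close> recorded for \<open>B \<in> I\<close>, and the change recorded for \<open>B\<close> is the
  part of \<open>D\<close> in the block \<open>B\<close>.\<close>
type_synonym state = "nat set \<times> (nat \<Rightarrow> nat set) \<times> nat set"

definition hyb :: "(nat \<Rightarrow> nat) \<Rightarrow> nat set \<Rightarrow> nat set \<Rightarrow> nat set \<Rightarrow> nat set" where
  "hyb \<pi> A w x = w \<inter> \<pi> -` A \<union> (x - \<pi> -` A)"

definition pattern :: "(nat \<Rightarrow> nat) \<Rightarrow> nat set \<Rightarrow> (nat \<Rightarrow> nat set) \<Rightarrow> (nat set \<Rightarrow> bool) \<Rightarrow> nat set \<Rightarrow> nat set" where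
  "pattern \<pi> I Z h x = {B \<in> I. \<not> h (hyb \<pi> {B} x (Z B))}"

definition normalize :: "(nat \<Rightarrow> nat) \<Rightarrow> nat set \<Rightarrow> (nat \<Rightarrow> nat set) \<Rightarrow> nat set \<Rightarrow> (nat set \<Rightarrow> bool) \<Rightarrow> nat set \<Rightarrow> nat set" where
  "normalize \<pi> I Z D h x = x \<oplus> (D \<inter> \<pi> -` pattern \<pi> I Z h x)"

definition kept :: "(nat \<Rightarrow> nat) \<Rightarrow> nat set \<Rightarrow> (nat \<Rightarrow> nat set) \<Rightarrow> (nat set \<Rightarrow> bool) \<Rightarrow> nat set \<Rightarrow> nat set \<Rightarrow> bool" where
  "kept \<pi> I Z h a w \<longleftrightarrow> h w \<and> pattern \<pi> I Z h w = a"

text \<open>The blocks of \<open>I\<close> are replaced all at once at the start of the path: for a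
  factored DNF and points \<open>x\<close>, \<open>w\<close> of equal pattern this does not touch
  the relevant variables of these blocks.\<close>

definition drops :: "(nat \<Rightarrow> nat) \<Rightarrow> nat set \<Rightarrow> (nat set \<Rightarrow> bool) \<Rightarrow> nat set \<Rightarrow> nat set \<Rightarrow> nat \<Rightarrow> bool" where
  "drops \<pi> I h x w j \<longleftrightarrow> h (hyb \<pi> (I \<union> {..<j}) w x) \<and> \<not> h (hyb \<pi> (I \<union> {..<Suc j}) w x)"

text \<open>The recorded point is the one just before the path leaves \<open>S\<close>, and the
  recorded change is the step that leaves \<open>S\<close>. For a factored DNF such a step exists
  whenever the tester looks for one, so \<open>Abort\<close> is evidence of the contrary.\<close>

definition new_block :: "(nat \<Rightarrow> nat) \<Rightarrow> nat \<Rightarrow> state \<Rightarrow> (nat set \<Rightarrow> bool) \<Rightarrow> nat set \<Rightarrow> nat set \<Rightarrow> state outcome" where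
  "new_block \<pi> l = (\<lambda>(I, Z, D) h x w.
     if \<exists>j<l. drops \<pi> I h x w j
     then let j = SOME j. j < l \<and> drops \<pi> I h x w j
       in Extend (insert j I, Z(j := hyb \<pi> (I \<union> {..<j}) w x), D \<union> (x \<oplus> w) \<inter> \<pi> -` {j})
     else Abort)"

text \<open>The condition on \<open>B \<in> I\<close> guarantees that the change recorded for \<open>B\<close> has exactly one coordinate
  outside the free coordinates: a random splitting of the change must separate a part that
  alters the pattern from a part that does not.\<close>
definition check :: "(nat \<Rightarrow> nat) \<Rightarrow> nat \<Rightarrow> state \<Rightarrow> (nat set \<Rightarrow> bool) \<Rightarrow> nat set \<Rightarrow> nat set \<Rightarrow> nat set \<Rightarrow> nat set \<Rightarrow> nat set \<Rightarrow> state outcome" where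
  "check \<pi> l = (\<lambda>(I, Z, D) h x m a w1 w2.
     if (\<exists>B\<in>I. kept \<pi> I Z h a (x \<oplus> (m \<inter> (D \<inter> \<pi> -` {B}))) = kept \<pi> I Z h a (x \<oplus> (D \<inter> \<pi> -` {B} - m))) \<or>
       pattern \<pi> I Z h w1 \<noteq> a \<or> pattern \<pi> I Z h w2 \<noteq> a then Abort
     else if \<not> h w1 then new_block \<pi> l (I, Z, D) h x w1
     else if \<not> h w2 then new_block \<pi> l (I, Z, D) h x w2
     else Pass)"

text \<open>The second point carries the pattern of \<open>x\<close> over to the normalized
  \<open>y\<close>. It tests that the possible patterns do not depend on the remaining coordinates,
  so that patterns of different samples can support one hypothesis.\<close>

definition probe :: "(nat \<Rightarrow> nat) \<Rightarrow> nat \<Rightarrow> state \<Rightarrow> (nat set \<Rightarrow> bool) \<Rightarrow> nat set \<Rightarrow> nat set \<Rightarrow> nat set \<Rightarrow> nat set \<Rightarrow> state outcome" where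
  "probe \<pi> l = (\<lambda>(I, Z, D) h x y z m.
     check \<pi> l (I, Z, D) h x m (pattern \<pi> I Z h x)
       (x \<oplus> (m \<inter> (normalize \<pi> I Z D h y \<oplus> normalize \<pi> I Z D h z)))
       (normalize \<pi> I Z D h y \<oplus> (D \<inter> \<pi> -` pattern \<pi> I Z h x)))"

definition test_round :: "nat \<Rightarrow> (nat \<Rightarrow> nat) \<Rightarrow> nat \<Rightarrow> nat set pmf \<Rightarrow> (nat set \<Rightarrow> bool) \<Rightarrow> state \<Rightarrow> state outcome pmf" where
  "test_round n \<pi> l U h s = do {
     x \<leftarrow> U; y \<leftarrow> U; z \<leftarrow> U; m \<leftarrow> pmf_of_set (Pow {..<n});
     return_pmf (probe \<pi> l s h x y z m)}"

text \<open>A DNF on the blocks is identified with the set of patterns that satisfy it, so that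
  hypotheses can be compared by counting.\<close>

definition dnfs :: "nat set \<Rightarrow> nat \<Rightarrow> nat set set set" where
  "dnfs I r = {f. \<exists>Ts. length Ts \<le> r \<and> (\<forall>T\<in>set Ts. vars T \<subseteq> I) \<and>
     f = {b. b \<subseteq> I \<and> (\<exists>T\<in>set Ts. \<forall>(i, v)\<in>T. (i \<in> b) = v)}}"

definition hypothesis :: "nat set \<Rightarrow> nat \<Rightarrow> nat set set \<Rightarrow> nat set set" where
  "hypothesis I r P = arg_min card (\<lambda>f. f \<in> dnfs I r \<and> P \<subseteq> f)"

text \<open>The \<open>k3\<close> sampled patterns exclude hypotheses that are too small. The
  \<open>k4\<close> trials implant random patterns of the hypothesis in fresh samples and so detect
  hypotheses that are too large.\<close>

definition verify :: "(nat \<Rightarrow> nat) \<Rightarrow> nat \<Rightarrow> nat \<Rightarrow> nat \<Rightarrow> nat set pmf \<Rightarrow> (nat set \<Rightarrow> bool) \<Rightarrow> state \<Rightarrow> bool pmf" where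
  "verify \<pi> r k3 k4 U h = (\<lambda>(I, Z, D). do {
     ps \<leftarrow> replicate_pmf k3 (map_pmf (pattern \<pi> I Z h) U);
     vs \<leftarrow> replicate_pmf k4 (do {
       y \<leftarrow> U; b \<leftarrow> pmf_of_set (hypothesis I r (set ps));
       return_pmf (h (normalize \<pi> I Z D h y \<oplus> (D \<inter> \<pi> -` b)))});
     return_pmf (False \<notin> set vs)})"

text \<open>If \<open>h\<close> has no ones, \<open>the None\<close> makes this meaningless; the tester then stops earlier.\<close>
definition sample :: "nat \<Rightarrow> (bool list \<Rightarrow> bool) \<Rightarrow> nat set pmf" where
  "sample n h = map_pmf (\<lambda>u. bits (the u)) (samp n h)"

text \<open>\<open>None\<close> is accepted because the constantly false function is a factored DNF
  without terms. \<open>Suc \<mu>\<close> stages leave room for \<open>\<mu>\<close>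
  discoveries.\<close>

definition tester :: "nat \<Rightarrow> nat \<Rightarrow> nat \<Rightarrow> nat \<Rightarrow> nat \<Rightarrow> nat \<Rightarrow> nat \<Rightarrow> (bool list \<Rightarrow> bool) \<Rightarrow> bool pmf" where
  "tester n r \<mu> l k k3 k4 h = do {
     u \<leftarrow> samp n h;
     if u = None then return_pmf True
     else do {
       \<pi> \<leftarrow> pmf_of_set ({..<n} \<rightarrow>\<^sub>E {..<l});
       search (test_round n \<pi> l (sample n h) (\<lambda>x. h (word n x)))
         (verify \<pi> r k3 k4 (sample n h) (\<lambda>x. h (word n x))) k (Suc \<mu>) ({}, \<lambda>_. {}, {})}}"

section \<open>Numbers of queries\<close>

lemma new_block_Extend:
  assumes "new_block \<pi> l (I, Z, D) h x w = Extend s'"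
  obtains j where "j < l" "drops \<pi> I h x w j"
    "s' = (insert j I, Z(j := hyb \<pi> (I \<union> {..<j}) w x), D \<union> (x \<oplus> w) \<inter> \<pi> -` {j})"
proof -
  have ex: "\<exists>j<l. drops \<pi> I h x w j" using assms by (auto simp: new_block_def split: if_splits)
  define j where "j = (SOME j. j < l \<and> drops \<pi> I h x w j)"
  have "j < l \<and> drops \<pi> I h x w j" unfolding j_def by (rule someI_ex) (use ex in auto)
  moreover have "s' = (insert j I, Z(j := hyb \<pi> (I \<union> {..<j}) w x), D \<union> (x \<oplus> w) \<inter> \<pi> -` {j})"
    using assms ex by (simp add: new_block_def Let_def flip: j_def)
  ultimately show thesis using that by blast
qed

text \<open>A block of \<open>I\<close> is replaced before the path begins, so its own step changes
  nothing.\<close>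

lemma drops_not_mem: "drops \<pi> I h x w j \<Longrightarrow> j \<notin> I"
proof
  assume *: "drops \<pi> I h x w j" and "j \<in> I"
  then have "I \<union> {..<Suc j} = I \<union> {..<j}" by (auto simp: less_Suc_eq)
  then show False using * by (simp add: drops_def)
qed

definition pattern_queries :: "(nat \<Rightarrow> nat) \<Rightarrow> nat set \<Rightarrow> (nat \<Rightarrow> nat set) \<Rightarrow> nat set \<Rightarrow> nat set set" where
  "pattern_queries \<pi> I Z x = (\<lambda>B. hyb \<pi> {B} x (Z B)) ` I"

lemma pattern_cong:
  assumes "\<And>v. v \<in> pattern_queries \<pi> I Z x \<Longrightarrow> h v = h' v"
  shows "pattern \<pi> I Z h x = pattern \<pi> I Z h' x"
proof -
  have "h (hyb \<pi> {B} x (Z B)) = h' (hyb \<pi> {B} x (Z B))" if "B \<in> I" for B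
    using that by (intro assms) (simp add: pattern_queries_def)
  then show ?thesis unfolding pattern_def by blast
qed

lemma computable_pattern:
  assumes "finite I" "card I \<le> \<mu>"
  shows "computable n \<mu> (\<lambda>h. return_pmf (pattern \<pi> I Z (\<lambda>x. h (word n x)) x))"
proof (rule computable_depends)
  show "finite (pattern_queries \<pi> I Z x)" using assms by (simp add: pattern_queries_def)
  show "card (pattern_queries \<pi> I Z x) \<le> \<mu>"
    unfolding pattern_queries_def using card_image_le[OF assms(1)] assms(2) by (rule order_trans)
  show "depends (pattern_queries \<pi> I Z x) (\<lambda>h. pattern \<pi> I Z h x)"
    unfolding depends_def by (auto intro!: pattern_cong)
qed

definition path_queries :: "(nat \<Rightarrow> nat) \<Rightarrow> nat \<Rightarrow> nat set \<Rightarrow> nat set \<Rightarrow> nat set \<Rightarrow> nat set set" where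
  "path_queries \<pi> l I x w = (\<lambda>j. hyb \<pi> (I \<union> {..<j}) w x) ` {..l}"

lemma new_block_cong:
  assumes "\<And>v. v \<in> path_queries \<pi> l I x w \<Longrightarrow> h v = h' v"
  shows "new_block \<pi> l (I, Z, D) h x w = new_block \<pi> l (I, Z, D) h' x w"
proof -
  have "drops \<pi> I h x w j \<longleftrightarrow> drops \<pi> I h' x w j" if "j < l" for j
    using that assms by (auto simp: drops_def path_queries_def)
  then have *: "(\<lambda>j. j < l \<and> drops \<pi> I h x w j) = (\<lambda>j. j < l \<and> drops \<pi> I h' x w j)" by auto
  show ?thesis unfolding new_block_def prod.case * by (rule refl)
qed

definition kept_queries :: "(nat \<Rightarrow> nat) \<Rightarrow> nat set \<Rightarrow> (nat \<Rightarrow> nat set) \<Rightarrow> nat set \<Rightarrow> nat set set" where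
  "kept_queries \<pi> I Z w = insert w (pattern_queries \<pi> I Z w)"

lemma kept_queries_card:
  assumes "finite I" "card I \<le> \<mu>"
  shows "finite (kept_queries \<pi> I Z w)" "card (kept_queries \<pi> I Z w) \<le> Suc \<mu>"
proof -
  show "finite (kept_queries \<pi> I Z w)" using assms by (simp add: kept_queries_def pattern_queries_def)
  have "card (kept_queries \<pi> I Z w) \<le> Suc (card (pattern_queries \<pi> I Z w))"
    unfolding kept_queries_def by (rule card_insert_le_m1[THEN le_trans]) (auto simp: card_insert_le_m1)
  also have "\<dots> \<le> Suc \<mu>"
    unfolding pattern_queries_def using card_image_le[OF assms(1)] assms(2) by (meson Suc_le_mono le_trans)
  finally show "card (kept_queries \<pi> I Z w) \<le> Suc \<mu>" .
qed

text \<open>Once \<open>a\<close>, \<open>w1\<close> and \<open>w2\<close> are fixed, all points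
  that may matter are known: \<open>Q1\<close> belongs to the two candidate points,
  \<open>Q2\<close> to the splittings of the recorded changes, \<open>Q3\<close> to the two
  paths.\<close>

lemma computable_check:
  assumes I: "finite I" "card I \<le> \<mu>"
  shows "computable n (2 * (\<mu> + 1) + 2 * \<mu> * (\<mu> + 1) + 2 * (l + 1))
     (\<lambda>h. return_pmf (check \<pi> l (I, Z, D) (\<lambda>x. h (word n x)) x m a w1 w2))"
proof -
  define u v where "u = (\<lambda>B. x \<oplus> (m \<inter> (D \<inter> \<pi> -` {B})))" and "v = (\<lambda>B. x \<oplus> (D \<inter> \<pi> -` {B} - m))"
  define K where "K = kept_queries \<pi> I Z"
  define Q1 where "Q1 = K w1 \<union> K w2"
  define Q2 where "Q2 = (\<Union>B\<in>I. K (u B) \<union> K (v B))"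
  define Q3 where "Q3 = path_queries \<pi> l I x w1 \<union> path_queries \<pi> l I x w2"
  have K: "finite (K w)" "card (K w) \<le> \<mu> + 1" for w
    using kept_queries_card[OF I] by (auto simp: K_def)
  have K2: "card (K w \<union> K w') \<le> 2 * (\<mu> + 1)" for w w'
    unfolding mult_2 by (rule order_trans[OF card_Un_le add_mono[OF K(2) K(2)]])
  have path: "finite (path_queries \<pi> l I x w)" "card (path_queries \<pi> l I x w) \<le> l + 1" for w
    using card_image_le[of "{..l}"] by (simp_all add: path_queries_def)
  have Q: "finite Q1" "finite Q2" "finite Q3" using K path I by (auto simp: Q1_def Q2_def Q3_def)
  have "card Q1 \<le> 2 * (\<mu> + 1)" unfolding Q1_def by (rule K2)
  moreover have "card Q2 \<le> 2 * \<mu> * (\<mu> + 1)"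
  proof -
    have "card Q2 \<le> (\<Sum>B\<in>I. card (K (u B) \<union> K (v B)))" unfolding Q2_def by (rule card_UN_le[OF I(1)])
    also have "\<dots> \<le> (\<Sum>B\<in>I. 2 * (\<mu> + 1))" by (intro sum_mono K2)
    also have "\<dots> \<le> \<mu> * (2 * (\<mu> + 1))" using mult_le_mono1[OF I(2)] by (simp only: sum_constant of_nat_id)
    finally show ?thesis by (simp add: mult_ac)
  qed
  moreover have "card Q3 \<le> 2 * (l + 1)"
    unfolding Q3_def mult_2 by (rule order_trans[OF card_Un_le add_mono[OF path(2) path(2)]])
  ultimately have card: "card (Q1 \<union> Q2 \<union> Q3) \<le> 2 * (\<mu> + 1) + 2 * \<mu> * (\<mu> + 1) + 2 * (l + 1)"
    using card_Un_le[of "Q1 \<union> Q2" Q3] card_Un_le[of Q1 Q2] by linarith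
  show ?thesis
  proof (rule computable_depends[OF _ card])
    show "finite (Q1 \<union> Q2 \<union> Q3)" using Q by simp
    show "depends (Q1 \<union> Q2 \<union> Q3) (\<lambda>h. check \<pi> l (I, Z, D) h x m a w1 w2)"
      unfolding depends_def
    proof (intro allI impI)
      fix h h' :: "nat set \<Rightarrow> bool" assume eq: "\<forall>q\<in>Q1 \<union> Q2 \<union> Q3. h q = h' q"
      have pat: "pattern \<pi> I Z h w = pattern \<pi> I Z h' w" if "K w \<subseteq> Q1 \<union> Q2 \<union> Q3" for w
        using that eq unfolding K_def kept_queries_def by (intro pattern_cong) blast
      have kept: "kept \<pi> I Z h a w = kept \<pi> I Z h' a w" if "K w \<subseteq> Q1 \<union> Q2 \<union> Q3" for w
        using pat[OF that] that eq unfolding K_def kept_queries_def kept_def by blast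
      have w12: "K w1 \<subseteq> Q1 \<union> Q2 \<union> Q3" "K w2 \<subseteq> Q1 \<union> Q2 \<union> Q3" by (auto simp: Q1_def)
      have uv: "K (u B) \<subseteq> Q1 \<union> Q2 \<union> Q3" "K (v B) \<subseteq> Q1 \<union> Q2 \<union> Q3" if "B \<in> I" for B
        using that by (auto simp: Q2_def)
      have "(\<exists>B\<in>I. kept \<pi> I Z h a (u B) = kept \<pi> I Z h a (v B)) \<longleftrightarrow>
          (\<exists>B\<in>I. kept \<pi> I Z h' a (u B) = kept \<pi> I Z h' a (v B))"
        using uv by (intro bex_cong refl) (simp add: kept)
      moreover have "h w1 = h' w1" "h w2 = h' w2"
        using eq by (auto simp: Q1_def K_def kept_queries_def)
      moreover have "new_block \<pi> l (I, Z, D) h x w1 = new_block \<pi> l (I, Z, D) h' x w1"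
        "new_block \<pi> l (I, Z, D) h x w2 = new_block \<pi> l (I, Z, D) h' x w2"
        using eq by (intro new_block_cong; simp add: Q3_def)+
      ultimately show "check \<pi> l (I, Z, D) h x m a w1 w2 = check \<pi> l (I, Z, D) h' x m a w1 w2"
        unfolding check_def prod.case u_def[symmetric] v_def[symmetric] pat[OF w12(1)] pat[OF w12(2)]
        by (auto simp: u_def v_def)
    qed
  qed
qed

lemma computable_probe:
  assumes I: "finite I" "card I \<le> \<mu>"
  shows "computable n (3 * \<mu> + (2 * (\<mu> + 1) + 2 * \<mu> * (\<mu> + 1) + 2 * (l + 1)))
     (\<lambda>h. return_pmf (probe \<pi> l (I, Z, D) (\<lambda>x. h (word n x)) x y z m))"
proof -
  let ?p = "\<lambda>h. pattern \<pi> I Z (\<lambda>x. h (word n x))" and ?q = "2 * (\<mu> + 1) + 2 * \<mu> * (\<mu> + 1) + 2 * (l + 1)"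
  \<comment> \<open>The patterns are parameters here: they must be known before the points derived
    from them can be queried.\<close>
  let ?c = "\<lambda>h a b c. return_pmf (check \<pi> l (I, Z, D) (\<lambda>x. h (word n x)) x m a
     (x \<oplus> (m \<inter> (y \<oplus> (D \<inter> \<pi> -` b) \<oplus> (z \<oplus> (D \<inter> \<pi> -` c))))) (y \<oplus> (D \<inter> \<pi> -` b) \<oplus> (D \<inter> \<pi> -` a)))"
  have "computable n (\<mu> + ?q) (\<lambda>h. ?c h a b (?p h z))" for a b
    by (rule computable_bind_det[OF computable_pattern[OF I], where V = UNIV and G = "\<lambda>c h. ?c h a b c"])
      (rule computable_check[OF I], simp)
  then have "computable n (\<mu> + (\<mu> + ?q)) (\<lambda>h. ?c h a (?p h y) (?p h z))" for a
    by (rule computable_bind_det[OF computable_pattern[OF I], where V = UNIV and G = "\<lambda>b h. ?c h a b (?p h z)"]) auto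
  then have "computable n (\<mu> + (\<mu> + (\<mu> + ?q))) (\<lambda>h. ?c h (?p h x) (?p h y) (?p h z))"
    by (rule computable_bind_det[OF computable_pattern[OF I], where V = UNIV and G = "\<lambda>a h. ?c h a (?p h y) (?p h z)"]) auto
  then show ?thesis by (simp add: probe_def normalize_def algebra_simps)
qed

lemma computable_sample: "computable n 1 (sample n)"
  unfolding sample_def by (rule computable_map[OF computable_samp])

lemma computable_bind': 
  assumes "computable n q F" "\<And>a. computable n q' (G a)"
  shows "computable n (q + q') (\<lambda>h. bind_pmf (F h) (\<lambda>a. G a h))"
  using computable_bind[OF assms, of UNIV] by simp

lemma computable_round:
  assumes I: "finite I" "card I \<le> \<mu>"
  shows "computable n (3 + 3 * \<mu> + 2 * (\<mu> + 1) + 2 * \<mu> * (\<mu> + 1) + 2 * (l + 1))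
     (\<lambda>h. test_round n \<pi> l (sample n h) (\<lambda>x. h (word n x)) (I, Z, D))"
proof -
  let ?q = "3 * \<mu> + (2 * (\<mu> + 1) + 2 * \<mu> * (\<mu> + 1) + 2 * (l + 1))"
  have "computable n (1 + (1 + (1 + (0 + ?q)))) (\<lambda>h. test_round n \<pi> l (sample n h) (\<lambda>x. h (word n x)) (I, Z, D))"
    unfolding test_round_def
    by (intro computable_bind' computable_sample computable_uniform computable_probe[OF I]) auto
  then show ?thesis by (rule computable_mono) simp
qed

lemma Pow_mem_dnfs: "0 < r \<Longrightarrow> Pow I \<in> dnfs I r"
  unfolding dnfs_def by (intro CollectI exI[of _ "[{}]"]) (auto simp: vars_def)

lemma hypothesis:
  assumes "0 < r" "P \<subseteq> Pow I"
  shows "hypothesis I r P \<in> dnfs I r" "P \<subseteq> hypothesis I r P"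
    "\<And>f. f \<in> dnfs I r \<Longrightarrow> P \<subseteq> f \<Longrightarrow> card (hypothesis I r P) \<le> card f"
proof -
  have "Pow I \<in> dnfs I r \<and> P \<subseteq> Pow I" using Pow_mem_dnfs assms by blast
  from arg_min_nat_lemma[of "\<lambda>f. f \<in> dnfs I r \<and> P \<subseteq> f", OF this, of card, folded hypothesis_def]
  show "hypothesis I r P \<in> dnfs I r" "P \<subseteq> hypothesis I r P"
    "\<And>f. f \<in> dnfs I r \<Longrightarrow> P \<subseteq> f \<Longrightarrow> card (hypothesis I r P) \<le> card f"
    by blast+
qed

lemma dnfs_subset: "f \<in> dnfs I r \<Longrightarrow> f \<subseteq> Pow I"
  unfolding dnfs_def by blast

lemma dnfs_finite: "finite I \<Longrightarrow> f \<in> dnfs I r \<Longrightarrow> finite f"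
  using finite_subset[OF dnfs_subset] by simp

lemma pattern_subset: "pattern \<pi> I Z h x \<subseteq> I"
  by (auto simp: pattern_def)

lemma computable_verify:
  assumes I: "finite I" "card I \<le> \<mu>" and "0 < r" "0 < k3"
  shows "computable n (k3 * (1 + \<mu>) + k4 * (2 + \<mu>))
     (\<lambda>h. verify \<pi> r k3 k4 (sample n h) (\<lambda>x. h (word n x)) (I, Z, D))"
proof -
  let ?p = "\<lambda>h. pattern \<pi> I Z (\<lambda>x. h (word n x))"
  \<comment> \<open>At least one pattern is sampled, so the hypothesis is nonempty and can itself be
    sampled.\<close>
  let ?V = "{ps. ps \<noteq> [] \<and> set ps \<subseteq> Pow I}"
  have pat: "computable n (1 + \<mu>) (\<lambda>h. map_pmf (?p h) (sample n h))"
    unfolding map_pmf_def by (intro computable_bind' computable_sample computable_pattern[OF I])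
  have "computable n (k4 * (2 + \<mu>)) (\<lambda>h. replicate_pmf k4 (do {
       y \<leftarrow> sample n h; b \<leftarrow> pmf_of_set (hypothesis I r (set ps));
       return_pmf (h (word n (y \<oplus> (D \<inter> \<pi> -` ?p h y) \<oplus> (D \<inter> \<pi> -` b))))}) \<bind> (\<lambda>vs. return_pmf (False \<notin> set vs)))"
    if ps: "ps \<in> ?V" for ps
  proof -
    let ?f = "hypothesis I r (set ps)"
    have f: "finite ?f" "?f \<noteq> {}"
      using hypothesis[OF assms(3), of "set ps" I] ps dnfs_finite[OF I(1)] by auto
    have "computable n (\<mu> + 1) (\<lambda>h. return_pmf (h (word n (y \<oplus> (D \<inter> \<pi> -` ?p h y) \<oplus> (D \<inter> \<pi> -` b)))))" for y b
      by (rule computable_bind_det[OF computable_pattern[OF I], where V = UNIV and G = "\<lambda>a h. return_pmf (h (word n (y \<oplus> (D \<inter> \<pi> -` a) \<oplus> (D \<inter> \<pi> -` b))))"])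
        (use computable_MQ in simp_all)
    then have "computable n (1 + (0 + (\<mu> + 1))) (\<lambda>h. do {
       y \<leftarrow> sample n h; b \<leftarrow> pmf_of_set ?f;
       return_pmf (h (word n (y \<oplus> (D \<inter> \<pi> -` ?p h y) \<oplus> (D \<inter> \<pi> -` b))))})"
      by (intro computable_bind' computable_sample computable_uniform f) auto
    from computable_bind'[OF computable_replicate[OF this, of k4] computable_return, of "\<lambda>vs. False \<notin> set vs"]
    show ?thesis by simp
  qed
  then have "computable n (k3 * (1 + \<mu>) + k4 * (2 + \<mu>)) (\<lambda>h. replicate_pmf k3 (map_pmf (?p h) (sample n h)) \<bind> (\<lambda>ps. replicate_pmf k4 (do {
       y \<leftarrow> sample n h; b \<leftarrow> pmf_of_set (hypothesis I r (set ps));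
       return_pmf (h (word n (y \<oplus> (D \<inter> \<pi> -` ?p h y) \<oplus> (D \<inter> \<pi> -` b))))}) \<bind> (\<lambda>vs. return_pmf (False \<notin> set vs))))"
    by (intro computable_bind[OF computable_replicate[OF pat], where V = ?V])
      (use assms(4) pattern_subset in \<open>fastforce simp: set_replicate_pmf\<close>)+
  then show ?thesis by (simp add: verify_def normalize_def)
qed

lemma check_Extend:
  assumes "check \<pi> l (I, Z, D) h x m a w1 w2 = Extend s'"
  shows "\<not> h w1 \<and> new_block \<pi> l (I, Z, D) h x w1 = Extend s' \<or>
    \<not> h w2 \<and> new_block \<pi> l (I, Z, D) h x w2 = Extend s'"
  using assms unfolding check_def prod.case by (metis outcome.distinct)

lemma probe_Extend:
  assumes "probe \<pi> l (I, Z, D) h x y z m = Extend s'"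
  obtains w where "w = x \<oplus> (m \<inter> (normalize \<pi> I Z D h y \<oplus> normalize \<pi> I Z D h z)) \<or>
      w = normalize \<pi> I Z D h y \<oplus> (D \<inter> \<pi> -` pattern \<pi> I Z h x)" "\<not> h w"
    "new_block \<pi> l (I, Z, D) h x w = Extend s'"
proof -
  note * = check_Extend[OF assms[unfolded probe_def prod.case]]
  show thesis
    using * that[OF disjI1[OF refl]] that[OF disjI2[OF refl]] by argo
qed

lemma round_Extend_card:
  assumes "Extend s' \<in> set_pmf (test_round n \<pi> l U h s)"
  shows "finite (fst s) \<Longrightarrow> finite (fst s') \<and> card (fst s') \<le> Suc (card (fst s))"
proof -
  obtain I Z D where s: "s = (I, Z, D)" by (cases s)
  obtain x y z m where "probe \<pi> l (I, Z, D) h x y z m = Extend s'"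
    using assms by (auto simp: test_round_def s)
  then show "finite (fst s) \<Longrightarrow> finite (fst s') \<and> card (fst s') \<le> Suc (card (fst s))"
    by (elim probe_Extend new_block_Extend) (auto simp: s card_insert_if)
qed

lemma computable_tester:
  assumes "0 < r" "0 < k3" "0 < l"
  shows "computable n (1 + (Suc \<mu> * (k * (3 + 3 * \<mu> + 2 * (\<mu> + 1) + 2 * \<mu> * (\<mu> + 1) + 2 * (l + 1)))
     + (k3 * (1 + \<mu>) + k4 * (2 + \<mu>)))) (tester n r \<mu> l k k3 k4)"
    (is "computable n (1 + ?q) _")
proof -
  \<comment> \<open>As long as a stage remains, at most \<open>\<mu>\<close> blocks are known, which
    bounds the queries of a round.\<close>
  define Inv :: "nat \<Rightarrow> state \<Rightarrow> bool" where "Inv = (\<lambda>j s. finite (fst s) \<and> card (fst s) + j \<le> Suc \<mu>)"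
  have search: "computable n ?q (\<lambda>h. search (test_round n \<pi> l (sample n h) (\<lambda>x. h (word n x)))
         (verify \<pi> r k3 k4 (sample n h) (\<lambda>x. h (word n x))) k (Suc \<mu>) ({}, \<lambda>_. {}, {}))" for \<pi>
  proof (rule computable_search[where Inv = Inv])
    fix j s assume "Inv (Suc j) s"
    then show "computable n (3 + 3 * \<mu> + 2 * (\<mu> + 1) + 2 * \<mu> * (\<mu> + 1) + 2 * (l + 1))
        (\<lambda>h. test_round n \<pi> l (sample n h) (\<lambda>x. h (word n x)) s)"
      "computable n (k3 * (1 + \<mu>) + k4 * (2 + \<mu>)) (\<lambda>h. verify \<pi> r k3 k4 (sample n h) (\<lambda>x. h (word n x)) s)"
      using computable_round[of "fst s" \<mu> n l \<pi> "fst (snd s)" "snd (snd s)"]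
        computable_verify[of "fst s" \<mu> r k3 n k4 \<pi> "fst (snd s)" "snd (snd s)"] assms
      by (auto simp: Inv_def)
  next
    fix j s s' h assume "Inv (Suc j) s" "Extend s' \<in> set_pmf (test_round n \<pi> l (sample n h) (\<lambda>x. h (word n x)) s)"
    then show "Inv j s'" using round_Extend_card[of s' n \<pi> l "sample n h" "\<lambda>x. h (word n x)" s] by (auto simp: Inv_def)
  qed (simp add: Inv_def)
  have "computable n ?q (\<lambda>h. if u = None then return_pmf True else do {
       \<pi> \<leftarrow> pmf_of_set ({..<n} \<rightarrow>\<^sub>E {..<l});
       search (test_round n \<pi> l (sample n h) (\<lambda>x. h (word n x)))
         (verify \<pi> r k3 k4 (sample n h) (\<lambda>x. h (word n x))) k (Suc \<mu>) ({}, \<lambda>_. {}, {})})" for u :: "bool list option"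
  proof (cases u)
    case None
    then show ?thesis by (auto intro: computable_mono[OF computable_return])
  next
    case Some
    have "computable n (0 + ?q) (\<lambda>h. do {
       \<pi> \<leftarrow> pmf_of_set ({..<n} \<rightarrow>\<^sub>E {..<l});
       search (test_round n \<pi> l (sample n h) (\<lambda>x. h (word n x)))
         (verify \<pi> r k3 k4 (sample n h) (\<lambda>x. h (word n x))) k (Suc \<mu>) ({}, \<lambda>_. {}, {})})"
      by (intro computable_bind' computable_uniform search) (use assms in \<open>auto intro!: finite_PiE simp: PiE_eq_empty_iff\<close>)
    then show ?thesis using Some by simp
  qed
  from computable_bind'[OF computable_samp this] show ?thesis by (simp add: tester_def[abs_def])
qed

section \<open>Soundness: passing sets are close to a factored DNF\<close>

text \<open>The recorded \<open>Z\<close> and the content of \<open>D\<close> are arbitrary here: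
  what soundness requires of them is certified by the round itself.\<close>

locale state =
  fixes n :: nat and \<pi> :: "nat \<Rightarrow> nat" and I :: "nat set" and Z :: "nat \<Rightarrow> nat set" and D :: "nat set"
    and h :: "nat set \<Rightarrow> bool" and S :: "nat set set"
  assumes fin_I: "finite I" and D: "D \<subseteq> {..<n}" and S_eq: "S = {x. x \<subseteq> {..<n} \<and> h x}" and S_ne: "S \<noteq> {}"
begin

abbreviation "pat \<equiv> pattern \<pi> I Z h"
abbreviation "nrm \<equiv> normalize \<pi> I Z D h"
abbreviation "dd b \<equiv> D \<inter> \<pi> -` b"

lemma dd_subset: "dd b \<subseteq> {..<n}" using D by auto

sublocale translation n S pat nrm
proof
  show "S \<subseteq> Pow {..<n}" "S \<noteq> {}" using S_eq S_ne by auto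
  show "nrm x \<subseteq> {..<n}" if "x \<in> S" for x
    unfolding normalize_def using that S_eq dd_subset by (intro xor_subset) auto
  show "nrm x \<oplus> nrm y = x \<oplus> y" if "pat x = pat y" for x y
    unfolding normalize_def that by (auto simp: set_eq_iff)
qed

lemma mem_S: "x \<subseteq> {..<n} \<Longrightarrow> x \<in> S \<longleftrightarrow> h x" by (simp add: S_eq)

lemma S_subset: "x \<in> S \<Longrightarrow> x \<subseteq> {..<n}" by (simp add: S_eq)

lemma keep_iff: "x \<in> S \<Longrightarrow> v \<subseteq> {..<n} \<Longrightarrow> keep v x \<longleftrightarrow> kept \<pi> I Z h (pat x) (x \<oplus> v)"
  using mem_S[OF xor_subset[of x _ v]] S_subset by (simp add: keep_def kept_def)

lemma nrm_xor: "x \<in> S \<Longrightarrow> keep v x \<Longrightarrow> nrm (x \<oplus> v) = nrm x \<oplus> v"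
  unfolding normalize_def keep_def by (auto simp: set_eq_iff)

lemma round_prob:
  "measure_pmf.prob (test_round n \<pi> l (pmf_of_set S) h (I, Z, D)) {u. u \<noteq> Pass} =
    (\<Sum>x\<in>S. \<Sum>y\<in>S. \<Sum>z\<in>S. \<Sum>m\<in>C. of_bool (probe \<pi> l (I, Z, D) h x y z m \<noteq> Pass)) / (N ^ 3 * M)"
proof -
  have C: "finite C" "C \<noteq> {}" by auto
  show ?thesis
    unfolding test_round_def prob_bind_pmf
    by (simp add: integral_pmf_of_set finite_S S_ne C sum_divide_distrib divide_divide_eq_left
        power3_eq_cube mult_ac indicator_def of_bool_def)
qed

context
  fixes l :: nat and \<delta> :: real
  assumes round_ok: "measure_pmf.prob (test_round n \<pi> l (pmf_of_set S) h (I, Z, D)) {u. u \<noteq> Pass} \<le> \<delta>"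
begin

lemma round_sum:
  "(\<Sum>x\<in>S. \<Sum>y\<in>S. \<Sum>z\<in>S. \<Sum>m\<in>C. of_bool (probe \<pi> l (I, Z, D) h x y z m \<noteq> Pass)) \<le> \<delta> * (N ^ 3 * M)"
  using round_ok N_pos M_pos unfolding round_prob by (simp add: divide_le_eq)

lemma Pass_imp:
  assumes "probe \<pi> l (I, Z, D) h x y z m = Pass" and xyz: "x \<in> S" "y \<in> S" "z \<in> S" and m: "m \<subseteq> {..<n}"
  shows "keep (m \<inter> (nrm y \<oplus> nrm z)) x" "h (nrm y \<oplus> dd (pat x))"
    "\<And>B. B \<in> I \<Longrightarrow> keep (m \<inter> dd {B}) x \<noteq> keep (dd {B} - m) x"
proof -
  have new: "new_block \<pi> l (I, Z, D) h x w \<noteq> Pass" for w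
    by (simp add: new_block_def Let_def)
  let ?w1 = "x \<oplus> (m \<inter> (nrm y \<oplus> nrm z))" and ?w2 = "nrm y \<oplus> dd (pat x)"
  note * = assms(1)[unfolded probe_def check_def prod.case]
  have a: "\<not> (\<exists>B\<in>I. kept \<pi> I Z h (pat x) (x \<oplus> (m \<inter> dd {B})) = kept \<pi> I Z h (pat x) (x \<oplus> (dd {B} - m)))"
    and b: "pat ?w1 = pat x" and c: "h ?w1" "h ?w2"
    using * new by (metis outcome.distinct(1))+
  have sub: "m \<inter> (nrm y \<oplus> nrm z) \<subseteq> {..<n}" using m by blast
  show "keep (m \<inter> (nrm y \<oplus> nrm z)) x"
    unfolding keep_iff[OF xyz(1) sub] kept_def using b c by simp
  show "h ?w2" by (rule c)
  fix B assume "B \<in> I"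
  moreover have "m \<inter> dd {B} \<subseteq> {..<n}" "dd {B} - m \<subseteq> {..<n}" using D by auto
  ultimately show "keep (m \<inter> dd {B}) x \<noteq> keep (dd {B} - m) x"
    using a keep_iff[OF xyz(1)] by simp
qed

text \<open>Counting the bad \<open>x\<close> for fixed \<open>y\<close>, \<open>z\<close> and
  \<open>m\<close> turns the failure probability of a round into the average of \<open>g\<close>
  that \<open>mask_test\<close> speaks of.\<close>

lemma mask_sum: "(\<Sum>y\<in>S. \<Sum>z\<in>S. \<Sum>m\<in>C. g (m \<inter> (nrm y \<oplus> nrm z))) \<le> \<delta> * N^2 * M"
proof -
  have "(\<Sum>y\<in>S. \<Sum>z\<in>S. \<Sum>m\<in>C. g (m \<inter> (nrm y \<oplus> nrm z))) * N =
     (\<Sum>y\<in>S. \<Sum>z\<in>S. \<Sum>m\<in>C. \<Sum>x\<in>S. of_bool (\<not> keep (m \<inter> (nrm y \<oplus> nrm z)) x))"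
    using card_not_keep finite_S by (simp add: sum_distrib_right of_bool_def sum.If_cases Int_def)
  also have "\<dots> \<le> (\<Sum>y\<in>S. \<Sum>z\<in>S. \<Sum>m\<in>C. \<Sum>x\<in>S. of_bool (probe \<pi> l (I, Z, D) h x y z m \<noteq> Pass))"
    using Pass_imp(1) by (intro sum_mono) (auto simp: of_bool_def)
  also have "\<dots> = (\<Sum>y\<in>S. \<Sum>z\<in>S. \<Sum>x\<in>S. \<Sum>m\<in>C. of_bool (probe \<pi> l (I, Z, D) h x y z m \<noteq> Pass))"
    by (intro sum.cong refl sum.swap)
  also have "\<dots> = (\<Sum>y\<in>S. \<Sum>x\<in>S. \<Sum>z\<in>S. \<Sum>m\<in>C. of_bool (probe \<pi> l (I, Z, D) h x y z m \<noteq> Pass))"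
    by (intro sum.cong refl sum.swap)
  also have "\<dots> = (\<Sum>x\<in>S. \<Sum>y\<in>S. \<Sum>z\<in>S. \<Sum>m\<in>C. of_bool (probe \<pi> l (I, Z, D) h x y z m \<noteq> Pass))"
    by (rule sum.swap)
  also have "\<dots> \<le> (\<delta> * N^2 * M) * N" using round_sum by (simp add: power2_eq_square power3_eq_cube mult_ac)
  finally show ?thesis using N_pos by (subst (asm) mult_le_cancel_right_pos) auto
qed

lemma cross_sum: "(\<Sum>x\<in>S. \<Sum>y\<in>S. of_bool (\<not> h (nrm y \<oplus> dd (pat x)))) \<le> \<delta> * N^2"
proof -
  have "(\<Sum>x\<in>S. \<Sum>y\<in>S. of_bool (\<not> h (nrm y \<oplus> dd (pat x)))) * (N * M) =
     (\<Sum>x\<in>S. \<Sum>y\<in>S. \<Sum>z\<in>S. \<Sum>m\<in>C. of_bool (\<not> h (nrm y \<oplus> dd (pat x))))"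
    by (simp add: sum_distrib_left sum_distrib_right mult_ac)
  also have "\<dots> \<le> (\<Sum>x\<in>S. \<Sum>y\<in>S. \<Sum>z\<in>S. \<Sum>m\<in>C. of_bool (probe \<pi> l (I, Z, D) h x y z m \<noteq> Pass))"
    using Pass_imp(2) by (intro sum_mono) (auto simp: of_bool_def)
  also have "\<dots> \<le> (\<delta> * N^2) * (N * M)" using round_sum by (simp add: power2_eq_square power3_eq_cube mult_ac)
  finally show ?thesis using N_pos M_pos by (subst (asm) mult_le_cancel_right_pos) auto
qed

lemma flip_sum:
  assumes "B \<in> I"
  shows "(\<Sum>m\<in>C. real (card {x\<in>S. keep (m \<inter> dd {B}) x = keep (dd {B} - m) x})) \<le> \<delta> * N * M"
proof -
  let ?f = "\<lambda>m x. of_bool (keep (m \<inter> dd {B}) x = keep (dd {B} - m) x) :: real"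
  have "(\<Sum>m\<in>C. real (card {x\<in>S. keep (m \<inter> dd {B}) x = keep (dd {B} - m) x})) = (\<Sum>m\<in>C. \<Sum>x\<in>S. ?f m x)"
    using finite_S by (simp add: of_bool_def sum.If_cases Int_def)
  also have "\<dots> = (\<Sum>x\<in>S. \<Sum>m\<in>C. ?f m x)" by (rule sum.swap)
  finally have "(\<Sum>m\<in>C. real (card {x\<in>S. keep (m \<inter> dd {B}) x = keep (dd {B} - m) x})) * N^2 =
      (\<Sum>x\<in>S. \<Sum>y\<in>S. \<Sum>z\<in>S. \<Sum>m\<in>C. ?f m x)"
    by (simp add: sum_distrib_right sum_distrib_left power2_eq_square mult_ac)
  also have "\<dots> \<le> (\<Sum>x\<in>S. \<Sum>y\<in>S. \<Sum>z\<in>S. \<Sum>m\<in>C. of_bool (probe \<pi> l (I, Z, D) h x y z m \<noteq> Pass))"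
    using Pass_imp(3)[OF _ _ _ _ _ assms] by (intro sum_mono) (auto simp: of_bool_def)
  also have "\<dots> \<le> (\<delta> * N * M) * N^2" using round_sum by (simp add: power2_eq_square power3_eq_cube mult_ac)
  finally show ?thesis using N_pos by (subst (asm) mult_le_cancel_right_pos) auto
qed

text \<open>The witness \<open>S'\<close> is the union, over the patterns \<open>b\<close> in
  \<open>f\<close>, of the translates by \<open>dd b\<close> of the coset of \<open>R\<close>
  through the center. Coordinates in \<open>R\<close> are free, those in \<open>J\<close> carry the
  terms, and all others are fixed by \<open>H\<close>. Points of \<open>S\<close> outside
  \<open>S'\<close> have a pattern outside \<open>f\<close> or are normalized outside the coset;
  points of \<open>S'\<close> outside \<open>S\<close> are counted through \<open>member\<close>,
  since free translations hardly affect samples.\<close>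

lemma near_factored:
  assumes \<delta>: "\<delta> \<le> \<delta>4 / 100" "\<delta>3 \<le> \<delta>4 / 100" "\<delta>4 \<le> 1 / 100"
    and f: "f \<in> dnfs I r" and I: "card I \<le> \<mu>"
    and cover: "real (card {x\<in>S. pat x \<notin> f}) \<le> \<delta>3 * N"
    and member: "(\<Sum>b\<in>f. real (card {y\<in>S. \<not> h (nrm y \<oplus> dd b)})) \<le> \<delta>4 * N * card f"
  shows "\<exists>S' \<subseteq> C. factored_dnf n r \<mu> (\<lambda>x. bits x \<in> S') \<and>
    real (card (S - S')) + real (card (S' - S)) \<le> 2 * \<delta>4 * N"
proof -
  have \<delta>': "\<delta> \<le> 1 / 100" using \<delta> by simp
  note facts = mask_sum \<delta>'
  have \<delta>0: "0 \<le> \<delta>" by (rule \<delta>_nonneg[OF facts])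
  obtain a0 where a0: "a0 \<in> S" and bad: "real (card {x\<in>S. \<not> nrm x \<oplus> nrm a0 \<subseteq> R}) \<le> 3 * \<delta> * N"
    using exists_center[OF facts] by blast
  define a where "a = nrm a0"
  have a: "a \<subseteq> {..<n}" unfolding a_def by (rule \<tau>_subset[OF a0])
  have R: "R \<subseteq> {..<n}" by (auto simp: R_def)
  then have finR: "finite R" by (rule finite_subset) simp
  \<comment> \<open>The single coordinate of the change that is not free becomes the variable that
    represents the block in the terms.\<close>
  have "card (dd {B} - R) = 1" if "B \<in> I" for B
    by (rule flip_test_card[OF facts dd_subset flip_sum[OF that]])
  then have "\<forall>B\<in>I. \<exists>i. dd {B} - R = {i}" by (simp add: card_1_singleton_iff)
  then obtain \<iota> where \<iota>: "\<And>B. B \<in> I \<Longrightarrow> dd {B} - R = {\<iota> B}" by metis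
  have \<iota>D: "\<iota> B \<in> D" "\<pi> (\<iota> B) = B" "\<iota> B \<notin> R" "\<iota> B < n" if "B \<in> I" for B
    using \<iota>[OF that] D by auto
  have inj: "inj_on \<iota> I" using \<iota>D(2) by (metis inj_onI)
  define J where "J = \<iota> ` I"
  have cardJ: "card J = card I" unfolding J_def by (rule card_image[OF inj])
  have dd_J: "dd b - R = \<iota> ` b" if "b \<subseteq> I" for b
  proof -
    have "dd b - R = (\<Union>B\<in>b. dd {B} - R)" by auto
    also have "\<dots> = (\<Union>B\<in>b. {\<iota> B})" using \<iota> that by (intro SUP_cong) auto
    finally show ?thesis by auto
  qed
  have fI: "f \<subseteq> Pow I" by (rule dnfs_subset[OF f])
  have finf: "finite f" by (rule dnfs_finite[OF fin_I f])
  \<comment> \<open>Inside \<open>S'\<close> the pattern is visible directly, as the deviation from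
    the center at the variables \<open>\<iota> B\<close>.\<close>
  define pt where "pt = (\<lambda>x. {B\<in>I. (\<iota> B \<in> x) \<noteq> (\<iota> B \<in> a)})"
  define E where "E = (\<lambda>b. {x. x \<subseteq> {..<n} \<and> x \<oplus> a \<oplus> dd b \<subseteq> R})"
  define S' where "S' = (\<Union>b\<in>f. E b)"
  have E_iff: "x \<in> E b \<longleftrightarrow> (\<forall>i<n. i \<notin> R \<union> J \<longrightarrow> (i \<in> x \<longleftrightarrow> i \<in> a)) \<and> pt x = b"
    if x: "x \<subseteq> {..<n}" and b: "b \<subseteq> I" for x b
  proof -
    have "x \<in> E b \<longleftrightarrow> (\<forall>i. i \<notin> R \<longrightarrow> ((i \<in> x) \<noteq> (i \<in> a)) = (i \<in> dd b - R))"
      using x by (auto simp: E_def)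
    also have "\<dots> \<longleftrightarrow> (\<forall>i. i \<notin> R \<longrightarrow> ((i \<in> x) \<noteq> (i \<in> a)) = (i \<in> \<iota> ` b))"
      unfolding dd_J[OF b] ..
    also have "\<dots> \<longleftrightarrow> (\<forall>i. i \<notin> R \<union> J \<longrightarrow> (i \<in> x \<longleftrightarrow> i \<in> a)) \<and> (\<forall>B\<in>I. ((\<iota> B \<in> x) \<noteq> (\<iota> B \<in> a)) = (B \<in> b))"
    proof -
      have "\<iota> B \<in> \<iota> ` b \<longleftrightarrow> B \<in> b" if "B \<in> I" for B
        using inj b that by (auto simp: inj_on_def)
      note 1 = this
      have 2: "i \<notin> \<iota> ` b" if "i \<notin> J" for i using that b by (auto simp: J_def)
      show ?thesis
      proof (rule iffI, intro conjI allI ballI impI)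
        fix i assume "\<forall>i. i \<notin> R \<longrightarrow> ((i \<in> x) \<noteq> (i \<in> a)) = (i \<in> \<iota> ` b)" "i \<notin> R \<union> J"
        then show "i \<in> x \<longleftrightarrow> i \<in> a" using 2[of i] by blast
      next
        fix B assume "\<forall>i. i \<notin> R \<longrightarrow> ((i \<in> x) \<noteq> (i \<in> a)) = (i \<in> \<iota> ` b)" "B \<in> I"
        then show "((\<iota> B \<in> x) \<noteq> (\<iota> B \<in> a)) = (B \<in> b)" using 1[of B] \<iota>D(3)[of B] by blast
      next
        assume *: "(\<forall>i. i \<notin> R \<union> J \<longrightarrow> (i \<in> x \<longleftrightarrow> i \<in> a)) \<and> (\<forall>B\<in>I. ((\<iota> B \<in> x) \<noteq> (\<iota> B \<in> a)) = (B \<in> b))"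
        have "((i \<in> x) \<noteq> (i \<in> a)) = (i \<in> \<iota> ` b)" if "i \<notin> R" for i
        proof (cases "i \<in> J")
          case True
          then obtain B where "B \<in> I" "i = \<iota> B" unfolding J_def by blast
          then show ?thesis using * 1 by simp
        next
          case False
          then show ?thesis using * 2 that by simp
        qed
        then show "\<forall>i. i \<notin> R \<longrightarrow> ((i \<in> x) \<noteq> (i \<in> a)) = (i \<in> \<iota> ` b)" by blast
      qed
    qed
    also have "(\<forall>i. i \<notin> R \<union> J \<longrightarrow> (i \<in> x \<longleftrightarrow> i \<in> a)) \<longleftrightarrow> (\<forall>i<n. i \<notin> R \<union> J \<longrightarrow> (i \<in> x \<longleftrightarrow> i \<in> a))"
      using x a by blast
    also have "(\<forall>B\<in>I. ((\<iota> B \<in> x) \<noteq> (\<iota> B \<in> a)) = (B \<in> b)) \<longleftrightarrow> pt x = b"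
      using b by (auto simp: pt_def)
    finally show ?thesis .
  qed
  have S'_iff: "x \<in> S' \<longleftrightarrow> (\<forall>i<n. i \<notin> R \<union> J \<longrightarrow> (i \<in> x \<longleftrightarrow> i \<in> a)) \<and> pt x \<in> f" if "x \<subseteq> {..<n}" for x
    unfolding S'_def using E_iff[OF that] fI by blast
  have "S' \<subseteq> C" by (auto simp: S'_def E_def)
  moreover have "factored_dnf n r \<mu> (\<lambda>x. bits x \<in> S')"
  proof -
    obtain Ts where Ts: "length Ts \<le> r" "\<And>T. T \<in> set Ts \<Longrightarrow> vars T \<subseteq> I"
        "f = {b. b \<subseteq> I \<and> (\<exists>T\<in>set Ts. \<forall>(i, v)\<in>T. (i \<in> b) = v)}"
      using f unfolding dnfs_def by blast
    \<comment> \<open>Patterns record deviations from \<open>a\<close>, so a literal keeps its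
      polarity exactly where \<open>a\<close> is 0.\<close>
    define tr where "tr = (\<lambda>T. (\<lambda>(B, v). (\<iota> B, v \<noteq> (\<iota> B \<in> a))) ` (T :: literal set))"
    define H :: "literal set" where "H = (\<lambda>i. (i, i \<in> a)) ` ({..<n} - (R \<union> J))"
    have vars_tr: "vars (tr T) = \<iota> ` vars T" for T
      by (force simp: vars_def tr_def image_image)
    have vJ: "(\<Union>T\<in>set (map tr Ts). vars T) \<subseteq> J"
      using Ts(2) by (auto simp: vars_tr J_def)
    have vH: "vars H = {..<n} - (R \<union> J)" by (force simp: vars_def H_def)
    show ?thesis unfolding factored_dnf_def
    proof (intro exI conjI ballI)
      show "length (map tr Ts) \<le> r" using Ts by simp
      show "vars H \<subseteq> {..<n}" using vH by auto
      show "(\<Union>T\<in>set (map tr Ts). vars T) \<subseteq> {..<n}" using vJ \<iota>D(4) by (auto simp: J_def)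
      show "vars H \<inter> (\<Union>T\<in>set (map tr Ts). vars T) = {}" using vJ vH by blast
      show "card (\<Union>T\<in>set (map tr Ts). vars T) \<le> \<mu>"
        using card_mono[OF _ vJ] fin_I I cardJ by (simp add: J_def)
      fix x assume "x \<in> cube n"
      then have len: "length x = n" by (simp add: cube_def)
      have bx: "i \<in> bits x \<longleftrightarrow> x ! i" if "i < n" for i using that len by (simp add: bits_def)
      have "conj_true H x \<longleftrightarrow> (\<forall>i<n. i \<notin> R \<union> J \<longrightarrow> (i \<in> bits x \<longleftrightarrow> i \<in> a))"
        using bx by (auto simp: conj_true_def H_def)
      moreover have "conj_true (tr T) x \<longleftrightarrow> (\<forall>(i, v)\<in>T. (i \<in> pt (bits x)) = v)" if "T \<in> set Ts" for T
      proof -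
        have "conj_true (tr T) x \<longleftrightarrow> (\<forall>(B, v)\<in>T. x ! (\<iota> B) = (v \<noteq> (\<iota> B \<in> a)))"
          by (auto simp: conj_true_def tr_def)
        also have "\<dots> \<longleftrightarrow> (\<forall>(B, v)\<in>T. (B \<in> pt (bits x)) = v)"
        proof (intro ball_cong refl, clarify)
          fix B v assume "(B, v) \<in> T"
          then have "B \<in> I" using Ts(2)[OF that] by (force simp: vars_def)
          then show "(x ! (\<iota> B) = (v \<noteq> (\<iota> B \<in> a))) = ((B \<in> pt (bits x)) = v)"
            using bx[OF \<iota>D(4)] by (auto simp: pt_def)
        qed
        finally show ?thesis .
      qed
      moreover have "pt (bits x) \<subseteq> I" by (auto simp: pt_def)
      ultimately show "(bits x \<in> S') \<longleftrightarrow> conj_true H x \<and> (\<exists>T\<in>set (map tr Ts). conj_true T x)"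
        unfolding S'_iff[OF bits_subset[OF len]] by (auto simp: Ts(3))
    qed
  qed
  moreover have "real (card (S - S')) + real (card (S' - S)) \<le> 2 * \<delta>4 * N"
  proof -
    have "S - S' \<subseteq> {x\<in>S. pat x \<notin> f} \<union> {x\<in>S. \<not> nrm x \<oplus> a \<subseteq> R}"
    proof
      fix x assume x: "x \<in> S - S'"
      have "x \<in> S'" if "pat x \<in> f" "nrm x \<oplus> a \<subseteq> R"
      proof -
        have "x \<oplus> a \<oplus> dd (pat x) = nrm x \<oplus> a" by (auto simp: normalize_def set_eq_iff)
        then have "x \<in> E (pat x)" using that x S_subset by (simp add: E_def)
        then show ?thesis using that by (auto simp: S'_def)
      qed
      then show "x \<in> {x\<in>S. pat x \<notin> f} \<union> {x\<in>S. \<not> nrm x \<oplus> a \<subseteq> R}" using x by blast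
    qed
    then have "card (S - S') \<le> card ({x\<in>S. pat x \<notin> f} \<union> {x\<in>S. \<not> nrm x \<oplus> a \<subseteq> R})"
      by (rule card_mono[rotated]) (use finite_S in auto)
    also have "\<dots> \<le> card {x\<in>S. pat x \<notin> f} + card {x\<in>S. \<not> nrm x \<oplus> a \<subseteq> R}" by (rule card_Un_le)
    finally have 1: "real (card (S - S')) \<le> \<delta>3 * N + 3 * \<delta> * N"
      using cover bad unfolding a_def by linarith
    define L where "L = real (card (Pow R))"
    have L: "L > 0" unfolding L_def using finR by (simp add: card_Pow)
    define \<kappa> where "\<kappa> = (\<lambda>b. real (card {v\<in>Pow R. \<not> h (a \<oplus> v \<oplus> dd b)}))"
    define c where "c = (\<lambda>b. real (card {y\<in>S. \<not> h (nrm y \<oplus> dd b)}))"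
    have \<kappa>_nonneg: "\<kappa> b \<ge> 0" for b by (simp add: \<kappa>_def)
    \<comment> \<open>Translation by a vector of free coordinates loses at most
      \<open>16 * \<delta> * N\<close> samples and is injective on the others.\<close>
    have shift: "real (card {y\<in>S. \<not> h (nrm y \<oplus> v \<oplus> dd b)}) \<le> 16 * \<delta> * N + c b" if v: "v \<in> Pow R" for v b
    proof -
      have "{y\<in>S. \<not> h (nrm y \<oplus> v \<oplus> dd b)} \<subseteq> {y\<in>S. \<not> keep v y} \<union> {y\<in>S. keep v y \<and> \<not> h (nrm (y \<oplus> v) \<oplus> dd b)}"
        using nrm_xor by auto
      then have "card {y\<in>S. \<not> h (nrm y \<oplus> v \<oplus> dd b)} \<le> card ({y\<in>S. \<not> keep v y} \<union> {y\<in>S. keep v y \<and> \<not> h (nrm (y \<oplus> v) \<oplus> dd b)})"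
        by (rule card_mono[rotated]) (use finite_S in auto)
      also have "\<dots> \<le> card {y\<in>S. \<not> keep v y} + card {y\<in>S. keep v y \<and> \<not> h (nrm (y \<oplus> v) \<oplus> dd b)}"
        by (rule card_Un_le)
      also have "card {y\<in>S. keep v y \<and> \<not> h (nrm (y \<oplus> v) \<oplus> dd b)} \<le> card {y\<in>S. \<not> h (nrm y \<oplus> dd b)}"
        by (rule card_inj_on_le[of "\<lambda>y. y \<oplus> v"]) (use finite_S inj_on_xor in \<open>auto simp: keep_def\<close>)
      finally have "real (card {y\<in>S. \<not> h (nrm y \<oplus> v \<oplus> dd b)}) \<le> g v * N + c b"
        unfolding c_def card_not_keep[symmetric] by simp
      moreover have "g v * N \<le> 16 * \<delta> * N"
        using g_le_of_subset[OF facts, of v] v by (intro mult_right_mono) auto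
      ultimately show ?thesis by linarith
    qed
    \<comment> \<open>Double counting: for every \<open>y\<close> that is normalized into the coset
      of the center, the points \<open>nrm y \<oplus> v\<close> with \<open>v\<close> in
      \<open>Pow R\<close> run through that coset exactly once.\<close>
    have kb: "(1 - 3 * \<delta>) * N * \<kappa> b \<le> L * (16 * \<delta> * N + c b)" for b
    proof -
      let ?G = "{y\<in>S. nrm y \<oplus> a \<subseteq> R}"
      have "card ?G + card {x\<in>S. \<not> nrm x \<oplus> a \<subseteq> R} = card S"
        using finite_S by (subst card_Un_disjoint[symmetric]) (auto intro: arg_cong[where f=card])
      then have G: "(1 - 3 * \<delta>) * N \<le> real (card ?G)" using bad unfolding a_def by (simp add: algebra_simps)
      have "(1 - 3 * \<delta>) * N * \<kappa> b \<le> real (card ?G) * \<kappa> b" by (intro mult_right_mono G \<kappa>_nonneg)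
      also have "\<dots> = (\<Sum>y\<in>?G. \<kappa> b)" by simp
      also have "\<dots> = (\<Sum>y\<in>?G. real (card {v\<in>Pow R. \<not> h (nrm y \<oplus> v \<oplus> dd b)}))"
      proof (intro sum.cong refl)
        fix y assume y: "y \<in> ?G"
        have eq: "nrm y \<oplus> (v \<oplus> (nrm y \<oplus> a)) = a \<oplus> v" for v by (auto simp: set_eq_iff)
        have "bij_betw (\<lambda>v. v \<oplus> (nrm y \<oplus> a)) {v\<in>Pow R. \<not> h (a \<oplus> v \<oplus> dd b)} {v\<in>Pow R. \<not> h (nrm y \<oplus> v \<oplus> dd b)}"
        proof (rule bij_betw_byWitness[where f' = "\<lambda>v. v \<oplus> (nrm y \<oplus> a)"])
          show "(\<lambda>v. v \<oplus> (nrm y \<oplus> a)) ` {v\<in>Pow R. \<not> h (a \<oplus> v \<oplus> dd b)} \<subseteq> {v\<in>Pow R. \<not> h (nrm y \<oplus> v \<oplus> dd b)}"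
            using y xor_subset by (auto simp: eq simp del: mem_xor)
          have eq': "a \<oplus> (v \<oplus> (nrm y \<oplus> a)) = nrm y \<oplus> v" for v by (auto simp: set_eq_iff)
          show "(\<lambda>v. v \<oplus> (nrm y \<oplus> a)) ` {v\<in>Pow R. \<not> h (nrm y \<oplus> v \<oplus> dd b)} \<subseteq> {v\<in>Pow R. \<not> h (a \<oplus> v \<oplus> dd b)}"
            using y xor_subset by (auto simp: eq' simp del: mem_xor)
        qed simp_all
        then show "\<kappa> b = real (card {v\<in>Pow R. \<not> h (nrm y \<oplus> v \<oplus> dd b)})"
          unfolding \<kappa>_def by (simp add: bij_betw_same_card)
      qed
      also have "\<dots> \<le> (\<Sum>y\<in>S. real (card {v\<in>Pow R. \<not> h (nrm y \<oplus> v \<oplus> dd b)}))"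
        by (rule sum_mono2) (use finite_S in auto)
      also have "\<dots> = (\<Sum>y\<in>S. \<Sum>v\<in>Pow R. of_bool (\<not> h (nrm y \<oplus> v \<oplus> dd b)))"
        using finR by (simp add: of_bool_def sum.If_cases Int_def)
      also have "\<dots> = (\<Sum>v\<in>Pow R. \<Sum>y\<in>S. of_bool (\<not> h (nrm y \<oplus> v \<oplus> dd b)))" by (rule sum.swap)
      also have "\<dots> = (\<Sum>v\<in>Pow R. real (card {y\<in>S. \<not> h (nrm y \<oplus> v \<oplus> dd b)}))"
        using finite_S by (simp add: of_bool_def sum.If_cases Int_def)
      also have "\<dots> \<le> (\<Sum>v\<in>Pow R. 16 * \<delta> * N + c b)" by (intro sum_mono shift)
      also have "\<dots> = L * (16 * \<delta> * N + c b)" by (simp add: L_def)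
      finally show ?thesis .
    qed
    define F where "F = real (card f)"
    have "(1 - 3 * \<delta>) * N * (\<Sum>b\<in>f. \<kappa> b) = (\<Sum>b\<in>f. (1 - 3 * \<delta>) * N * \<kappa> b)" by (simp add: sum_distrib_left)
    also have "\<dots> \<le> (\<Sum>b\<in>f. L * (16 * \<delta> * N + c b))" by (intro sum_mono kb)
    also have "\<dots> = L * (F * (16 * \<delta> * N) + (\<Sum>b\<in>f. c b))"
      by (simp add: F_def sum.distrib flip: sum_distrib_left)
    also have "\<dots> \<le> L * (F * (16 * \<delta> * N) + \<delta>4 * N * F)"
      using member L unfolding c_def F_def by (intro mult_left_mono add_left_mono) auto
    finally have "((1 - 3 * \<delta>) * (\<Sum>b\<in>f. \<kappa> b)) * N \<le> (L * F * (16 * \<delta> + \<delta>4)) * N"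
      by (simp add: algebra_simps)
    then have k: "(1 - 3 * \<delta>) * (\<Sum>b\<in>f. \<kappa> b) \<le> L * F * (16 * \<delta> + \<delta>4)"
      using N_pos by (subst (asm) mult_le_cancel_right_pos) auto
    have E_img: "E b = (\<lambda>v. a \<oplus> v \<oplus> dd b) ` Pow R" for b
    proof (intro equalityI subsetI)
      fix x assume "x \<in> E b"
      moreover have "x = a \<oplus> (x \<oplus> a \<oplus> dd b) \<oplus> dd b" by (auto simp: set_eq_iff)
      ultimately show "x \<in> (\<lambda>v. a \<oplus> v \<oplus> dd b) ` Pow R" unfolding E_def by blast
    next
      fix x assume "x \<in> (\<lambda>v. a \<oplus> v \<oplus> dd b) ` Pow R"
      then obtain v where v: "v \<subseteq> R" "x = a \<oplus> v \<oplus> dd b" by blast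
      then have "x \<oplus> a \<oplus> dd b = v" by (auto simp: set_eq_iff)
      moreover have "x \<subseteq> {..<n}" unfolding v(2) using v(1) a R dd_subset by (intro xor_subset) auto
      ultimately show "x \<in> E b" using v(1) by (simp add: E_def)
    qed
    have inj_E: "inj_on (\<lambda>v. a \<oplus> v \<oplus> dd b) X" for b X
      by (rule inj_on_inverseI[where g = "\<lambda>x. a \<oplus> x \<oplus> dd b"]) (auto simp: set_eq_iff)
    have card_E: "real (card (E b)) = L" for b unfolding E_img L_def by (simp add: card_image[OF inj_E])
    have fin_E: "finite (E b)" for b unfolding E_img using finR by simp
    have "card (\<Union>b\<in>f. E b) = (\<Sum>b\<in>f. card (E b))"
    proof (rule card_UN_disjoint[OF finf])
      show "\<forall>i\<in>f. \<forall>j\<in>f. i \<noteq> j \<longrightarrow> E i \<inter> E j = {}"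
      proof (intro ballI impI)
        fix b b' assume b: "b \<in> f" "b' \<in> f" "b \<noteq> b'"
        have False if "x \<in> E b" "x \<in> E b'" for x
        proof -
          have "x \<subseteq> {..<n}" using that by (simp add: E_def)
          then show False using E_iff[of x b] E_iff[of x b'] that b fI by blast
        qed
        then show "E b \<inter> E b' = {}" by blast
      qed
    qed (simp add: fin_E)
    then have "real (card S') = L * F" unfolding S'_def F_def by (simp add: card_E)
    moreover have "card S' \<le> card (S \<union> (S' - S))"
      by (rule card_mono) (use finite_S fin_E finf in \<open>auto simp: S'_def\<close>)
    moreover have "card (S \<union> (S' - S)) \<le> card S + card (S' - S)" by (rule card_Un_le)
    \<comment> \<open>The error is measured relative to the size \<open>L * F\<close> of
      \<open>S'\<close>, which may itself exceed \<open>N\<close> by the quantity to be bounded.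
      This circularity is resolved by absorbing a small multiple of \<open>s\<close>.\<close>
    ultimately have LF: "L * F \<le> N + real (card (S' - S))" by linarith
    have "S' - S \<subseteq> (\<Union>b\<in>f. (\<lambda>v. a \<oplus> v \<oplus> dd b) ` {v\<in>Pow R. \<not> h (a \<oplus> v \<oplus> dd b)})"
    proof
      fix x assume x: "x \<in> S' - S"
      then obtain b where b: "b \<in> f" "x \<in> E b" by (auto simp: S'_def)
      then obtain v where v: "v \<in> Pow R" "x = a \<oplus> v \<oplus> dd b" unfolding E_img by blast
      have "x \<subseteq> {..<n}" using b by (simp add: E_def)
      then have "\<not> h x" using x mem_S by blast
      then show "x \<in> (\<Union>b\<in>f. (\<lambda>v. a \<oplus> v \<oplus> dd b) ` {v\<in>Pow R. \<not> h (a \<oplus> v \<oplus> dd b)})" using b v by blast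
    qed
    then have "card (S' - S) \<le> card (\<Union>b\<in>f. (\<lambda>v. a \<oplus> v \<oplus> dd b) ` {v\<in>Pow R. \<not> h (a \<oplus> v \<oplus> dd b)})"
      by (rule card_mono[rotated]) (use finR finf in auto)
    also have "\<dots> \<le> (\<Sum>b\<in>f. card ((\<lambda>v. a \<oplus> v \<oplus> dd b) ` {v\<in>Pow R. \<not> h (a \<oplus> v \<oplus> dd b)}))"
      by (rule card_UN_le[OF finf])
    finally have sk: "real (card (S' - S)) \<le> (\<Sum>b\<in>f. \<kappa> b)"
      by (simp add: \<kappa>_def card_image[OF inj_E] flip: of_nat_sum)
    define s where "s = real (card (S' - S))"
    define e where "e = 16 * \<delta> + \<delta>4"
    have s0: "s \<ge> 0" by (simp add: s_def)
    have d0: "\<delta>4 \<ge> 0" using \<delta> \<delta>0 by linarith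
    have "(1 - 3 * \<delta>) * s \<le> (1 - 3 * \<delta>) * (\<Sum>b\<in>f. \<kappa> b)"
      using sk \<delta>' by (intro mult_left_mono) (auto simp: s_def)
    also have "\<dots> \<le> L * F * e" using k by (simp add: e_def)
    also have "\<dots> \<le> (N + s) * e" using LF \<delta>0 d0 by (intro mult_right_mono) (auto simp: s_def e_def)
    finally have "s \<le> e * N + s * (3 * \<delta> + e)" by (simp add: algebra_simps)
    moreover have "s * (3 * \<delta> + e) \<le> s * (1 / 10)" using s0 \<delta> by (intro mult_left_mono) (auto simp: e_def)
    moreover have "e * N \<le> (116/100 * \<delta>4) * N" using \<delta> N_pos by (intro mult_right_mono) (auto simp: e_def)
    \<comment> \<open>\<open>1.16 / 0.9\<close> is below \<open>1.3\<close>.\<close>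
    ultimately have s: "s \<le> 13/10 * \<delta>4 * N" using d0 N_pos mult_nonneg_nonneg[of \<delta>4 N] by linarith
    have "\<delta>3 * N + 3 * \<delta> * N \<le> (4/100 * \<delta>4) * N"
      using \<delta> N_pos by (subst distrib_right[symmetric], intro mult_right_mono) auto
    then show ?thesis using 1 s d0 N_pos mult_nonneg_nonneg[of \<delta>4 N] unfolding s_def by linarith
  qed
  ultimately show ?thesis by blast
qed

end

end

section \<open>Learning the set of patterns\<close>

lemma sum_power_le: "1 \<le> A \<Longrightarrow> (\<Sum>i\<le>r. A ^ i) \<le> (2 * A :: nat) ^ r"
proof (induction r)
  case (Suc r)
  define P where "P = (2 * A) ^ r"
  have "A ^ r \<le> P" unfolding P_def by (intro power_mono) auto
  then have "A * A ^ r \<le> A * P" by simp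
  moreover have "P \<le> A * P" using Suc.prems by simp
  moreover have "(\<Sum>i\<le>r. A ^ i) \<le> P" using Suc unfolding P_def by blast
  ultimately show ?case
    unfolding sum.atMost_Suc power_Suc P_def[symmetric] mult.assoc by linarith
qed simp

text \<open>A term is a set of literals over \<open>I\<close>, so there are at most
  \<open>2 ^ (2 * \<mu>)\<close> terms. The exponent of the bound enters the choice of
  \<open>k3\<close>.\<close>

lemma dnfs_card:
  assumes "finite I" "card I \<le> \<mu>"
  shows "finite (dnfs I r)" "card (dnfs I r) \<le> 2 ^ ((2 * \<mu> + 1) * r)"
proof -
  let ?A = "Pow (I \<times> (UNIV :: bool set))"
  let ?L = "{Ts. set Ts \<subseteq> ?A \<and> length Ts \<le> r}"
  have A: "finite ?A" using assms by simp
  have L: "finite ?L" by (rule finite_lists_length_le[OF A])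
  have sub: "dnfs I r \<subseteq> (\<lambda>Ts. {b. b \<subseteq> I \<and> (\<exists>T\<in>set Ts. \<forall>(i, v)\<in>T. (i \<in> b) = v)}) ` ?L"
  proof
    fix f assume "f \<in> dnfs I r"
    then obtain Ts where Ts: "length Ts \<le> r" "\<forall>T\<in>set Ts. vars T \<subseteq> I"
      "f = {b. b \<subseteq> I \<and> (\<exists>T\<in>set Ts. \<forall>(i, v)\<in>T. (i \<in> b) = v)}" unfolding dnfs_def by blast
    moreover have "set Ts \<subseteq> ?A"
    proof
      fix T assume "T \<in> set Ts"
      then have "fst ` T \<subseteq> I" using Ts(2) by (simp add: vars_def)
      then show "T \<in> ?A" by force
    qed
    ultimately show "f \<in> (\<lambda>Ts. {b. b \<subseteq> I \<and> (\<exists>T\<in>set Ts. \<forall>(i, v)\<in>T. (i \<in> b) = v)}) ` ?L" by blast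
  qed
  then show "finite (dnfs I r)" using L by (blast intro: finite_subset finite_imageI)
  have "card (dnfs I r) \<le> card ?L"
    using card_mono[OF finite_imageI[OF L] sub] card_image_le[OF L] by (rule order_trans)
  also have "\<dots> = (\<Sum>i\<le>r. card ?A ^ i)" by (rule card_lists_length_le[OF A])
  also have "\<dots> \<le> (2 * card ?A) ^ r"
    using assms(1) by (intro sum_power_le) (simp add: card_Pow card_cartesian_product)
  also have "\<dots> \<le> (2 * 2 ^ (2 * \<mu>)) ^ r"
    using assms by (intro power_mono mult_left_mono) (auto simp: card_Pow card_cartesian_product)
  also have "\<dots> = 2 ^ ((2 * \<mu> + 1) * r)" by (simp flip: power_mult power_Suc)
  finally show "card (dnfs I r) \<le> 2 ^ ((2 * \<mu> + 1) * r)" .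
qed

lemma prob_compl_pmf: "measure_pmf.prob Q (- f) = 1 - measure_pmf.prob Q f"
  using measure_pmf.prob_compl[of f Q] by (simp add: Compl_eq_Diff_UNIV)

text \<open>The union bound for consistent learners: a fixed hypothesis with error above
  \<open>d\<close> agrees with \<open>k\<close> samples with probability at most
  \<open>(1 - d) ^ k\<close>.\<close>

lemma consistent_prob:
  fixes d :: real
  assumes F: "finite F" and d: "0 \<le> d" "d \<le> 1"
  shows "measure_pmf.prob (replicate_pmf k Q) {ps. \<exists>f\<in>F. set ps \<subseteq> f \<and> d < measure_pmf.prob Q (- f)} \<le> card F * (1 - d) ^ k"
proof -
  let ?F = "{f\<in>F. d < measure_pmf.prob Q (- f)}"
  have "{ps. \<exists>f\<in>F. set ps \<subseteq> f \<and> d < measure_pmf.prob Q (- f)} = (\<Union>f\<in>?F. {ps. set ps \<subseteq> f})" by blast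
  then have "measure_pmf.prob (replicate_pmf k Q) {ps. \<exists>f\<in>F. set ps \<subseteq> f \<and> d < measure_pmf.prob Q (- f)}
     \<le> (\<Sum>f\<in>?F. measure_pmf.prob (replicate_pmf k Q) {ps. set ps \<subseteq> f})"
    using F by (simp only:) (intro measure_pmf.finite_measure_subadditive_finite, auto)
  also have "\<dots> \<le> (\<Sum>f\<in>?F. (1 - d) ^ k)"
    unfolding prob_replicate_all by (intro sum_mono power_mono) (auto simp: prob_compl_pmf)
  also have "\<dots> \<le> card F * (1 - d) ^ k"
    using F d by (simp add: card_mono mult_right_mono)
  finally show ?thesis .
qed

text \<open>The power is at most \<open>exp (- (a + d))\<close>: the part \<open>a\<close> of the
  exponent pays for the number of hypotheses, the part \<open>d\<close> leaves a bound below
  \<open>1 / d\<close>.\<close>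

lemma union_bound_small:
  assumes "0 < d" "k = d * (a + d)" "c \<le> 2 ^ a"
  shows "real c * (1 - 1 / real d) ^ k \<le> 1 / real d"
proof -
  have "(1 - 1 / real d) ^ k \<le> exp (- (1 / real d)) ^ k"
    using assms exp_ge_add_one_self[of "- (1 / real d)"] by (intro power_mono) auto
  also have "\<dots> = exp (- (a + real d))"
    using assms by (simp add: field_simps flip: exp_of_nat_mult)
  also have "\<dots> = 1 / (exp (real a) * exp (real d))" by (simp add: exp_diff exp_minus field_simps)
  finally have "real c * (1 - 1 / real d) ^ k \<le> real c * (1 / (exp (real a) * exp (real d)))"
    by (rule mult_left_mono) simp
  also have "\<dots> \<le> exp (real a) * (1 / (exp (real a) * exp (real d)))"
  proof (rule mult_right_mono)
    have "real c \<le> 2 ^ a" using assms(3) by (metis of_nat_le_iff of_nat_numeral of_nat_power)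
    also have "\<dots> \<le> exp 1 ^ a" using exp_ge_add_one_self[of 1] by (intro power_mono) auto
    also have "\<dots> = exp (real a)" by (simp flip: exp_of_nat_mult)
    finally show "real c \<le> exp (real a)" .
  qed simp
  also have "\<dots> = 1 / exp (real d)" by simp
  also have "\<dots> \<le> 1 / real d"
    using assms(1) exp_ge_add_one_self[of "real d"] by (intro divide_left_mono) (linarith | simp)+
  finally show ?thesis .
qed

context state
begin

text \<open>For a factored DNF whose relevant blocks are not all found, the set of possible patterns depends on
  the unfound variables; \<open>slice y\<close> fixes these as in \<open>y\<close>.\<close>
definition "slice y = {b. b \<subseteq> I \<and> h (nrm y \<oplus> dd b)}"

lemma fraction_prob: "measure_pmf.prob (pmf_of_set S) {x. P x} = card {x\<in>S. P x} / N"
  using S_ne finite_S by (simp add: measure_pmf_of_set Int_def)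

lemma member_prob:
  assumes "finite f" "f \<noteq> {}"
  shows "measure_pmf.prob (do {y \<leftarrow> pmf_of_set S; b \<leftarrow> pmf_of_set f; return_pmf (h (nrm y \<oplus> dd b))}) {False}
    = (\<Sum>b\<in>f. real (card {y\<in>S. \<not> h (nrm y \<oplus> dd b)})) / (N * card f)"
proof -
  have "measure_pmf.prob (do {y \<leftarrow> pmf_of_set S; b \<leftarrow> pmf_of_set f; return_pmf (h (nrm y \<oplus> dd b))}) {False}
     = (\<Sum>y\<in>S. \<Sum>b\<in>f. of_bool (\<not> h (nrm y \<oplus> dd b))) / (N * card f)"
    unfolding prob_bind_pmf
    by (simp add: integral_pmf_of_set finite_S S_ne assms sum_divide_distrib divide_divide_eq_left
       mult_ac indicator_def of_bool_def)
  also have "(\<Sum>y\<in>S. \<Sum>b\<in>f. of_bool (\<not> h (nrm y \<oplus> dd b))) = (\<Sum>b\<in>f. \<Sum>y\<in>S. of_bool (\<not> h (nrm y \<oplus> dd b)) :: real)"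
    by (rule sum.swap)
  finally show ?thesis using finite_S by (simp add: of_bool_def sum.If_cases Int_def)
qed

context
  fixes r \<mu> d3 k3 k4 :: nat
  assumes r: "0 < r" and I: "card I \<le> \<mu>" and d3: "0 < d3" and k3: "k3 = d3 * ((2 * \<mu> + 1) * r + d3)"
begin

lemma k3_pos: "0 < k3" using d3 k3 by simp

abbreviation "Q \<equiv> map_pmf pat (pmf_of_set S)"

text \<open>All DNFs are treated at once because the hypothesis depends on the sample.\<close>

definition "misled = {ps. \<exists>f\<in>dnfs I r. set ps \<subseteq> f \<and> 1 / d3 < measure_pmf.prob Q (- f)}"

lemma misled_prob: "measure_pmf.prob (replicate_pmf k3 Q) misled \<le> 1 / d3"
  unfolding misled_def using dnfs_card[OF fin_I I] d3
  by (intro order.trans[OF consistent_prob union_bound_small[OF d3 k3]]) auto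

lemma hypothesis_facts:
  assumes "ps \<in> set_pmf (replicate_pmf k3 Q)"
  defines "f \<equiv> hypothesis I r (set ps)"
  shows "f \<in> dnfs I r" "set ps \<subseteq> f" "finite f" "f \<noteq> {}"
    "\<And>f'. f' \<in> dnfs I r \<Longrightarrow> set ps \<subseteq> f' \<Longrightarrow> card f \<le> card f'"
    "ps \<notin> misled \<Longrightarrow> measure_pmf.prob Q (- f) \<le> 1 / d3"
proof -
  have ps: "set ps \<subseteq> Pow I" "ps \<noteq> []"
    using assms pattern_subset k3_pos by (fastforce simp: set_replicate_pmf)+
  note hyp = hypothesis[OF r ps(1), folded f_def]
  show "f \<in> dnfs I r" "set ps \<subseteq> f" by (fact hyp)+
  show "finite f" by (rule dnfs_finite[OF fin_I hyp(1)])
  show "f \<noteq> {}" using hyp(2) ps(2) by auto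
  show "\<And>f'. f' \<in> dnfs I r \<Longrightarrow> set ps \<subseteq> f' \<Longrightarrow> card f \<le> card f'" by (fact hyp(3))
  show "ps \<notin> misled \<Longrightarrow> measure_pmf.prob Q (- f) \<le> 1 / d3"
    using hyp(1,2) unfolding misled_def by (auto simp: not_less)
qed

lemma Q_prob: "measure_pmf.prob Q (- f) = card {x\<in>S. pat x \<notin> f} / N"
  using fraction_prob[of "\<lambda>x. pat x \<notin> f"] by (simp add: vimage_def)

definition "trial f = do {y \<leftarrow> pmf_of_set S; b \<leftarrow> pmf_of_set f; return_pmf (h (nrm y \<oplus> dd b))}"

lemma verify_eq: "verify \<pi> r k3 k4 (pmf_of_set S) h (I, Z, D) = replicate_pmf k3 Q \<bind>
    (\<lambda>ps. map_pmf (\<lambda>vs. False \<notin> set vs) (replicate_pmf k4 (trial (hypothesis I r (set ps)))))"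
  by (simp add: verify_def trial_def map_pmf_def)

text \<open>If the sample does not mislead, the hypothesis covers nearly all patterns. Were its
  failure rate in a trial at most \<open>\<delta>4\<close>, then \<open>near_factored\<close> would
  contradict \<open>far\<close>; so all \<open>k4\<close> trials rarely succeed.\<close>

lemma verify_accept:
  fixes \<delta> \<delta>4 :: real
  assumes round: "measure_pmf.prob (test_round n \<pi> l (pmf_of_set S) h (I, Z, D)) {u. u \<noteq> Pass} \<le> \<delta>"
    and \<delta>: "\<delta> \<le> \<delta>4 / 100" "1 / d3 \<le> \<delta>4 / 100" "\<delta>4 \<le> 1 / 100" and "0 < \<delta>4" "0 < k4"
    and far: "\<And>S'. S' \<subseteq> C \<Longrightarrow> factored_dnf n r \<mu> (\<lambda>x. bits x \<in> S') \<Longrightarrow>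
      real (card (S - S')) + real (card (S' - S)) > 2 * \<delta>4 * N"
  shows "measure_pmf.prob (verify \<pi> r k3 k4 (pmf_of_set S) h (I, Z, D)) {True} \<le> 1 / d3 + 1 / (k4 * \<delta>4)"
proof -
  have "measure_pmf.prob (verify \<pi> r k3 k4 (pmf_of_set S) h (I, Z, D)) {True} \<le>
      measure_pmf.prob (replicate_pmf k3 Q) misled + 1 / (k4 * \<delta>4)"
    unfolding verify_eq
  proof (rule prob_bind_le_except)
    fix ps assume ps: "ps \<in> set_pmf (replicate_pmf k3 Q)" "ps \<notin> misled"
    define f where "f = hypothesis I r (set ps)"
    note f = hypothesis_facts[OF ps(1), folded f_def]
    let ?p = "measure_pmf.prob (trial f) {False}"
    have card_f: "real (card f) > 0" using f by (simp add: card_gt_0_iff)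
    have "\<delta>4 < ?p"
    proof (rule ccontr)
      assume "\<not> \<delta>4 < ?p"
      then have "(\<Sum>b\<in>f. real (card {y\<in>S. \<not> h (nrm y \<oplus> dd b)})) \<le> \<delta>4 * (N * card f)"
        unfolding trial_def member_prob[OF f(3,4)] not_less
        using N_pos card_f by (simp only: pos_divide_le_eq mult_pos_pos)
      moreover have "real (card {x\<in>S. pat x \<notin> f}) \<le> 1 / d3 * N"
        using f(6)[OF ps(2)] N_pos unfolding Q_prob by (simp add: divide_le_eq)
      ultimately obtain S' where "S' \<subseteq> C" "factored_dnf n r \<mu> (\<lambda>x. bits x \<in> S')"
          "real (card (S - S')) + real (card (S' - S)) \<le> 2 * \<delta>4 * N"
        using near_factored[OF round \<delta> f(1) I] by (auto simp: mult.assoc)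
      then show False using far[of S'] by simp
    qed
    have "measure_pmf.prob (map_pmf (\<lambda>vs. False \<notin> set vs) (replicate_pmf k4 (trial f))) {True}
        = measure_pmf.prob (replicate_pmf k4 (trial f)) {vs. set vs \<subseteq> {True}}"
      by (simp, rule arg_cong[where f = "measure_pmf.prob (replicate_pmf k4 (trial f))"]) (auto, metis (full_types))
    also have "\<dots> = (1 - ?p) ^ k4"
    proof -
      have "{True} = - {False}" by auto
      then have "measure_pmf.prob (trial f) {True} = 1 - ?p" by (simp only: prob_compl_pmf)
      then show ?thesis unfolding prob_replicate_all by (simp only:)
    qed
    also have "\<dots> \<le> 1 / (k4 * \<delta>4)" using \<open>\<delta>4 < ?p\<close> assms by (intro one_minus_power_le) auto
    finally show "measure_pmf.prob (map_pmf (\<lambda>vs. False \<notin> set vs) (replicate_pmf k4 (trial (hypothesis I r (set ps))))) {True}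
       \<le> 1 / (k4 * \<delta>4)" by (simp only: f_def)
  qed (use assms in simp)
  then show ?thesis using misled_prob by linarith
qed

text \<open>By \<open>cross_sum\<close> a sampled pattern lies in the slice of a typical
  \<open>y\<close>, so on average at most a fraction \<open>k3 * \<delta>\<close> of the slices
  misses one of the \<open>k3\<close> patterns. Every other slice is a DNF consistent with the
  sample, hence no smaller than the hypothesis, and \<open>count\<close> converts this into a small
  failure rate.\<close>

lemma verify_reject:
  fixes \<delta> :: real
  assumes round: "measure_pmf.prob (test_round n \<pi> l (pmf_of_set S) h (I, Z, D)) {u. u \<noteq> Pass} \<le> \<delta>"
    and slice: "\<And>y. y \<in> S \<Longrightarrow> slice y \<in> dnfs I r"
    and count: "\<And>f P. finite f \<Longrightarrow> f \<subseteq> Pow I \<Longrightarrow> (\<And>y. y \<in> S \<Longrightarrow> P \<subseteq> slice y \<Longrightarrow> card f \<le> card (slice y)) \<Longrightarrow>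
      (\<Sum>y\<in>S. card (f - slice y)) \<le> card f * (card {y\<in>S. \<not> P \<subseteq> slice y} + card {x\<in>S. pat x \<notin> f})"
  shows "measure_pmf.prob (verify \<pi> r k3 k4 (pmf_of_set S) h (I, Z, D)) {False} \<le> k4 * (k3 * \<delta> + 2 / d3)"
proof -
  \<comment> \<open>The fraction of \<open>y\<close> whose slice misses a sampled pattern, where
    minimality of the hypothesis cannot be applied.\<close>
  define A where "A = (\<lambda>ps. (\<Sum>y\<in>S. indicator {ps. \<exists>p\<in>set ps. p \<in> - slice y} ps :: real) / N)"
  \<comment> \<open>A bound for the patterns missed by the hypothesis: \<open>1 / d3\<close>, and
    trivially 1 if the sample misleads.\<close>
  define B where "B = (\<lambda>ps. 1 / d3 + indicator misled ps :: real)"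
  let ?R = "replicate_pmf k3 Q"
  have A01: "0 \<le> A ps" "A ps \<le> 1" for ps
  proof -
    show "0 \<le> A ps" unfolding A_def by (intro divide_nonneg_nonneg sum_nonneg) auto
    have "(\<Sum>y\<in>S. indicator {ps. \<exists>p\<in>set ps. p \<in> - slice y} ps :: real) \<le> (\<Sum>y\<in>S. 1)"
      by (intro sum_mono) (simp add: indicator_def)
    then show "A ps \<le> 1" unfolding A_def using N_pos by (simp add: divide_le_eq)
  qed
  have "1 / real d3 \<le> 1" using d3 by simp
  then have B01: "0 \<le> B ps" "B ps \<le> 2" for ps by (auto simp: B_def indicator_def)
  have intA: "integrable (measure_pmf ?R) A" by (rule integrable_bounded_pmf[OF A01])
  have intB: "integrable (measure_pmf ?R) B" by (rule integrable_bounded_pmf[OF B01])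
  have "measure_pmf.prob (verify \<pi> r k3 k4 (pmf_of_set S) h (I, Z, D)) {False} \<le>
      measure_pmf.expectation ?R (\<lambda>ps. k4 * (A ps + B ps))"
    unfolding verify_eq
  proof (rule prob_bind_le)
    fix ps assume ps: "ps \<in> set_pmf ?R"
    define f where "f = hypothesis I r (set ps)"
    note f = hypothesis_facts[OF ps, folded f_def]
    have card_f: "real (card f) > 0" using f by (simp add: card_gt_0_iff)
    have "(\<lambda>vs. False \<notin> set vs) -` {False} = {vs. \<exists>v\<in>set vs. v \<in> {False}}"
      by blast
    then have "measure_pmf.prob (map_pmf (\<lambda>vs. False \<notin> set vs) (replicate_pmf k4 (trial f))) {False}
        = measure_pmf.prob (replicate_pmf k4 (trial f)) {vs. \<exists>v\<in>set vs. v \<in> {False}}"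
      by (simp only: measure_map_pmf)
    also have "\<dots> \<le> k4 * measure_pmf.prob (trial f) {False}" by (rule prob_replicate_ex_le)
    also have "measure_pmf.prob (trial f) {False} \<le> A ps + B ps"
    proof -
      have fI: "f \<subseteq> Pow I" by (rule dnfs_subset[OF f(1)])
      have "(\<Sum>b\<in>f. real (card {y\<in>S. \<not> h (nrm y \<oplus> dd b)})) = (\<Sum>b\<in>f. \<Sum>y\<in>S. of_bool (b \<notin> slice y))"
      proof (intro sum.cong refl)
        fix b assume "b \<in> f"
        then have "b \<subseteq> I" using fI by blast
        then have "{y\<in>S. \<not> h (nrm y \<oplus> dd b)} = {y\<in>S. b \<notin> slice y}" by (simp add: slice_def)
        then show "real (card {y\<in>S. \<not> h (nrm y \<oplus> dd b)}) = (\<Sum>y\<in>S. of_bool (b \<notin> slice y))"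
          using finite_S by (simp add: of_bool_def sum.If_cases Int_def)
      qed
      also have "\<dots> = (\<Sum>y\<in>S. \<Sum>b\<in>f. of_bool (b \<notin> slice y))" by (rule sum.swap)
      also have "\<dots> = (\<Sum>y\<in>S. real (card (f - slice y)))"
        using f(3) by (simp add: of_bool_def sum.If_cases Int_def set_diff_eq)
      also have "\<dots> = real (\<Sum>y\<in>S. card (f - slice y))" by simp
      also have "\<dots> \<le> real (card f * (card {y\<in>S. \<not> set ps \<subseteq> slice y} + card {x\<in>S. pat x \<notin> f}))"
        using count[OF f(3) fI f(5)[OF slice]] by (simp only: of_nat_le_iff)
      finally have "measure_pmf.prob (trial f) {False} \<le>
          real (card f * (card {y\<in>S. \<not> set ps \<subseteq> slice y} + card {x\<in>S. pat x \<notin> f})) / (N * card f)"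
        unfolding trial_def member_prob[OF f(3,4)] using N_pos card_f by (intro divide_right_mono) auto
      also have "\<dots> = card {y\<in>S. \<not> set ps \<subseteq> slice y} / N + measure_pmf.prob Q (- f)"
        unfolding Q_prob using N_pos card_f by (simp add: field_simps)
      also have "card {y\<in>S. \<not> set ps \<subseteq> slice y} / N = A ps"
        unfolding A_def using finite_S by (simp add: indicator_def sum.If_cases Int_def subset_eq)
      also have "measure_pmf.prob Q (- f) \<le> B ps"
      proof (cases "ps \<in> misled")
        case True
        have "measure_pmf.prob Q (- f) \<le> 1" by (rule measure_pmf.prob_le_1)
        also have "1 \<le> B ps" using True by (simp add: B_def)
        finally show ?thesis .
      next
        case False
        then show ?thesis using f(6) by (simp add: B_def)
      qed
      finally show ?thesis by simp
    qed
    finally show "measure_pmf.prob (map_pmf (\<lambda>vs. False \<notin> set vs) (replicate_pmf k4 (trial (hypothesis I r (set ps))))) {False}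
       \<le> k4 * (A ps + B ps)" by (simp add: f_def mult_left_mono)
  qed (intro integrable_mult_right Bochner_Integration.integrable_add intA intB)
  also have "\<dots> = k4 * (measure_pmf.expectation ?R A + measure_pmf.expectation ?R B)"
    using intA intB by simp
  also have "\<dots> \<le> k4 * (k3 * \<delta> + 2 / d3)"
  proof (rule mult_left_mono)
    have "measure_pmf.expectation ?R (\<lambda>ps. \<Sum>y\<in>S. indicator {ps. \<exists>p\<in>set ps. p \<in> - slice y} ps :: real) =
        (\<Sum>y\<in>S. measure_pmf.expectation ?R (indicator {ps. \<exists>p\<in>set ps. p \<in> - slice y}))"
      by (rule Bochner_Integration.integral_sum, rule integrable_bounded_pmf[where B = 1])
        (simp_all add: indicator_def)
    then have "measure_pmf.expectation ?R A =
        (\<Sum>y\<in>S. measure_pmf.prob ?R {ps. \<exists>p\<in>set ps. p \<in> - slice y}) / N"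
      unfolding A_def by (simp del: ComplI Compl_iff)
    also have "\<dots> \<le> (\<Sum>y\<in>S. k3 * measure_pmf.prob Q (- slice y)) / N"
      using N_pos by (intro divide_right_mono sum_mono prob_replicate_ex_le) auto
    also have "\<dots> = k3 * (\<Sum>y\<in>S. real (card {x\<in>S. pat x \<notin> slice y})) / N^2"
      unfolding Q_prob by (simp add: sum_distrib_left sum_divide_distrib power2_eq_square)
    also have "(\<Sum>y\<in>S. real (card {x\<in>S. pat x \<notin> slice y})) = (\<Sum>y\<in>S. \<Sum>x\<in>S. of_bool (\<not> h (nrm y \<oplus> dd (pat x))))"
      using finite_S pattern_subset by (simp add: of_bool_def sum.If_cases Int_def slice_def)
    also have "\<dots> = (\<Sum>x\<in>S. \<Sum>y\<in>S. of_bool (\<not> h (nrm y \<oplus> dd (pat x))))" by (rule sum.swap)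
    also have "real k3 * (\<Sum>x\<in>S. \<Sum>y\<in>S. of_bool (\<not> h (nrm y \<oplus> dd (pat x)))) / N^2 \<le> k3 * (\<delta> * N^2) / N^2"
      by (rule divide_right_mono[OF mult_left_mono[OF cross_sum[OF round]]]) simp_all
    also have "\<dots> = k3 * \<delta>" using N_pos by simp
    finally have "measure_pmf.expectation ?R A \<le> k3 * \<delta>" .
    moreover have "measure_pmf.expectation ?R B = 1 / d3 + measure_pmf.prob ?R misled"
      unfolding B_def by (subst Bochner_Integration.integral_add)
        (auto intro!: integrable_bounded_pmf[where B = 1] simp: indicator_def)
    ultimately show "measure_pmf.expectation ?R A + measure_pmf.expectation ?R B \<le> k3 * \<delta> + 2 / d3"
      using misled_prob by simp
  qed simp
  finally show ?thesis .
qed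

end

end

section \<open>Completeness: invariants for a factored DNF\<close>

text \<open>\<open>V\<close> holds the variables of the common factor and \<open>\<alpha>\<close>
  their prescribed values; \<open>J\<close> holds the variables of the terms and \<open>F\<close>
  their disjunction. Injectivity of \<open>\<pi>\<close> on \<open>J\<close> says that the partition
  separates the term variables.\<close>

locale factored_oracle =
  fixes n :: nat and \<pi> :: "nat \<Rightarrow> nat" and h :: "nat set \<Rightarrow> bool" and S :: "nat set set"
    and V J \<alpha> :: "nat set" and F :: "nat set \<Rightarrow> bool"
  assumes S_def': "S = {x. x \<subseteq> {..<n} \<and> h x}" and S_ne': "S \<noteq> {}"
    and J: "J \<subseteq> {..<n}" "V \<inter> J = {}" "inj_on \<pi> J"
    and h_iff: "\<And>x. x \<subseteq> {..<n} \<Longrightarrow> h x \<longleftrightarrow> x \<inter> V = \<alpha> \<and> F (x \<inter> J)"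
begin

text \<open>The points that satisfy the common factor. The tester never queries outside this set,
  and inside it \<open>h\<close> depends on the variables in \<open>J\<close> alone.\<close>

definition "cyl = {x. x \<subseteq> {..<n} \<and> x \<inter> V = \<alpha>}"

lemma S_cyl: "x \<in> S \<Longrightarrow> x \<in> cyl"
  using h_iff by (auto simp: S_def' cyl_def)

lemma h_cyl: "x \<in> cyl \<Longrightarrow> h x \<longleftrightarrow> F (x \<inter> J)"
  using h_iff by (simp add: cyl_def)

lemma mem_S_cyl: "x \<in> cyl \<Longrightarrow> x \<in> S \<longleftrightarrow> F (x \<inter> J)"
  using h_cyl by (simp add: S_def' cyl_def)

lemma cyl_xor:
  assumes "x \<in> cyl" "v \<subseteq> {..<n}" "v \<inter> V = {}"
  shows "x \<oplus> v \<in> cyl"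
proof -
  have "(x \<oplus> v) \<inter> V = x \<inter> V" using assms(3) by (auto simp: set_eq_iff)
  then show ?thesis using assms xor_subset[of x _ v] by (simp add: cyl_def)
qed

lemma cyl_diff: "x \<in> cyl \<Longrightarrow> y \<in> cyl \<Longrightarrow> (x \<oplus> y) \<inter> V = {}"
  by (auto simp: cyl_def set_eq_iff)

lemma cyl_subset: "x \<in> cyl \<Longrightarrow> x \<subseteq> {..<n}"
  by (simp add: cyl_def)

lemma cyl_hyb: "x \<in> cyl \<Longrightarrow> y \<in> cyl \<Longrightarrow> hyb \<pi> A x y \<in> cyl"
  by (auto simp: cyl_def hyb_def)

text \<open>A certificate that \<open>B\<close> is relevant: flipping \<open>i\<close> moves
  \<open>z\<close> out of \<open>S\<close>. As \<open>i\<close> is the only variable of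
  \<open>J\<close> in its block, substituting the block of \<open>x\<close> into \<open>z\<close>
  reads off whether \<open>x\<close> and \<open>z\<close> agree at \<open>i\<close>.\<close>

definition witness :: "nat set \<Rightarrow> nat \<Rightarrow> nat set \<Rightarrow> nat \<Rightarrow> bool" where
  "witness D B z i \<longleftrightarrow> i \<in> J \<and> i \<in> D \<and> \<pi> i = B \<and> z \<in> cyl \<and> F (z \<inter> J) \<and> \<not> F ((z \<inter> J) \<oplus> {i})"

definition valid :: "state \<Rightarrow> bool" where
  "valid = (\<lambda>(I, Z, D). finite I \<and> D \<subseteq> {..<n} \<and> D \<inter> V = {} \<and> (\<forall>B\<in>I. \<exists>i. witness D B (Z B) i))"

end

locale factored_state = factored_oracle n \<pi> h S V J \<alpha> F + state n \<pi> I Z D h S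
  for n \<pi> h S V J \<alpha> F I Z D +
  fixes \<iota> :: "nat \<Rightarrow> nat"
  assumes DV: "D \<inter> V = {}" and wit: "\<And>B. B \<in> I \<Longrightarrow> witness D B (Z B) (\<iota> B)"
begin

lemma \<iota>: "B \<in> I \<Longrightarrow> \<iota> B \<in> J \<and> \<iota> B \<in> D \<and> \<pi> (\<iota> B) = B"
  using wit by (simp add: witness_def)

lemma \<iota>_unique: "i \<in> J \<Longrightarrow> \<pi> i \<in> I \<Longrightarrow> i = \<iota> (\<pi> i)"
  using \<iota>[of "\<pi> i"] J(3) by (metis inj_onD)

lemma card_I: "card I \<le> card J"
proof (rule card_inj_on_le[of \<iota>])
  show "inj_on \<iota> I" using \<iota> by (metis inj_onI)
  show "\<iota> ` I \<subseteq> J" using \<iota> by blast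
  show "finite J" using J(1) by (rule finite_subset) simp
qed

lemma pat_cyl:
  assumes x: "x \<in> cyl" shows "pat x = {B\<in>I. (\<iota> B \<in> x) \<noteq> (\<iota> B \<in> Z B)}"
proof -
  have "h (hyb \<pi> {B} x (Z B)) \<longleftrightarrow> (\<iota> B \<in> x \<longleftrightarrow> \<iota> B \<in> Z B)" if B: "B \<in> I" for B
  proof -
    note w = wit[OF B, unfolded witness_def]
    have "hyb \<pi> {B} x (Z B) \<in> cyl" using x w by (intro cyl_hyb) auto
    then have h: "h (hyb \<pi> {B} x (Z B)) \<longleftrightarrow> F (hyb \<pi> {B} x (Z B) \<inter> J)" by (rule h_cyl)
    have mem: "i \<in> hyb \<pi> {B} x (Z B) \<longleftrightarrow> (if i = \<iota> B then i \<in> x else i \<in> Z B)" if "i \<in> J" for i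
    proof -
      have "\<pi> i = B \<longleftrightarrow> i = \<iota> B" using that w J(3) by (metis inj_onD)
      then show ?thesis by (auto simp: hyb_def)
    qed
    show ?thesis
    proof (cases "\<iota> B \<in> x \<longleftrightarrow> \<iota> B \<in> Z B")
      case True
      then have "hyb \<pi> {B} x (Z B) \<inter> J = Z B \<inter> J" using mem by (auto split: if_splits)
      then show ?thesis using h True w by simp
    next
      case False
      have "hyb \<pi> {B} x (Z B) \<inter> J = (Z B \<inter> J) \<oplus> {\<iota> B}"
      proof (rule set_eqI)
        fix i
        show "i \<in> hyb \<pi> {B} x (Z B) \<inter> J \<longleftrightarrow> i \<in> (Z B \<inter> J) \<oplus> {\<iota> B}"
          using mem[of i] False w by (cases "i = \<iota> B") auto
      qed
      then show ?thesis using h False w by simp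
    qed
  qed
  then show ?thesis unfolding pattern_def by blast
qed

lemma mem_dd: "B \<in> I \<Longrightarrow> \<iota> B \<in> dd b \<longleftrightarrow> B \<in> b"
  using \<iota>[of B] by auto

lemma cyl_dd: "x \<in> cyl \<Longrightarrow> x \<oplus> dd b \<in> cyl"
  using DV dd_subset by (intro cyl_xor) auto

lemma pat_xor:
  assumes "x \<in> cyl" "x \<oplus> v \<in> cyl"
  shows "pat (x \<oplus> v) = pat x \<oplus> {B\<in>I. \<iota> B \<in> v}"
  unfolding pat_cyl[OF assms(1)] pat_cyl[OF assms(2)] by (rule set_eqI) auto

lemma pat_dd: 
  assumes "x \<in> cyl" "b \<subseteq> I" shows "pat (x \<oplus> dd b) = pat x \<oplus> b"
proof -
  have "{B\<in>I. \<iota> B \<in> dd b} = b" using mem_dd assms(2) by blast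
  then show ?thesis using pat_xor[OF assms(1) cyl_dd[OF assms(1)]] by simp
qed

lemma nrm_cyl: "x \<in> cyl \<Longrightarrow> nrm x \<in> cyl"
  unfolding normalize_def by (rule cyl_dd)

lemma pat_nrm: "x \<in> cyl \<Longrightarrow> pat (nrm x) = {}"
  using pat_dd[of x "pat x"] pattern_subset unfolding normalize_def by simp

lemma nrm_\<iota>: "x \<in> cyl \<Longrightarrow> B \<in> I \<Longrightarrow> \<iota> B \<in> nrm x \<longleftrightarrow> \<iota> B \<in> Z B"
  using pat_nrm[of x] pat_cyl[OF nrm_cyl, of x] by blast

text \<open>Equal patterns make the start of the path agree with \<open>x\<close> on
  \<open>J\<close>, and the path ends in \<open>w\<close>, so \<open>h\<close> drops at some step.
  That step changes one block, hence one variable of \<open>J\<close>, which is the new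
  witness.\<close>

lemma new_block_valid:
  assumes x: "x \<in> S" and w: "w \<in> cyl" "pat w = pat x" "\<not> h w" and l: "\<pi> ` {..<n} \<subseteq> {..<l}"
  obtains I' Z' D' where "new_block \<pi> l (I, Z, D) h x w = Extend (I', Z', D')" "valid (I', Z', D')"
    "card I' = Suc (card I)"
proof -
  note xc = S_cyl[OF x]
  define z where "z = (\<lambda>j. hyb \<pi> (I \<union> {..<j}) w x)"
  have zc: "z j \<in> cyl" for j unfolding z_def by (intro cyl_hyb w xc)
  have "i \<in> z 0 \<longleftrightarrow> i \<in> x" if i: "i \<in> J" for i
  proof (cases "\<pi> i \<in> I")
    case True
    then have "i = \<iota> (\<pi> i)" by (rule \<iota>_unique[OF i])
    moreover have "\<iota> (\<pi> i) \<in> w \<longleftrightarrow> \<iota> (\<pi> i) \<in> x"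
      using w(2) True unfolding pat_cyl[OF w(1)] pat_cyl[OF xc] by blast
    ultimately show ?thesis using True by (simp add: z_def hyb_def)
  qed (simp add: z_def hyb_def)
  then have "z 0 \<inter> J = x \<inter> J" by blast
  then have h0: "h (z 0)" using h_cyl[OF zc] mem_S_cyl[OF xc] x by simp
  have "z l = w"
  proof (rule set_eqI)
    fix i
    show "i \<in> z l \<longleftrightarrow> i \<in> w"
    proof (cases "i < n")
      case True
      then have "\<pi> i < l" using l by auto
      then show ?thesis by (simp add: z_def hyb_def)
    next
      case False
      then show ?thesis using cyl_subset[OF zc, of l] cyl_subset[OF w(1)] by blast
    qed
  qed
  then have hl: "\<not> h (z l)" using w by simp
  have "\<exists>j<l. drops \<pi> I h x w j"
  proof (rule ccontr)
    assume *: "\<not> ?thesis"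
    have "j \<le> l \<Longrightarrow> h (z j)" for j
    proof (induction j)
      case (Suc j)
      then show ?case using * unfolding drops_def z_def[symmetric] by (metis Suc_leD Suc_le_lessD z_def)
    qed (use h0 in simp)
    then show False using hl by blast
  qed
  then obtain s' where s': "new_block \<pi> l (I, Z, D) h x w = Extend s'"
    by (simp add: new_block_def Let_def)
  then obtain j where j: "j < l" "drops \<pi> I h x w j" and
    s'_eq: "s' = (insert j I, Z(j := z j), D \<union> (x \<oplus> w) \<inter> \<pi> -` {j})"
    unfolding z_def by (rule new_block_Extend)
  have jI: "j \<notin> I" by (rule drops_not_mem[OF j(2)])
  have drop: "F (z j \<inter> J)" "\<not> F (z (Suc j) \<inter> J)"
    using j(2) h_cyl[OF zc] unfolding drops_def z_def[symmetric] by (simp_all add: z_def)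
  then have "z j \<inter> J \<noteq> z (Suc j) \<inter> J" by auto
  then obtain i where i: "i \<in> J" "(i \<in> z j) \<noteq> (i \<in> z (Suc j))" by blast
  then have \<pi>i: "\<pi> i = j" and iw: "(i \<in> x) \<noteq> (i \<in> w)"
    by (auto simp: z_def hyb_def less_Suc_eq)
  have same: "i' \<in> z (Suc j) \<longleftrightarrow> i' \<in> z j" if "i' \<in> J" "i' \<noteq> i" for i'
  proof -
    have "\<pi> i' \<noteq> j" using that i(1) \<pi>i J(3) by (metis inj_onD)
    then show ?thesis by (auto simp: z_def hyb_def less_Suc_eq)
  qed
  have flip: "z (Suc j) \<inter> J = (z j \<inter> J) \<oplus> {i}"
  proof (rule set_eqI)
    fix i'
    show "i' \<in> z (Suc j) \<inter> J \<longleftrightarrow> i' \<in> (z j \<inter> J) \<oplus> {i}"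
      using same[of i'] i by (cases "i' = i") auto
  qed
  let ?D = "D \<union> (x \<oplus> w) \<inter> \<pi> -` {j}"
  have "(x \<oplus> w) \<inter> V = {}" by (rule cyl_diff[OF xc w(1)])
  then have "?D \<inter> V = {}" using DV by blast
  moreover have "x \<oplus> w \<subseteq> {..<n}" by (rule xor_subset[OF cyl_subset[OF xc] cyl_subset[OF w(1)]])
  then have "?D \<subseteq> {..<n}" using D by blast
  moreover have "witness ?D j (z j) i"
    unfolding witness_def using i(1) \<pi>i iw zc[of j] drop flip by simp
  moreover have "witness ?D B (Z B) (\<iota> B)" if "B \<in> I" for B
    using wit[OF that] by (simp add: witness_def)
  ultimately have "valid s'"
    unfolding valid_def s'_eq using fin_I jI by auto
  moreover have "card (insert j I) = Suc (card I)" using jI fin_I by simp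
  ultimately show thesis using that s' unfolding s'_eq by blast
qed

text \<open>Of the recorded change only \<open>\<iota> B\<close> belongs to \<open>J\<close>. The
  part containing it alters the pattern; the other part alters nothing on which \<open>h\<close>
  depends.\<close>

lemma flip_kept:
  assumes x: "x \<in> S" and B: "B \<in> I"
  shows "kept \<pi> I Z h (pat x) (x \<oplus> (m \<inter> dd {B})) \<longleftrightarrow> \<iota> B \<notin> m"
    "kept \<pi> I Z h (pat x) (x \<oplus> (dd {B} - m)) \<longleftrightarrow> \<iota> B \<in> m"
proof -
  note xc = S_cyl[OF x]
  have *: "kept \<pi> I Z h (pat x) (x \<oplus> v) \<longleftrightarrow> \<iota> B \<notin> v" if v: "v \<subseteq> dd {B}" for v
  proof -
    have "v \<inter> V = {}" "v \<subseteq> {..<n}" using v DV dd_subset by blast+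
    then have c: "x \<oplus> v \<in> cyl" by (intro cyl_xor xc)
    show ?thesis
    proof (cases "\<iota> B \<in> v")
      case True
      then have "\<not> pat (x \<oplus> v) = pat x"
        unfolding pat_cyl[OF c] pat_cyl[OF xc] using B by auto
      then show ?thesis using True by (simp add: kept_def)
    next
      case False
      have vJ: "i \<notin> v" if "i \<in> J" for i
      proof
        assume "i \<in> v"
        then have "\<pi> i = B" using v by blast
        then show False using \<iota>_unique[OF that] B False \<open>i \<in> v\<close> by simp
      qed
      then have "(x \<oplus> v) \<inter> J = x \<inter> J" by (auto simp: set_eq_iff)
      then have "h (x \<oplus> v)" using h_cyl[OF c] mem_S_cyl[OF xc] x by simp
      moreover have "pat (x \<oplus> v) = pat x"
      proof -
        have e: "{B\<in>I. \<iota> B \<in> v} = {}" using vJ \<iota> by blast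
        show ?thesis unfolding pat_xor[OF xc c] e by (rule xor_empty)
      qed
      ultimately show ?thesis using False by (simp add: kept_def)
    qed
  qed
  show "kept \<pi> I Z h (pat x) (x \<oplus> (m \<inter> dd {B})) \<longleftrightarrow> \<iota> B \<notin> m"
    using \<iota>[OF B] by (subst *) auto
  show "kept \<pi> I Z h (pat x) (x \<oplus> (dd {B} - m)) \<longleftrightarrow> \<iota> B \<in> m"
    using \<iota>[OF B] by (subst *) auto
qed

text \<open>Normalized samples agree at every \<open>\<iota> B\<close>, so masking their difference
  does not touch the variables already found. Both candidate points therefore have the pattern of
  \<open>x\<close>, and one that is outside \<open>S\<close> reveals a further block.\<close>

lemma probe_valid:
  assumes S: "x \<in> S" "y \<in> S" "z \<in> S" and m: "m \<subseteq> {..<n}" and l: "\<pi> ` {..<n} \<subseteq> {..<l}"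
  shows "probe \<pi> l (I, Z, D) h x y z m = Pass \<or>
    (\<exists>I' Z' D'. probe \<pi> l (I, Z, D) h x y z m = Extend (I', Z', D') \<and> valid (I', Z', D') \<and> card I' = Suc (card I))"
proof -
  note c = S[THEN S_cyl]
  define u where "u = m \<inter> (nrm y \<oplus> nrm z)"
  define w1 where "w1 = x \<oplus> u"
  define w2 where "w2 = nrm y \<oplus> dd (pat x)"
  have "u \<inter> V = {}" unfolding u_def using cyl_diff[OF nrm_cyl nrm_cyl, OF c(2,3)] by blast
  then have w1: "w1 \<in> cyl" unfolding w1_def using m by (intro cyl_xor c) (auto simp: u_def)
  have e: "{B\<in>I. \<iota> B \<in> u} = {}"
    unfolding u_def using nrm_\<iota>[OF c(2)] nrm_\<iota>[OF c(3)] by auto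
  have p1: "pat w1 = pat x"
    using pat_xor[OF c(1), of u] w1 unfolding w1_def e xor_empty by blast
  have w2: "w2 \<in> cyl" unfolding w2_def by (intro cyl_dd nrm_cyl c)
  have p2: "pat w2 = pat x"
    unfolding w2_def using pat_dd[OF nrm_cyl[OF c(2)] pattern_subset] pat_nrm[OF c(2)] by simp
  have flips: "\<not> (\<exists>B\<in>I. kept \<pi> I Z h (pat x) (x \<oplus> (m \<inter> dd {B})) = kept \<pi> I Z h (pat x) (x \<oplus> (dd {B} - m)))"
    using flip_kept[OF S(1)] by simp
  have "probe \<pi> l (I, Z, D) h x y z m =
     (if \<not> h w1 then new_block \<pi> l (I, Z, D) h x w1 else if \<not> h w2 then new_block \<pi> l (I, Z, D) h x w2 else Pass)"
    unfolding probe_def check_def prod.case u_def[symmetric] w1_def[symmetric] w2_def[symmetric] p1 p2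
    using flips by (simp only: simp_thms if_False)
  moreover obtain I1 Z1 D1 where "\<not> h w1 \<longrightarrow> new_block \<pi> l (I, Z, D) h x w1 = Extend (I1, Z1, D1) \<and> valid (I1, Z1, D1) \<and> card I1 = Suc (card I)"
    using new_block_valid[OF S(1) w1 p1 _ l] by metis
  moreover obtain I2 Z2 D2 where "\<not> h w2 \<longrightarrow> new_block \<pi> l (I, Z, D) h x w2 = Extend (I2, Z2, D2) \<and> valid (I2, Z2, D2) \<and> card I2 = Suc (card I)"
    using new_block_valid[OF S(1) w2 p2 _ l] by metis
  ultimately show ?thesis by auto
qed

text \<open>The variables of unfound blocks are fixed as in the normalized point: terms that they
  falsify are dropped (\<open>live\<close>), and the remaining literals become conditions on which
  blocks are flipped (\<open>tr\<close>).\<close>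

lemma slice_dnfs:
  assumes F: "\<And>c. c \<subseteq> J \<Longrightarrow> F c \<longleftrightarrow> (\<exists>T\<in>set Ts. \<forall>(i, v)\<in>T. (i \<in> c) = v)"
    and Ts: "length Ts \<le> r" "\<And>T. T \<in> set Ts \<Longrightarrow> vars T \<subseteq> J" and y: "y \<in> S"
  shows "slice y \<in> dnfs I r"
proof -
  define t where "t = nrm y"
  have tc: "t \<in> cyl" unfolding t_def by (rule nrm_cyl[OF S_cyl[OF y]])
  have t\<iota>: "\<iota> B \<in> t \<longleftrightarrow> \<iota> B \<in> Z B" if "B \<in> I" for B
    unfolding t_def by (rule nrm_\<iota>[OF S_cyl[OF y] that])
  define live :: "literal set \<Rightarrow> bool" where "live T \<longleftrightarrow> (\<forall>(i, v)\<in>T. \<pi> i \<notin> I \<longrightarrow> (i \<in> t) = v)" for T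
  define tr :: "literal set \<Rightarrow> literal set"
    where "tr T = (\<lambda>(i, v). (\<pi> i, v \<noteq> (i \<in> t))) ` {(i, v)\<in>T. \<pi> i \<in> I}" for T
  let ?Ts = "map tr (filter live Ts)"
  have "b \<in> slice y \<longleftrightarrow> b \<subseteq> I \<and> (\<exists>T\<in>set ?Ts. \<forall>(B, v)\<in>T. (B \<in> b) = v)" for b
  proof (cases "b \<subseteq> I")
    case True
    have mem: "i \<in> t \<oplus> dd b \<longleftrightarrow> (i \<in> t) \<noteq> (\<pi> i \<in> b)" if i: "i \<in> J" for i
    proof (cases "\<pi> i \<in> I")
      case True
      then have "i \<in> D" using \<iota>_unique[OF i] \<iota> by metis
      then show ?thesis by simp
    next
      case False
      then show ?thesis using \<open>b \<subseteq> I\<close> by auto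
    qed
    have literals: "(\<forall>(i, v)\<in>T. (i \<in> (t \<oplus> dd b) \<inter> J) = v) \<longleftrightarrow> live T \<and> (\<forall>(B, v)\<in>tr T. (B \<in> b) = v)"
      if T: "T \<in> set Ts" for T
    proof -
      have iJ: "i \<in> J" if "(i, v) \<in> T" for i v using Ts(2)[OF T] that by (force simp: vars_def)
      have "(\<forall>(i, v)\<in>T. (i \<in> (t \<oplus> dd b) \<inter> J) = v) \<longleftrightarrow> (\<forall>(i, v)\<in>T. ((i \<in> t) \<noteq> (\<pi> i \<in> b)) = v)"
        using mem iJ by (intro ball_cong refl) (auto simp del: mem_xor)
      also have "\<dots> \<longleftrightarrow> (\<forall>(i, v)\<in>T. (\<pi> i \<notin> I \<longrightarrow> (i \<in> t) = v) \<and> (\<pi> i \<in> I \<longrightarrow> (\<pi> i \<in> b) = (v \<noteq> (i \<in> t))))"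
        using True by (intro ball_cong refl) auto
      also have "\<dots> \<longleftrightarrow> live T \<and> (\<forall>(B, v)\<in>tr T. (B \<in> b) = v)"
        unfolding live_def tr_def by fastforce
      finally show ?thesis .
    qed
    have "b \<in> slice y \<longleftrightarrow> h (t \<oplus> dd b)" using True by (simp add: slice_def t_def)
    also have "\<dots> \<longleftrightarrow> F ((t \<oplus> dd b) \<inter> J)" by (rule h_cyl[OF cyl_dd[OF tc]])
    also have "\<dots> \<longleftrightarrow> (\<exists>T\<in>set Ts. \<forall>(i, v)\<in>T. (i \<in> (t \<oplus> dd b) \<inter> J) = v)" by (rule F) simp
    also have "\<dots> \<longleftrightarrow> (\<exists>T\<in>set Ts. live T \<and> (\<forall>(B, v)\<in>tr T. (B \<in> b) = v))"
      by (rule bex_cong[OF refl literals])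
    also have "\<dots> \<longleftrightarrow> b \<subseteq> I \<and> (\<exists>T\<in>set ?Ts. \<forall>(B, v)\<in>T. (B \<in> b) = v)" using True by auto
    finally show ?thesis .
  qed (simp add: slice_def)
  then have "slice y = {b. b \<subseteq> I \<and> (\<exists>T\<in>set ?Ts. \<forall>(B, v)\<in>T. (B \<in> b) = v)}" by blast
  moreover have "length ?Ts \<le> r" using le_trans[OF length_filter_le Ts(1)] by simp
  moreover have "\<forall>T\<in>set ?Ts. vars T \<subseteq> I" by (auto simp: vars_def tr_def)
  ultimately show ?thesis unfolding dnfs_def by blast
qed

text \<open>A point is recovered from its normalization and its pattern, so the points over
  \<open>t\<close> correspond to the patterns that \<open>t\<close> admits.\<close>

lemma fibre_bij:
  assumes t: "t \<in> nrm ` S"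
  shows "bij_betw pat {y\<in>S. nrm y = t} {b. b \<subseteq> I \<and> h (t \<oplus> dd b)}"
proof -
  obtain y0 where y0: "y0 \<in> S" "t = nrm y0" using t by blast
  have tc: "t \<in> cyl" unfolding y0 by (rule nrm_cyl[OF S_cyl[OF y0(1)]])
  have tp: "pat t = {}" unfolding y0 by (rule pat_nrm[OF S_cyl[OF y0(1)]])
  have restore: "nrm y \<oplus> dd (pat y) = y" for y by (simp add: normalize_def)
  have pat_b: "pat (t \<oplus> dd b) = b" if "b \<subseteq> I" for b using pat_dd[OF tc that] tp by simp
  show ?thesis
  proof (rule bij_betw_byWitness[where f' = "\<lambda>b. t \<oplus> dd b"])
    show "\<forall>y\<in>{y\<in>S. nrm y = t}. t \<oplus> dd (pat y) = y" using restore by auto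
    show "\<forall>b\<in>{b. b \<subseteq> I \<and> h (t \<oplus> dd b)}. pat (t \<oplus> dd b) = b" using pat_b by simp
    show "pat ` {y\<in>S. nrm y = t} \<subseteq> {b. b \<subseteq> I \<and> h (t \<oplus> dd b)}"
    proof (intro image_subsetI CollectI conjI)
      fix y assume y: "y \<in> {y\<in>S. nrm y = t}"
      show "pat y \<subseteq> I" by (rule pattern_subset)
      show "h (t \<oplus> dd (pat y))" using y restore[of y] mem_S[OF S_subset] by auto
    qed
    show "(\<lambda>b. t \<oplus> dd b) ` {b. b \<subseteq> I \<and> h (t \<oplus> dd b)} \<subseteq> {y\<in>S. nrm y = t}"
    proof (intro image_subsetI CollectI conjI)
      fix b assume b: "b \<in> {b. b \<subseteq> I \<and> h (t \<oplus> dd b)}"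
      then show "t \<oplus> dd b \<in> S" using mem_S[OF cyl_subset[OF cyl_dd[OF tc]]] by simp
      show "nrm (t \<oplus> dd b) = t" unfolding normalize_def using b pat_b by simp
    qed
  qed
qed

text \<open>Minimality of \<open>f\<close> turns \<open>card (f - slice y)\<close> into \<open>card (slice y - f)\<close>: the points of
  \<open>S\<close> that are normalized to the same point are in bijection with a slice.\<close>
lemma slice_count:
  assumes f: "finite f" and P: "\<And>y. y \<in> S \<Longrightarrow> P \<subseteq> slice y \<Longrightarrow> card f \<le> card (slice y)"
  shows "(\<Sum>y\<in>S. card (f - slice y)) \<le> card f * (card {y\<in>S. \<not> P \<subseteq> slice y} + card {x\<in>S. pat x \<notin> f})"
proof -
  let ?w = "\<lambda>y. card f * (of_bool (\<not> P \<subseteq> slice y) + of_bool (pat y \<notin> f))"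
  have group: "(\<Sum>y\<in>S. a y) = (\<Sum>t\<in>nrm ` S. \<Sum>y\<in>{y\<in>S. nrm y = t}. a y)" for a :: "nat set \<Rightarrow> nat"
    by (rule sum.image_gen[OF finite_S])
  have "(\<Sum>y\<in>S. card (f - slice y)) \<le> (\<Sum>y\<in>S. ?w y)"
    unfolding group
  proof (rule sum_mono)
    fix t assume t: "t \<in> nrm ` S"
    define f' where "f' = {b. b \<subseteq> I \<and> h (t \<oplus> dd b)}"
    let ?Y = "{y\<in>S. nrm y = t}"
    have slice: "slice y = f'" if "y \<in> ?Y" for y using that by (simp add: slice_def f'_def)
    have bij: "bij_betw pat ?Y f'" unfolding f'_def by (rule fibre_bij[OF t])
    have fin: "finite f'" unfolding f'_def using fin_I by simp
    have cardY: "card ?Y = card f'" by (rule bij_betw_same_card[OF bij])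
    have Y: "?Y \<noteq> {}" using t by blast
    have "(\<Sum>y\<in>?Y. card (f - slice y)) = (\<Sum>y\<in>?Y. card (f - f'))" by (rule sum.cong) (simp_all add: slice)
    also have "\<dots> = card f' * card (f - f')" using cardY by simp
    also have "\<dots> \<le> card f * (card f' * of_bool (\<not> P \<subseteq> f') + card (f' - f))"
    proof (cases "P \<subseteq> f'")
      case True
      then have le: "card f \<le> card f'" using P Y slice by auto
      \<comment> \<open>After adding \<open>card f * card (f \<inter> f')\<close> to both sides, the
        claim is just \<open>card f \<le> card f'\<close>.\<close>
      have "card f' * card (f - f') + card f * card (f \<inter> f') \<le> card f' * card (f - f') + card f' * card (f \<inter> f')"
        using le by simp
      also have "\<dots> = card f' * card f" using f by (simp flip: add_mult_distrib2 add: card_Int_Diff[of f f'] add.commute)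
      also have "\<dots> = card f * (card (f' - f) + card (f \<inter> f'))"
        using fin by (simp add: card_Int_Diff[of f' f] Int_commute add.commute)
      finally show ?thesis using True by (simp add: distrib_left)
    next
      case False
      have "card (f - f') \<le> card f" using f by (intro card_mono) auto
      then have "card f' * card (f - f') \<le> card f' * card f" by simp
      then show ?thesis using False by (simp add: distrib_left mult.commute trans_le_add1)
    qed
    also have "card (f' - f) = (\<Sum>y\<in>?Y. of_bool (pat y \<notin> f))"
    proof -
      have "(\<Sum>y\<in>?Y. of_bool (pat y \<notin> f)) = (\<Sum>b\<in>f'. of_bool (b \<notin> f) :: nat)"
        by (rule sum.reindex_bij_betw[OF bij])
      then show ?thesis using fin by (simp add: of_bool_def sum.If_cases Int_def set_diff_eq)
    qed
    also have "card f' * of_bool (\<not> P \<subseteq> f') = (\<Sum>y\<in>?Y. of_bool (\<not> P \<subseteq> f'))" using cardY by simp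
    also have "\<dots> = (\<Sum>y\<in>?Y. of_bool (\<not> P \<subseteq> slice y))" by (rule sum.cong) (simp_all add: slice)
    also have "card f * (\<dots> + (\<Sum>y\<in>?Y. of_bool (pat y \<notin> f))) = (\<Sum>y\<in>?Y. ?w y)"
      by (simp add: sum.distrib sum_distrib_left distrib_left)
    finally show "(\<Sum>y\<in>?Y. card (f - slice y)) \<le> (\<Sum>y\<in>?Y. ?w y)" .
  qed
  also have "\<dots> = card f * (card {y\<in>S. \<not> P \<subseteq> slice y} + card {x\<in>S. pat x \<notin> f})"
    using finite_S by (simp add: sum.distrib distrib_left of_bool_def sum.If_cases Int_def flip: sum_distrib_left)
  finally show ?thesis .
qed

end

section \<open>Acceptance and rejection\<close>

lemma round_support:
  assumes "finite S" "S \<noteq> {}" "u \<in> set_pmf (test_round n \<pi> l (pmf_of_set S) h s)"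
  obtains x y z m where "x \<in> S" "y \<in> S" "z \<in> S" "m \<subseteq> {..<n}" "u = probe \<pi> l s h x y z m"
proof -
  have "set_pmf (pmf_of_set (Pow {..<n})) = Pow {..<n}" by (rule set_pmf_of_set) auto
  with assms that show thesis unfolding test_round_def by auto
qed

context factored_oracle
begin

lemma factored_stateI:
  assumes "valid (I, Z, D)"
  shows "\<exists>\<iota>. factored_state n \<pi> h S V J \<alpha> F I Z D \<iota>"
proof -
  obtain \<iota> where \<iota>: "\<And>B. B \<in> I \<Longrightarrow> witness D B (Z B) (\<iota> B)"
    using assms unfolding valid_def by (auto simp: Ball_def) metis
  have "factored_state n \<pi> h S V J \<alpha> F I Z D \<iota>"
    by unfold_locales (use assms \<iota> S_def' S_ne' in \<open>auto simp: valid_def\<close>)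
  then show ?thesis by blast
qed

lemma search_accepts:
  fixes \<delta> :: real and r d3 k3 k k4 \<mu> :: nat
  assumes l: "\<pi> ` {..<n} \<subseteq> {..<l}" and card_J: "card J \<le> \<mu>"
    and F: "\<And>c. c \<subseteq> J \<Longrightarrow> F c \<longleftrightarrow> (\<exists>T\<in>set Ts. \<forall>(i, v)\<in>T. (i \<in> c) = v)"
    and Ts: "length Ts \<le> r" "\<And>T. T \<in> set Ts \<Longrightarrow> vars T \<subseteq> J"
    and r: "0 < r" and d3: "0 < d3" and k3: "k3 = d3 * ((2 * \<mu> + 1) * r + d3)" and pos: "0 < \<delta>" "0 < k"
  shows "measure_pmf.prob (search (test_round n \<pi> l (pmf_of_set S) h) (verify \<pi> r k3 k4 (pmf_of_set S) h) k (Suc \<mu>) ({}, \<lambda>_. {}, {})) {False}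
    \<le> Suc \<mu> / (k * \<delta>) + k4 * (k3 * \<delta> + 2 / d3)"
proof -
  \<comment> \<open>With equality, running out of stages would mean \<open>Suc \<mu>\<close>
    relevant blocks, more than there are variables in \<open>J\<close>.\<close>
  define Inv :: "nat \<Rightarrow> state \<Rightarrow> bool" where "Inv = (\<lambda>j s. valid s \<and> card (fst s) + j = Suc \<mu>)"
  have finS: "finite S" by (rule finite_subset[of _ "Pow {..<n}"]) (auto simp: S_def')
  have outcome: "u = Pass \<or> (\<exists>s'. u = Extend s' \<and> valid s' \<and> card (fst s') = Suc (card (fst s)))"
    if s: "valid s" and u: "u \<in> set_pmf (test_round n \<pi> l (pmf_of_set S) h s)" for s u
  proof -
    obtain I Z D where s_eq: "s = (I, Z, D)" by (cases s)
    obtain \<iota> where "factored_state n \<pi> h S V J \<alpha> F I Z D \<iota>" using factored_stateI s s_eq by blast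
    then interpret factored_state n \<pi> h S V J \<alpha> F I Z D \<iota> .
    obtain x y z m where "x \<in> S" "y \<in> S" "z \<in> S" "m \<subseteq> {..<n}" "u = probe \<pi> l (I, Z, D) h x y z m"
      using u unfolding s_eq by (rule round_support[OF finS S_ne'])
    then show ?thesis using probe_valid[OF _ _ _ _ l, of x y z m] s_eq by fastforce
  qed
  show ?thesis
  proof (rule search_error[where Inv = Inv and wrong = False])
    fix s assume inv: "Inv 0 s"
    obtain I Z D where s_eq: "s = (I, Z, D)" by (cases s)
    have "valid (I, Z, D)" and c: "card I = Suc \<mu>" using inv s_eq by (simp_all add: Inv_def)
    then obtain \<iota> where "factored_state n \<pi> h S V J \<alpha> F I Z D \<iota>" using factored_stateI by blast
    then interpret factored_state n \<pi> h S V J \<alpha> F I Z D \<iota> .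
    show False using card_I c card_J by simp
  next
    fix j s assume "Inv (Suc j) s" "Abort \<in> set_pmf (test_round n \<pi> l (pmf_of_set S) h s)"
    then show False using outcome[of s Abort] by (simp add: Inv_def)
  next
    fix j s s' assume "Inv (Suc j) s" "Extend s' \<in> set_pmf (test_round n \<pi> l (pmf_of_set S) h s)"
    then show "Inv j s'" using outcome[of s "Extend s'"] by (simp add: Inv_def)
  next
    fix j s assume inv: "Inv (Suc j) s" and round: "measure_pmf.prob (test_round n \<pi> l (pmf_of_set S) h s) {u. u \<noteq> Pass} \<le> \<delta>"
    obtain I Z D where s_eq: "s = (I, Z, D)" by (cases s)
    have "valid (I, Z, D)" using inv s_eq by (simp add: Inv_def)
    then obtain \<iota> where "factored_state n \<pi> h S V J \<alpha> F I Z D \<iota>" using factored_stateI by blast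
    then interpret factored_state n \<pi> h S V J \<alpha> F I Z D \<iota> .
    have "card I \<le> \<mu>" using inv s_eq by (simp add: Inv_def)
    then show "measure_pmf.prob (verify \<pi> r k3 k4 (pmf_of_set S) h s) {False} \<le> k4 * (k3 * \<delta> + 2 / d3)"
      unfolding s_eq using r d3 k3 round[unfolded s_eq]
      by (intro verify_reject slice_dnfs[OF F Ts] slice_count)
  next
    show "Inv (Suc \<mu>) ({}, \<lambda>_. {}, {})" by (simp add: Inv_def valid_def)
  qed (use pos in auto)
qed

end

text \<open>Early rejection is never an error here, so the invariant tracks only sizes and
  ranges.\<close>

lemma search_rejects:
  fixes \<delta> \<delta>4 :: real and r d3 k3 k k4 \<mu> :: nat
  assumes S: "S = {x. x \<subseteq> {..<n} \<and> h x}" "S \<noteq> {}"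
    and r: "0 < r" and d3: "0 < d3" and k3: "k3 = d3 * ((2 * \<mu> + 1) * r + d3)" and pos: "0 < \<delta>" "0 < k"
    and \<delta>: "\<delta> \<le> \<delta>4 / 100" "1 / d3 \<le> \<delta>4 / 100" "\<delta>4 \<le> 1 / 100" "0 < \<delta>4" "0 < k4"
    and far: "\<And>S'. S' \<subseteq> Pow {..<n} \<Longrightarrow> factored_dnf n r \<mu> (\<lambda>x. bits x \<in> S') \<Longrightarrow>
      real (card (S - S')) + real (card (S' - S)) > 2 * \<delta>4 * card S"
  shows "measure_pmf.prob (search (test_round n \<pi> l (pmf_of_set S) h) (verify \<pi> r k3 k4 (pmf_of_set S) h) k (Suc \<mu>) ({}, \<lambda>_. {}, {})) {True}
    \<le> Suc \<mu> / (k * \<delta>) + (1 / d3 + 1 / (k4 * \<delta>4))"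
proof -
  define Inv :: "nat \<Rightarrow> state \<Rightarrow> bool"
    where "Inv = (\<lambda>j (I, Z, D). finite I \<and> D \<subseteq> {..<n} \<and> card I + j \<le> Suc \<mu>)"
  have finS: "finite S" by (rule finite_subset[of _ "Pow {..<n}"]) (auto simp: S)
  show ?thesis
  proof (rule search_error[where Inv = Inv and wrong = True])
    fix j s s' assume inv: "Inv (Suc j) s" and ext: "Extend s' \<in> set_pmf (test_round n \<pi> l (pmf_of_set S) h s)"
    obtain I Z D where s_eq: "s = (I, Z, D)" by (cases s)
    interpret state n \<pi> I Z D h S
      by unfold_locales (use inv S in \<open>auto simp: Inv_def s_eq\<close>)
    obtain x y z m where xyz: "x \<in> S" "y \<in> S" "z \<in> S" "m \<subseteq> {..<n}"
        and p: "probe \<pi> l (I, Z, D) h x y z m = Extend s'"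
      using ext unfolding s_eq by (rule round_support[OF finS S(2)]) auto
    obtain w where w: "w = x \<oplus> (m \<inter> (nrm y \<oplus> nrm z)) \<or> w = nrm y \<oplus> dd (pat x)" "new_block \<pi> l (I, Z, D) h x w = Extend s'"
      using probe_Extend[OF p] by metis
    have "m \<inter> (nrm y \<oplus> nrm z) \<subseteq> {..<n}" using xyz(4) by blast
    then have "w \<subseteq> {..<n}"
      using w(1) xor_subset[OF S_subset[OF xyz(1)]] xor_subset[OF \<tau>_subset[OF xyz(2)] dd_subset] by blast
    then have "x \<oplus> w \<subseteq> {..<n}" by (rule xor_subset[OF S_subset[OF xyz(1)]])
    then have "snd (snd s') \<subseteq> {..<n}" using w(2) D by (elim new_block_Extend) auto
    moreover have "finite (fst s')" "card (fst s') \<le> Suc (card I)"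
      using round_Extend_card[OF ext] fin_I by (auto simp: s_eq)
    ultimately show "Inv j s'" using inv by (auto simp: Inv_def s_eq)
  next
    fix j s assume inv: "Inv (Suc j) s" and round: "measure_pmf.prob (test_round n \<pi> l (pmf_of_set S) h s) {u. u \<noteq> Pass} \<le> \<delta>"
    obtain I Z D where s_eq: "s = (I, Z, D)" by (cases s)
    interpret state n \<pi> I Z D h S
      by unfold_locales (use inv S in \<open>auto simp: Inv_def s_eq\<close>)
    have "card I \<le> \<mu>" using inv by (simp add: Inv_def s_eq)
    then show "measure_pmf.prob (verify \<pi> r k3 k4 (pmf_of_set S) h s) {True} \<le> 1 / d3 + 1 / (k4 * \<delta>4)"
      unfolding s_eq by (rule verify_accept[OF r _ d3 k3 round[unfolded s_eq] \<delta>(1-3) \<delta>(4,5) far])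
  next
    show "Inv (Suc \<mu>) ({}, \<lambda>_. {}, {})" by (simp add: Inv_def)
    show "0 \<le> 1 / d3 + 1 / (k4 * \<delta>4)" using \<delta>(4) by simp
  qed (use pos in auto)
qed

section \<open>Transfer to bit lists and random partitions\<close>

lemma finite_cube: "finite (cube n)"
  using finite_lists_length_eq[of "UNIV :: bool set" n] by (simp add: cube_def)

lemma inj_on_bits: "inj_on bits (cube n)"
  by (rule inj_on_inverseI[where g = "word n"]) (simp add: cube_def word_bits)

lemma bits_ones: "bits ` ones n h = {x. x \<subseteq> {..<n} \<and> h (word n x)}"
proof (intro equalityI subsetI)
  fix x assume "x \<in> {x. x \<subseteq> {..<n} \<and> h (word n x)}"
  then have "word n x \<in> ones n h" "bits (word n x) = x"
    by (auto simp: ones_def cube_def bits_word)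
  then show "x \<in> bits ` ones n h" by (metis image_eqI)
qed (auto simp: ones_def cube_def word_bits dest!: subsetD[OF bits_subset[OF refl]])

lemma sample_eq:
  assumes "ones n h \<noteq> {}"
  shows "sample n h = pmf_of_set {x. x \<subseteq> {..<n} \<and> h (word n x)}"
proof -
  have "finite (ones n h)" using finite_cube[of n] by (simp add: ones_def)
  moreover have "inj_on bits (ones n h)" by (rule inj_on_subset[OF inj_on_bits]) (auto simp: ones_def)
  ultimately have "map_pmf bits (pmf_of_set (ones n h)) = pmf_of_set {x. x \<subseteq> {..<n} \<and> h (word n x)}"
    using assms by (simp add: map_pmf_of_set_inj bits_ones)
  moreover have "samp n h = map_pmf Some (pmf_of_set (ones n h))" using assms unfolding samp_def by simp
  ultimately show ?thesis by (simp only: sample_def pmf.map_comp o_def option.sel)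
qed

lemma reldist_bits:
  fixes n :: nat and h :: "bool list \<Rightarrow> bool" and S' :: "nat set set"
  assumes S': "S' \<subseteq> Pow {..<n}"
  defines "S \<equiv> {x. x \<subseteq> {..<n} \<and> h (word n x)}"
  shows "reldist n h (\<lambda>x. bits x \<in> S') = (real (card (S - S')) + real (card (S' - S))) / card S"
proof -
  let ?h' = "\<lambda>x. bits x \<in> S'"
  have S'_eq: "S' = {x. x \<subseteq> {..<n} \<and> ?h' (word n x)}" using S' by (auto simp: bits_word Int_absorb2)
  have sub: "ones n f \<subseteq> cube n" for f by (auto simp: ones_def)
  have fin: "finite (ones n f)" for f using finite_cube finite_subset[OF sub] by blast
  have card_diff: "card (ones n f - ones n f') = card (bits ` ones n f - bits ` ones n f')" for f f'
  proof -
    have "bits ` (ones n f - ones n f') = bits ` ones n f - bits ` ones n f'"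
      by (rule inj_on_image_set_diff[OF inj_on_bits]) (use sub in auto)
    moreover have "card (bits ` (ones n f - ones n f')) = card (ones n f - ones n f')"
      by (rule card_image[OF inj_on_subset[OF inj_on_bits]]) (use sub in auto)
    ultimately show ?thesis by simp
  qed
  have "card (sym_diff (ones n h) (ones n ?h')) = card (ones n h - ones n ?h') + card (ones n ?h' - ones n h)"
    by (rule card_Un_disjoint) (use fin in auto)
  also have "\<dots> = card (S - S') + card (S' - S)"
    unfolding card_diff bits_ones S_def[symmetric] S'_eq[symmetric] ..
  moreover have "card (ones n h) = card S"
    unfolding S_def bits_ones[symmetric] by (rule card_image[symmetric, OF inj_on_subset[OF inj_on_bits sub]])
  ultimately show ?thesis by (simp add: reldist_def)
qed

text \<open>In a collision \<open>\<pi> i\<close> is determined by \<open>\<pi> j\<close>, so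
  overwriting it by any of \<open>l\<close> values is injective and multiplies the number of
  colliding maps by \<open>l\<close>.\<close>

lemma collision_prob:
  fixes n l i j :: nat
  assumes "0 < l" "i < n" "j < n" "i \<noteq> j"
  shows "measure_pmf.prob (pmf_of_set ({..<n} \<rightarrow>\<^sub>E {..<l})) {\<pi>. \<pi> i = \<pi> j} \<le> 1 / l"
proof -
  let ?P = "{..<n} \<rightarrow>\<^sub>E {..<l}"
  have fin: "finite ?P" by (intro finite_PiE) auto
  have ne: "?P \<noteq> {}" using assms by (auto simp: PiE_eq_empty_iff)
  have "card ((?P \<inter> {\<pi>. \<pi> i = \<pi> j}) \<times> {..<l}) \<le> card ?P"
  proof (rule card_inj_on_le[where f = "\<lambda>(\<pi>, c). \<pi>(i := c)"])
    show "inj_on (\<lambda>(\<pi>, c). \<pi>(i := c)) ((?P \<inter> {\<pi>. \<pi> i = \<pi> j}) \<times> {..<l})"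
    proof (rule inj_onI, clarify)
      fix \<pi> c \<pi>' c' assume \<pi>: "\<pi> i = \<pi> j" "\<pi>' i = \<pi>' j" and eq: "\<pi>(i := c) = \<pi>'(i := c')"
      have v: "(\<pi>(i := c)) a = (\<pi>'(i := c')) a" for a using eq by simp
      have "\<pi> a = \<pi>' a" for a using v[of a] v[of j] \<pi> assms(4) by (cases "a = i") auto
      then show "\<pi> = \<pi>' \<and> c = c'" using v[of i] by auto
    qed
    show "(\<lambda>(\<pi>, c). \<pi>(i := c)) ` ((?P \<inter> {\<pi>. \<pi> i = \<pi> j}) \<times> {..<l}) \<subseteq> ?P"
    proof clarify
      fix \<pi> c assume "\<pi> \<in> ?P" "c < l"
      then have "\<pi>(i := c) \<in> insert i {..<n} \<rightarrow>\<^sub>E {..<l}" by (intro PiE_fun_upd) simp_all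
      then show "\<pi>(i := c) \<in> ?P" using assms(2) by (simp add: insert_absorb)
    qed
  qed (rule fin)
  then have "real (card (?P \<inter> {\<pi>. \<pi> i = \<pi> j})) * l \<le> real (card ?P)"
    by (simp add: card_cartesian_product flip: of_nat_mult)
  moreover have "card ?P > 0" using fin ne by (simp add: card_gt_0_iff)
  ultimately show ?thesis
    unfolding measure_pmf_of_set[OF ne fin]
    by (intro mult_imp_div_pos_le) (use assms(1) in \<open>simp_all add: pos_le_divide_eq\<close>)
qed

lemma inj_prob:
  fixes n l \<mu> :: nat
  assumes l: "0 < l" and J: "J \<subseteq> {..<n}" "card J \<le> \<mu>"
  shows "measure_pmf.prob (pmf_of_set ({..<n} \<rightarrow>\<^sub>E {..<l})) {\<pi>. \<not> inj_on \<pi> J} \<le> \<mu>\<^sup>2 / l"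
proof -
  let ?M = "pmf_of_set ({..<n} \<rightarrow>\<^sub>E {..<l})"
  let ?A = "{(i, j) \<in> J \<times> J. i \<noteq> j}"
  have finJ: "finite J" using J(1) by (rule finite_subset) simp
  have finA: "finite ?A" by (rule finite_subset[of _ "J \<times> J"]) (use finJ in auto)
  have "card ?A \<le> card (J \<times> J)" by (rule card_mono) (use finJ in auto)
  also have "\<dots> \<le> \<mu>\<^sup>2" using J(2) by (simp add: card_cartesian_product power2_eq_square mult_le_mono)
  finally have card_A: "card ?A \<le> \<mu>\<^sup>2" .
  have "measure_pmf.prob ?M {\<pi>. \<not> inj_on \<pi> J} \<le> measure_pmf.prob ?M (\<Union>p\<in>?A. {\<pi>. \<pi> (fst p) = \<pi> (snd p)})"
    by (rule measure_pmf.finite_measure_mono) (auto simp: inj_on_def)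
  also have "\<dots> \<le> (\<Sum>p\<in>?A. measure_pmf.prob ?M {\<pi>. \<pi> (fst p) = \<pi> (snd p)})"
    by (intro measure_pmf.finite_measure_subadditive_finite finA) auto
  also have "\<dots> \<le> (\<Sum>p\<in>?A. 1 / l)"
    using J(1) by (intro sum_mono collision_prob l) auto
  also have "\<dots> = card ?A / l" by simp
  also have "\<dots> \<le> \<mu>\<^sup>2 / l" using card_A by (intro divide_right_mono) (simp_all flip: of_nat_power)
  finally show ?thesis .
qed

text \<open>\<open>B\<close> stands for the partitions to be discarded: those that do not separate
  the term variables for completeness, none for soundness.\<close>

lemma tester_nonempty:
  fixes n r \<mu> l k k3 k4 :: nat and h :: "bool list \<Rightarrow> bool"
  assumes ne: "ones n h \<noteq> {}" and l: "0 < l"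
  defines "S \<equiv> {x. x \<subseteq> {..<n} \<and> h (word n x)}"
  defines "search' \<equiv> \<lambda>\<pi>. search (test_round n \<pi> l (pmf_of_set S) (\<lambda>x. h (word n x)))
         (verify \<pi> r k3 k4 (pmf_of_set S) (\<lambda>x. h (word n x))) k (Suc \<mu>) ({}, \<lambda>_. {}, {})"
  assumes good: "\<And>\<pi>. \<pi> ` {..<n} \<subseteq> {..<l} \<Longrightarrow> \<pi> \<notin> B \<Longrightarrow> measure_pmf.prob (search' \<pi>) {v} \<le> q" and "0 \<le> q"
  shows "measure_pmf.prob (tester n r \<mu> l k k3 k4 h) {v} \<le>
    measure_pmf.prob (pmf_of_set ({..<n} \<rightarrow>\<^sub>E {..<l})) B + q"
proof -
  let ?P = "{..<n} \<rightarrow>\<^sub>E {..<l}"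
  have P: "finite ?P" "?P \<noteq> {}" using l by (auto intro!: finite_PiE simp: PiE_eq_empty_iff)
  have S: "sample n h = pmf_of_set S" unfolding S_def by (rule sample_eq[OF ne])
  have fin: "finite (ones n h)" using finite_cube[of n] by (simp add: ones_def)
  have inner: "measure_pmf.prob (pmf_of_set ?P \<bind> search') {v} \<le> measure_pmf.prob (pmf_of_set ?P) B + q"
  proof (rule prob_bind_le_except)
    fix \<pi> assume "\<pi> \<in> set_pmf (pmf_of_set ?P)" "\<pi> \<notin> B"
    then show "measure_pmf.prob (search' \<pi>) {v} \<le> q"
      using P by (intro good) auto
  qed fact
  have "measure_pmf.prob (tester n r \<mu> l k k3 k4 h) {v} \<le>
      measure_pmf.prob (samp n h) {} + (measure_pmf.prob (pmf_of_set ?P) B + q)"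
    unfolding tester_def S
  proof (rule prob_bind_le_except)
    fix u assume "u \<in> set_pmf (samp n h)"
    then have u: "u \<noteq> None" using ne fin by (auto simp: samp_def)
    show "measure_pmf.prob (if u = None then return_pmf True else pmf_of_set ?P \<bind> (\<lambda>\<pi>.
        search (test_round n \<pi> l (pmf_of_set S) (\<lambda>x. h (word n x)))
         (verify \<pi> r k3 k4 (pmf_of_set S) (\<lambda>x. h (word n x))) k (Suc \<mu>) ({}, \<lambda>_. {}, {}))) {v}
      \<le> measure_pmf.prob (pmf_of_set ?P) B + q"
      unfolding if_not_P[OF u] using inner unfolding search'_def .
  qed (use \<open>0 \<le> q\<close> in simp)
  then show ?thesis by simp
qed

lemma tester_accepts:
  fixes \<delta> :: real and r d3 k3 k k4 l \<mu> :: nat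
  assumes h: "factored_dnf n r \<mu> h" and r: "0 < r" and d3: "0 < d3" and k3: "k3 = d3 * ((2 * \<mu> + 1) * r + d3)"
    and pos: "0 < \<delta>" "0 < k" "0 < l"
  shows "measure_pmf.prob (tester n r \<mu> l k k3 k4 h) {False} \<le>
     \<mu>\<^sup>2 / l + (Suc \<mu> / (k * \<delta>) + k4 * (k3 * \<delta> + 2 / d3))"
proof (cases "ones n h = {}")
  case True
  then show ?thesis using pos by (simp add: tester_def samp_def bind_return_pmf)
next
  case False
  obtain H :: "literal set" and Ts :: "literal set list" where *: "length Ts \<le> r \<and>
        vars H \<subseteq> {..<n} \<and> (\<Union>T\<in>set Ts. vars T) \<subseteq> {..<n} \<and>
        vars H \<inter> (\<Union>T\<in>set Ts. vars T) = {} \<and>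
        card (\<Union>T\<in>set Ts. vars T) \<le> \<mu> \<and>
        (\<forall>x\<in>cube n. h x \<longleftrightarrow> conj_true H x \<and> (\<exists>T\<in>set Ts. conj_true T x))"
    using h unfolding factored_dnf_def by (elim exE) (rule that)
  then have Ts: "length Ts \<le> r" and H: "vars H \<subseteq> {..<n}" and J: "(\<Union>T\<in>set Ts. vars T) \<subseteq> {..<n}"
    and disj: "vars H \<inter> (\<Union>T\<in>set Ts. vars T) = {}" and card_J: "card (\<Union>T\<in>set Ts. vars T) \<le> \<mu>"
    and h_eq: "\<And>x. x \<in> cube n \<Longrightarrow> h x \<longleftrightarrow> conj_true H x \<and> (\<exists>T\<in>set Ts. conj_true T x)"
    by blast+
  define V where "V = vars H"
  define J where "J = (\<Union>T\<in>set Ts. vars T)"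
  define S where "S = {x. x \<subseteq> {..<n} \<and> h (word n x)}"
  define F where "F c \<longleftrightarrow> (\<exists>T\<in>set Ts. \<forall>(i, v)\<in>T. (i \<in> c) = v)" for c
  have S_ne: "S \<noteq> {}" using False bits_ones[of n h] unfolding S_def by (metis image_is_empty)
  then obtain x0 where x0: "x0 \<subseteq> {..<n}" "h (word n x0)" by (auto simp: S_def)
  \<comment> \<open>Since \<open>h\<close> has a one, \<open>H\<close> is not contradictory, and any
    one shows the values that \<open>H\<close> prescribes.\<close>
  define \<alpha> where "\<alpha> = x0 \<inter> V"
  have conj_H: "conj_true H (word n x) \<longleftrightarrow> (\<forall>(i, b)\<in>H. (i \<in> x) = b)" for x
    unfolding conj_true_def using H by (intro ball_cong refl) (force simp: vars_def)
  have conj_T: "conj_true T (word n x) \<longleftrightarrow> (\<forall>(i, v)\<in>T. (i \<in> x \<inter> J) = v)" if "T \<in> set Ts" for T x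
    unfolding conj_true_def using J that by (intro ball_cong refl) (force simp: vars_def J_def)
  have cube: "word n x \<in> cube n" for x by (simp add: cube_def)
  have H0: "\<forall>(i, b)\<in>H. (i \<in> x0) = b" using x0 h_eq[OF cube] conj_H by blast
  have H_iff: "conj_true H (word n x) \<longleftrightarrow> x \<inter> V = \<alpha>" for x
  proof
    assume "conj_true H (word n x)"
    then have *: "\<forall>(i, b)\<in>H. (i \<in> x) = b" by (simp add: conj_H)
    have "i \<in> x \<longleftrightarrow> i \<in> x0" if "i \<in> V" for i
    proof -
      have "i \<in> fst ` H" using that by (simp add: V_def vars_def)
      then obtain b where "(i, b) \<in> H" by (metis imageE prod.collapse)
      then show ?thesis using * H0 by auto
    qed
    then show "x \<inter> V = \<alpha>" unfolding \<alpha>_def by blast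
  next
    assume *: "x \<inter> V = \<alpha>"
    show "conj_true H (word n x)"
      unfolding conj_H
    proof clarify
      fix i b assume ib: "(i, b) \<in> H"
      then have "i \<in> V" by (force simp: V_def vars_def)
      then have "i \<in> x \<longleftrightarrow> i \<in> x0" using * unfolding \<alpha>_def by blast
      then show "(i \<in> x) = b" using H0 ib by auto
    qed
  qed
  have h_iff: "h (word n x) \<longleftrightarrow> x \<inter> V = \<alpha> \<and> F (x \<inter> J)" for x
    unfolding h_eq[OF cube] H_iff F_def using conj_T by auto
  have "measure_pmf.prob (tester n r \<mu> l k k3 k4 h) {False} \<le>
     measure_pmf.prob (pmf_of_set ({..<n} \<rightarrow>\<^sub>E {..<l})) {\<pi>. \<not> inj_on \<pi> J} + (Suc \<mu> / (k * \<delta>) + k4 * (k3 * \<delta> + 2 / d3))"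
  proof (rule tester_nonempty[OF False pos(3), folded S_def])
    fix \<pi> assume \<pi>: "\<pi> ` {..<n} \<subseteq> {..<l}" "\<pi> \<notin> {\<pi>. \<not> inj_on \<pi> J}"
    interpret factored_oracle n \<pi> "\<lambda>x. h (word n x)" S V J \<alpha> F
      by unfold_locales (use S_ne J disj \<pi> h_iff in \<open>auto simp: S_def V_def J_def\<close>)
    show "measure_pmf.prob (search (test_round n \<pi> l (pmf_of_set S) (\<lambda>x. h (word n x)))
         (verify \<pi> r k3 k4 (pmf_of_set S) (\<lambda>x. h (word n x))) k (Suc \<mu>) ({}, \<lambda>_. {}, {})) {False}
       \<le> Suc \<mu> / (k * \<delta>) + k4 * (k3 * \<delta> + 2 / d3)"
      by (rule search_accepts[OF \<pi>(1) _ F_def Ts _ r d3 k3 pos(1,2)]) (use card_J in \<open>auto simp: J_def\<close>)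
  qed (use pos in simp)
  moreover have "measure_pmf.prob (pmf_of_set ({..<n} \<rightarrow>\<^sub>E {..<l})) {\<pi>. \<not> inj_on \<pi> J} \<le> \<mu>\<^sup>2 / l"
    using inj_prob[OF pos(3), of J n \<mu>] J card_J by (simp add: J_def)
  ultimately show ?thesis by linarith
qed

lemma factored_dnf_False: "factored_dnf n r \<mu> (\<lambda>_. False)"
  unfolding factored_dnf_def by (intro exI[of _ "{}"] exI[of _ "[]"]) (simp add: vars_def)

lemma reldist_False: "reldist n h (\<lambda>_. False) = (if ones n h = {} then 0 else 1)"
proof -
  have "finite (ones n h)" using finite_cube[of n] by (simp add: ones_def)
  moreover have "ones n (\<lambda>_. False) = {}" by (simp add: ones_def)
  ultimately show ?thesis by (simp add: reldist_def)
qed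

lemma tester_rejects:
  fixes \<delta> \<delta>4 :: real and r d3 k3 k k4 l \<mu> :: nat
  assumes far: "\<And>h'. factored_dnf n r \<mu> h' \<Longrightarrow> reldist n h h' > \<epsilon>" and \<epsilon>: "2 * \<delta>4 \<le> \<epsilon>"
    and r: "0 < r" and d3: "0 < d3" and k3: "k3 = d3 * ((2 * \<mu> + 1) * r + d3)" and pos: "0 < \<delta>" "0 < k" "0 < l"
    and \<delta>: "\<delta> \<le> \<delta>4 / 100" "1 / d3 \<le> \<delta>4 / 100" "\<delta>4 \<le> 1 / 100" "0 < \<delta>4" "0 < k4"
  shows "measure_pmf.prob (tester n r \<mu> l k k3 k4 h) {True} \<le> Suc \<mu> / (k * \<delta>) + (1 / d3 + 1 / (k4 * \<delta>4))"
proof -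
  have ne: "ones n h \<noteq> {}"
    using far[OF factored_dnf_False] \<epsilon> \<delta>(4) unfolding reldist_False by (auto split: if_splits)
  define S where "S = {x. x \<subseteq> {..<n} \<and> h (word n x)}"
  have S_ne: "S \<noteq> {}" using ne bits_ones[of n h] unfolding S_def by (metis image_is_empty)
  have "finite S" by (rule finite_subset[of _ "Pow {..<n}"]) (auto simp: S_def)
  then have N: "real (card S) > 0" using S_ne by (simp add: card_gt_0_iff)
  have "measure_pmf.prob (tester n r \<mu> l k k3 k4 h) {True} \<le>
    measure_pmf.prob (pmf_of_set ({..<n} \<rightarrow>\<^sub>E {..<l})) {} + (Suc \<mu> / (k * \<delta>) + (1 / d3 + 1 / (k4 * \<delta>4)))"
  proof (rule tester_nonempty[OF ne pos(3), folded S_def])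
    fix \<pi> :: "nat \<Rightarrow> nat"
    show "measure_pmf.prob (search (test_round n \<pi> l (pmf_of_set S) (\<lambda>x. h (word n x)))
         (verify \<pi> r k3 k4 (pmf_of_set S) (\<lambda>x. h (word n x))) k (Suc \<mu>) ({}, \<lambda>_. {}, {})) {True}
       \<le> Suc \<mu> / (k * \<delta>) + (1 / d3 + 1 / (k4 * \<delta>4))"
    proof (rule search_rejects[OF S_def S_ne r d3 k3 pos(1,2) \<delta>])
      fix S' assume S': "S' \<subseteq> Pow {..<n}" "factored_dnf n r \<mu> (\<lambda>x. bits x \<in> S')"
      have "2 * \<delta>4 < (real (card (S - S')) + real (card (S' - S))) / card S"
        using far[OF S'(2)] \<epsilon> unfolding reldist_bits[OF S'(1)] S_def by linarith
      then show "real (card (S - S')) + real (card (S' - S)) > 2 * \<delta>4 * card S"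
        using N by (simp add: pos_less_divide_eq)
    qed
  qed (use pos \<delta> in simp)
  then show ?thesis by simp
qed

text \<open>With \<open>X\<close> for \<open>r / \<epsilon>\<close>, \<open>k3\<close> is of order
  \<open>\<mu> * X ^ 2\<close>, \<open>k4\<close> of order \<open>X\<close> and \<open>k\<close> of
  order \<open>\<mu> ^ 2 * X ^ 3\<close>. The number of stages contributes another factor
  \<open>\<mu>\<close> and the queries of a round a factor \<open>\<mu> ^ 2\<close>.\<close>

lemma query_bound:
  fixes X :: real and \<mu> r e :: nat
  assumes \<mu>: "1 \<le> \<mu>" and X: "1 \<le> X" "real r \<le> X" "real e \<le> 2 * X"
  defines "d3 \<equiv> 1000000 * e" and "k4 \<equiv> 10000 * e" and "l \<equiv> 20 * \<mu>\<^sup>2"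
  defines "k3 \<equiv> d3 * ((2 * \<mu> + 1) * r + d3)"
  defines "k \<equiv> 10000 * (\<mu> + 1) * k3 * k4"
  shows "real (1 + (Suc \<mu> * (k * (3 + 3 * \<mu> + 2 * (\<mu> + 1) + 2 * \<mu> * (\<mu> + 1) + 2 * (l + 1)))
     + (k3 * (1 + \<mu>) + k4 * (2 + \<mu>)))) \<le> 10 ^ 24 * \<mu> ^ 5 * X ^ 3"
proof -
  define m where "m = real \<mu>"
  have m: "1 \<le> m" using \<mu> by (simp add: m_def)
  have p: "1 \<le> m ^ a * X ^ b" for a b using m X(1) by (metis mult_mono' one_le_power mult_1 zero_le_one)
  have mono: "m ^ a * X ^ b \<le> m ^ a' * X ^ b'" if "a \<le> a'" "b \<le> b'" for a b a' b'
    using m X(1) that by (intro mult_mono power_increasing) auto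
  have d3: "real d3 \<le> 2000000 * X" using X(3) by (simp add: d3_def)
  have k4: "real k4 \<le> 20000 * X" using X(3) by (simp add: k4_def)
  have k3: "real k3 \<le> 10 ^ 13 * (m * X ^ 2)"
  proof -
    have "(2 * m + 1) * real r \<le> (3 * m) * X" using m X by (intro mult_mono) auto
    moreover have "X \<le> m * X" using m X by simp
    ultimately have "(2 * m + 1) * real r + real d3 \<le> 2000003 * (m * X)"
      using d3 by linarith
    then have "real d3 * ((2 * m + 1) * real r + real d3) \<le> (2000000 * X) * (2000003 * (m * X))"
      using d3 m X by (intro mult_mono) auto
    also have "\<dots> \<le> 10 ^ 13 * (m * X ^ 2)" using m X by (simp add: power2_eq_square)
    finally show ?thesis by (simp add: k3_def m_def algebra_simps)
  qed
  have k: "real k \<le> 4 * 10 ^ 21 * (m ^ 2 * X ^ 3)"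
  proof -
    have kk: "real k3 * real k4 \<le> (10 ^ 13 * (m * X ^ 2)) * (20000 * X)" using k3 k4 m X by (intro mult_mono) auto
    have "(m + 1) * (real k3 * real k4) \<le> (2 * m) * ((10 ^ 13 * (m * X ^ 2)) * (20000 * X))"
      by (rule mult_mono[OF _ kk]) (use m in auto)
    then have "10000 * ((m + 1) * (real k3 * real k4)) \<le> 10000 * ((2 * m) * ((10 ^ 13 * (m * X ^ 2)) * (20000 * X)))"
      by (rule mult_left_mono) simp
    also have "\<dots> = 4 * 10 ^ 21 * (m ^ 2 * X ^ 3)" by (simp add: power2_eq_square power3_eq_cube mult_ac)
    finally show ?thesis by (simp add: k_def m_def mult_ac add_ac)
  qed
  have q: "3 + 3 * m + 2 * (m + 1) + 2 * m * (m + 1) + 2 * (20 * m\<^sup>2 + 1) \<le> 60 * m\<^sup>2"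
  proof -
    have "m \<le> m\<^sup>2" "1 \<le> m\<^sup>2" using m by (auto simp: power2_eq_square intro: order_trans)
    then show ?thesis by (simp add: algebra_simps power2_eq_square)
  qed
  have kq: "real k * (3 + 3 * m + 2 * (m + 1) + 2 * m * (m + 1) + 2 * (20 * m\<^sup>2 + 1)) \<le> (4 * 10 ^ 21 * (m ^ 2 * X ^ 3)) * (60 * m\<^sup>2)"
    using k q m X by (intro mult_mono) auto
  have "(m + 1) * (real k * (3 + 3 * m + 2 * (m + 1) + 2 * m * (m + 1) + 2 * (20 * m\<^sup>2 + 1)))
     \<le> (2 * m) * ((4 * 10 ^ 21 * (m ^ 2 * X ^ 3)) * (60 * m\<^sup>2))"
    by (rule mult_mono[OF _ kq]) (use m in auto)
  also have "\<dots> = 480 * 10 ^ 21 * (m ^ 5 * X ^ 3)" by (simp add: power2_eq_square eval_nat_numeral)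
  finally have A: "(m + 1) * (real k * (3 + 3 * m + 2 * (m + 1) + 2 * m * (m + 1) + 2 * (20 * m\<^sup>2 + 1))) \<le> 480 * 10 ^ 21 * (m ^ 5 * X ^ 3)" .
  have "real k3 * (1 + m) \<le> (10 ^ 13 * (m * X ^ 2)) * (2 * m)" using k3 m X by (intro mult_mono) auto
  also have "\<dots> = 2 * 10 ^ 13 * (m ^ 2 * X ^ 2)" by (simp add: power2_eq_square)
  also have "\<dots> \<le> 2 * 10 ^ 13 * (m ^ 5 * X ^ 3)" by (intro mult_left_mono mono) auto
  finally have B: "real k3 * (1 + m) \<le> 2 * 10 ^ 13 * (m ^ 5 * X ^ 3)" .
  have "real k4 * (2 + m) \<le> (20000 * X) * (3 * m)" using k4 m X by (intro mult_mono) auto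
  also have "\<dots> = 60000 * (m ^ 1 * X ^ 1)" by simp
  also have "\<dots> \<le> 60000 * (m ^ 5 * X ^ 3)" by (intro mult_left_mono mono) auto
  finally have C: "real k4 * (2 + m) \<le> 60000 * (m ^ 5 * X ^ 3)" .
  have "real (1 + (Suc \<mu> * (k * (3 + 3 * \<mu> + 2 * (\<mu> + 1) + 2 * \<mu> * (\<mu> + 1) + 2 * (l + 1)))
     + (k3 * (1 + \<mu>) + k4 * (2 + \<mu>)))) =
     1 + ((m + 1) * (real k * (3 + 3 * m + 2 * (m + 1) + 2 * m * (m + 1) + 2 * (20 * m\<^sup>2 + 1)))
       + (real k3 * (1 + m) + real k4 * (2 + m)))"
    by (simp add: l_def m_def algebra_simps)
  also have "\<dots> \<le> 10 ^ 24 * (m ^ 5 * X ^ 3)"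
  proof -
    have "1 + (a + (b + c)) \<le> 10 ^ 24 * Y"
      if "a \<le> 480 * 10 ^ 21 * Y" "b \<le> 2 * 10 ^ 13 * Y" "c \<le> 60000 * Y" "1 \<le> Y" for a b c Y :: real
      using that by simp
    then show ?thesis using A B C p[of 5 3] by blast
  qed
  finally show ?thesis by (simp add: m_def mult.assoc)
qed

lemma tester_exists:
  fixes n r \<mu> :: nat and \<epsilon> :: real
  assumes r: "0 < r" and \<mu>: "0 < \<mu>" and \<epsilon>: "0 < \<epsilon>"
  shows "\<exists>A. \<forall>h. (\<forall>(b, c) \<in> set_pmf (run n h A). real c \<le> 10 ^ 24 * real \<mu> ^ 5 * (real r / \<epsilon>) ^ 3) \<and>
      (factored_dnf n r \<mu> h \<longrightarrow> prob_accept n h A \<ge> 9 / 10) \<and>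
      ((\<forall>h'. factored_dnf n r \<mu> h' \<longrightarrow> reldist n h h' > \<epsilon>) \<longrightarrow> prob_reject n h A \<ge> 9 / 10)"
proof (cases "\<epsilon> \<ge> 1")
  case True
  \<comment> \<open>The constantly false function is within relative distance 1 of every
    \<open>h\<close>.\<close>
  have "\<not> (\<forall>h'. factored_dnf n r \<mu> h' \<longrightarrow> reldist n h h' > \<epsilon>)" for h
  proof
    assume "\<forall>h'. factored_dnf n r \<mu> h' \<longrightarrow> reldist n h h' > \<epsilon>"
    then have "reldist n h (\<lambda>_. False) > \<epsilon>" using factored_dnf_False by blast
    then show False using True \<epsilon> unfolding reldist_False by (auto split: if_splits)
  qed
  note vacuous = this
  show ?thesis
  proof (intro exI[of _ "Output True"] allI conjI impI)
    fix h
    show "\<forall>(b, c)\<in>set_pmf (run n h (Output True)). real c \<le> 10 ^ 24 * real \<mu> ^ 5 * (real r / \<epsilon>) ^ 3"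
      using \<epsilon> by simp
    show "9 / 10 \<le> prob_accept n h (Output True)" by (simp add: prob_accept_def)
    show "9 / 10 \<le> prob_reject n h (Output True)" if "\<forall>h'. factored_dnf n r \<mu> h' \<longrightarrow> reldist n h h' > \<epsilon>"
      using vacuous[of h] that by blast
  qed
next
  case False
  \<comment> \<open>An integer substitute for \<open>1 / \<epsilon>\<close>, as the repetition
    counts are natural numbers.\<close>
  define e where "e = nat \<lceil>1 / \<epsilon>\<rceil>"
  have e: "1 / \<epsilon> \<le> real e" "real e \<le> 1 / \<epsilon> + 1" "0 < e"
    using \<epsilon> by (auto simp: e_def)
  \<comment> \<open>The constants give a false rejection at most \<open>5/100\<close> from a bad
    partition, \<open>1/100\<close> from the search and \<open>3/100\<close> from the verification,
    of which \<open>2/100\<close> is \<open>2 * k4 / d3\<close>. A false acceptance costs at most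
    \<open>1/100\<close> for each of three terms.\<close>
  define d3 where "d3 = 1000000 * e"
  define k4 where "k4 = 10000 * e"
  define l where "l = 20 * \<mu>\<^sup>2"
  define k3 where "k3 = d3 * ((2 * \<mu> + 1) * r + d3)"
  define k where "k = 10000 * (\<mu> + 1) * k3 * k4"
  define \<delta>4 where "\<delta>4 = 1 / (100 * real e)"
  define \<delta> where "\<delta> = 1 / (100 * (real k3 * real k4))"
  have pos: "0 < d3" "0 < k4" "0 < l" "0 < \<delta>4"
    using e \<mu> by (simp_all add: d3_def k4_def l_def \<delta>4_def)
  moreover from pos have "0 < k3" by (simp add: k3_def)
  moreover from this pos have "0 < k" "0 < \<delta>" by (simp_all add: k_def \<delta>_def)
  ultimately have pos: "0 < d3" "0 < k4" "0 < l" "0 < k3" "0 < k" "0 < \<delta>4" "0 < \<delta>" by blast+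
  have "2 * \<delta>4 \<le> \<epsilon>"
  proof -
    have "1 \<le> \<epsilon> * real e" using e(1) \<epsilon> by (simp add: field_simps)
    then have "2 \<le> \<epsilon> * (100 * real e)" by linarith
    then show ?thesis unfolding \<delta>4_def using e(3) by (simp add: pos_divide_le_eq)
  qed
  moreover have "\<delta>4 \<le> 1 / 100" using e(3) by (simp add: \<delta>4_def field_simps)
  moreover have "1 / d3 \<le> \<delta>4 / 100" using e(3) by (simp add: d3_def \<delta>4_def field_simps)
  moreover have "\<delta> \<le> \<delta>4 / 100"
  proof -
    have "1 \<le> real k3" using pos by simp
    then have "10000 * real e * 1 \<le> 10000 * real e * real k3" by (intro mult_left_mono) auto
    then have "10000 * real e \<le> 100 * (real k3 * real k4)" by (simp add: k4_def mult_ac)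
    then have "1 / (100 * (real k3 * real k4)) \<le> 1 / (10000 * real e)"
      using e(3) pos by (intro divide_left_mono) auto
    then show ?thesis by (simp add: \<delta>_def \<delta>4_def)
  qed
  ultimately have \<delta>: "2 * \<delta>4 \<le> \<epsilon>" "\<delta> \<le> \<delta>4 / 100" "1 / d3 \<le> \<delta>4 / 100" "\<delta>4 \<le> 1 / 100" by auto
  have k\<delta>: "Suc \<mu> / (k * \<delta>) = 1 / 100" 
  proof -
    have "real k = 10000 * real (Suc \<mu>) * (real k3 * real k4)" by (simp add: k_def algebra_simps)
    then have "real k * \<delta> = 100 * real (Suc \<mu>)" using pos by (simp add: \<delta>_def del: of_nat_Suc)
    then show ?thesis by (simp del: of_nat_Suc)
  qed
  have k4\<delta>: "1 / (k4 * \<delta>4) = 1 / 100" using e(3) by (simp add: k4_def \<delta>4_def)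
  have k3\<delta>: "k4 * (k3 * \<delta> + 2 / d3) = 3 / 100"
    using pos e(3) by (simp add: \<delta>_def distrib_left) (simp add: k4_def d3_def)
  have l\<mu>: "\<mu>\<^sup>2 / l = 5 / 100" using \<mu> by (simp add: l_def)
  have acc: "measure_pmf.prob (tester n r \<mu> l k k3 k4 h) {False} \<le> 1 / 10" if "factored_dnf n r \<mu> h" for h
    using tester_accepts[OF that r pos(1) k3_def pos(7,5,3), of k4] unfolding k\<delta> k3\<delta> l\<mu> by simp
  have rej: "measure_pmf.prob (tester n r \<mu> l k k3 k4 h) {True} \<le> 1 / 10"
    if "\<And>h'. factored_dnf n r \<mu> h' \<Longrightarrow> reldist n h h' > \<epsilon>" for h
  proof -
    have "1 / real d3 \<le> 1 / 100" using \<delta> by simp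
    then show ?thesis
      using tester_rejects[OF that \<delta>(1) r pos(1) k3_def pos(7,5,3) \<delta>(2-4) pos(6,2)] unfolding k\<delta> k4\<delta> by linarith
  qed
  let ?q = "1 + (Suc \<mu> * (k * (3 + 3 * \<mu> + 2 * (\<mu> + 1) + 2 * \<mu> * (\<mu> + 1) + 2 * (l + 1)))
     + (k3 * (1 + \<mu>) + k4 * (2 + \<mu>)))"
  obtain A where A: "\<And>h. (\<forall>(b, c)\<in>set_pmf (run n h A). c \<le> ?q) \<and>
      map_pmf fst (run n h A) = tester n r \<mu> l k k3 k4 h"
    using computable_alg[OF computable_tester[OF r pos(4,3)]] by blast
  have X: "1 \<le> real r / \<epsilon>" "real r \<le> real r / \<epsilon>" "real e \<le> 2 * (real r / \<epsilon>)"
  proof -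
    have "\<epsilon> \<le> real r" using False r by linarith
    then show "1 \<le> real r / \<epsilon>" using \<epsilon> by simp
    show "real r \<le> real r / \<epsilon>" using False \<epsilon> by (simp add: pos_le_divide_eq mult_left_le)
    have "1 / \<epsilon> \<le> real r / \<epsilon>" using r \<epsilon> by (intro divide_right_mono) auto
    then show "real e \<le> 2 * (real r / \<epsilon>)" using e(2) \<open>1 \<le> real r / \<epsilon>\<close> by linarith
  qed
  have bound: "real ?q \<le> 10 ^ 24 * real \<mu> ^ 5 * (real r / \<epsilon>) ^ 3"
    using query_bound[of \<mu> "real r / \<epsilon>" r e] \<mu> X unfolding k_def k3_def k4_def d3_def l_def by simp
  have prob: "prob_accept n h A = measure_pmf.prob (tester n r \<mu> l k k3 k4 h) {True}"
    "prob_reject n h A = measure_pmf.prob (tester n r \<mu> l k k3 k4 h) {False}" for h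
  proof -
    have "{(b :: bool, c :: nat). b} = fst -` {True}" "{(b :: bool, c :: nat). \<not> b} = fst -` {False}"
      by (rule set_eqI, simp add: split_beta)+
    then show "prob_accept n h A = measure_pmf.prob (tester n r \<mu> l k k3 k4 h) {True}"
      "prob_reject n h A = measure_pmf.prob (tester n r \<mu> l k k3 k4 h) {False}"
      unfolding prob_accept_def prob_reject_def by (simp_all only: measure_map_pmf[symmetric] A)
  qed
  have compl: "measure_pmf.prob M {True} = 1 - measure_pmf.prob M {False}" for M :: "bool pmf"
  proof -
    have "{True} = - {False}" by auto
    then show ?thesis by (simp only: prob_compl_pmf)
  qed
  show ?thesis
  proof (intro exI[of _ A] allI conjI impI)
    fix h
    show "\<forall>(b, c)\<in>set_pmf (run n h A). real c \<le> 10 ^ 24 * real \<mu> ^ 5 * (real r / \<epsilon>) ^ 3"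
    proof clarify
      fix b c assume "(b, c) \<in> set_pmf (run n h A)"
      then have "c \<le> ?q" using A[of h] by blast
      then have "real c \<le> real ?q" by (simp only: of_nat_le_iff)
      then show "real c \<le> 10 ^ 24 * real \<mu> ^ 5 * (real r / \<epsilon>) ^ 3" using bound by (rule order_trans)
    qed
    show "prob_accept n h A \<ge> 9 / 10" if "factored_dnf n r \<mu> h"
      using acc[OF that] unfolding prob compl by simp
    show "prob_reject n h A \<ge> 9 / 10" if "\<forall>h'. factored_dnf n r \<mu> h' \<longrightarrow> reldist n h h' > \<epsilon>"
      using rej[of h] that unfolding prob compl by simp
  qed
qed

theorem theorem20:
  "\<exists>(A :: nat \<Rightarrow> nat \<Rightarrow> nat \<Rightarrow> real \<Rightarrow> oracle_alg) (p :: real poly poly).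
     \<forall>(n :: nat) (r :: nat) (\<mu> :: nat) (\<epsilon> :: real) (h :: bool list \<Rightarrow> bool).
       r > 0 \<longrightarrow> \<mu> > 0 \<longrightarrow> \<epsilon> > 0 \<longrightarrow>
         (\<forall>(b, c) \<in> set_pmf (run n h (A n r \<mu> \<epsilon>)).
            real c \<le> poly (poly p [:real \<mu>:]) (real r / \<epsilon>)) \<and>
         (factored_dnf n r \<mu> h \<longrightarrow> prob_accept n h (A n r \<mu> \<epsilon>) \<ge> 9 / 10) \<and>
         ((\<forall>h'. factored_dnf n r \<mu> h' \<longrightarrow> reldist n h h' > \<epsilon>) \<longrightarrow>
            prob_reject n h (A n r \<mu> \<epsilon>) \<ge> 9 / 10)"
proof -
  define good where "good n r \<mu> \<epsilon> A \<longleftrightarrow> (\<forall>h.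
      (\<forall>(b, c) \<in> set_pmf (run n h A). real c \<le> 10 ^ 24 * real \<mu> ^ 5 * (real r / \<epsilon>) ^ 3) \<and>
      (factored_dnf n r \<mu> h \<longrightarrow> prob_accept n h A \<ge> 9 / 10) \<and>
      ((\<forall>h'. factored_dnf n r \<mu> h' \<longrightarrow> reldist n h h' > \<epsilon>) \<longrightarrow> prob_reject n h A \<ge> 9 / 10))"
    for n r \<mu> :: nat and \<epsilon> :: real and A
  \<comment> \<open>The outer variable, evaluated at a constant polynomial, stands for
    \<open>\<mu>\<close>, the inner one for \<open>r / \<epsilon>\<close>.\<close>
  define p :: "real poly poly" where "p = monom (monom (10 ^ 24) 3) 5"
  have p: "poly (poly p [:real \<mu>:]) X = 10 ^ 24 * real \<mu> ^ 5 * X ^ 3" for \<mu> :: nat and X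
    by (simp add: p_def poly_monom)
  \<comment> \<open>The choice is made before \<open>h\<close> is given: \<open>good\<close>
    quantifies over \<open>h\<close>, so the tree depends on \<open>n\<close> and the parameters
    alone.\<close>
  have "good n r \<mu> \<epsilon> (SOME A. good n r \<mu> \<epsilon> A)" if "0 < r" "0 < \<mu>" "0 < \<epsilon>" for n r \<mu> \<epsilon>
    using tester_exists[OF that, of n] unfolding good_def[symmetric] by (rule someI_ex)
  then show ?thesis
    unfolding p[symmetric] good_def
    by (intro exI[of _ "\<lambda>n r \<mu> \<epsilon>. SOME A. good n r \<mu> \<epsilon> A"] exI[of _ p]) (simp add: good_def p)
qed

end
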